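(* The algebra homomorphism $\varphi:\mathbb{A}\to \mathcal{B}_{\rm aff}(S)$ from the affine nil-Hecke algebra $\mathbb{A}$ to the extended Nichols-Woronowicz algebra $\mathcal{B}_{\rm aff}(S)=\mathcal{B}_{\rm aff}\ltimes S$, given by $\tau_0\mapsto[\alpha_0,-1]$, $\tau_i\mapsto[\alpha_i,0]$ for $i=1,\ldots,r$, and $f\mapsto f$ for $f\in S$, is injective.
   Context: Root data: $G$ is a simply-connected complex Lie group with irreducible root system $\Delta$, positive roots $\Delta_+$, simple roots $\alpha_1,\ldots,\alpha_r$, highest root $\theta$, $\alpha_0:=-\theta$, Weyl group $W$, weight lattice $P$, coroot lattice $Q^\vee$, coroots $\alpha^\vee$, and natural pairing $\langle\cdot,\cdot\rangle$. For $\alpha\in\Delta$, $k\in\mathbb{Z}$, $s_{\alpha,k}$ is the affine reflection of $Q^\vee\otimes\mathbb{R}$ in $H_{\alpha,k}=\{\lambda:\langle\lambda,\alpha\rangle=k\}$, i.e. $s_{\alpha,k}(\lambda)=\lambda-(\langle\lambda,\alpha\rangle-k)\alpha^\vee$; $s_{\alpha,0}=s_\alpha$ is the usual reflection in $W$, which also acts on $P$. The affine Weyl group $W_{\rm aff}=W\ltimes Q^\vee$ is generated by all $s_{\alpha,k}$; $t_\lambda$ is translation by $\lambda\in Q^\vee$. It is a Coxeter group with simple reflections $s_0=s_{\theta,1}$, $s_i=s_{\alpha_i,0}$ ($1\le i\le r$); $m_{ij}$ is the order of $s_is_j$. Nil-Hecke algebra: the affine nil-Coxeter algebra $\mathbb{A}_0$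 is the associative $\mathbb{Q}$-algebra generated by $\tau_0,\ldots,\tau_r$ with relations $\tau_i^2=0$ and, for $i\ne j$ with $m_{ij}<\infty$, $\tau_i\tau_j\tau_i\cdots=\tau_j\tau_i\tau_j\cdots$ ($m_{ij}$ factors on each side). Let $S=\mathrm{Sym}(P\otimes\mathbb{Q})$ and, for $\alpha\in\Delta$, $\partial_\alpha(f)=(f-s_\alpha f)/\alpha$. $\mathbb{A}_0$ acts on $S$ by $\tau_i\mapsto\partial_{\alpha_i}$, $0\le i\le r$. The affine nil-Hecke algebra $\mathbb{A}=\mathbb{A}_0\ltimes S$ is the cross product (as a vector space $S\otimes\mathbb{A}_0$, containing $S$ and $\mathbb{A}_0$ as subalgebras) with cross relations $\tau_i f=\partial_{\alpha_i}(f)+s_{\alpha_i}(f)\tau_i$ for $f\in S$, $0\le i\le r$. Nichols-Woronowicz algebra: for a vector space $M$ with braiding $\psi$ on $M^{\otimes2}$ satisfying the braid relation, let $\psi_i$ be $\psi$ applied to factors $i,i+1$ of $M^{\otimes n}$; for a reduced expression $w=s_{i_1}\cdots s_{i_l}\in S_n$ (in simple transpositions) put $\Psi_w=\psi_{i_1}\cdots\psi_{i_l}$, and $\sigma_n=\sum_{w\in S_n}\Psi_w$. Then $\mathcal{B}(M)=\bigoplus_{n\ge0}M^{\otimes n}/\ker\sigma_n$. A Yetter-Drinfeld module over a group $\Gamma$ is a $\Gamma$-module $M=\bigoplus_{g\in\Gamma}M_g$ with $h(M_g)\subset M_{hgh^{-1}}$; its braiding is $\psi(a\otimes b)=g(b)\otimes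 a$ for $a\in M_g$, $b\in M$. Let $V_{\rm aff}$ be the $\mathbb{Q}$-vector space spanned by symbols $[\alpha,k]$, $\alpha\in\Delta$, $k\in\mathbb{Z}$, modulo $[\alpha,k]+[-\alpha,-k]=0$, with $W_{\rm aff}$-action $w[\alpha,k]=[w(\alpha),k]$ ($w\in W$), $t_\lambda[\alpha,k]=[\alpha,k+\langle\lambda,\alpha\rangle]$ ($\lambda\in Q^\vee$), and $[\alpha,k]$ of $W_{\rm aff}$-degree $s_{\alpha,k}$. It is a Yetter-Drinfeld module over $W_{\rm aff}$, and $\mathcal{B}_{\rm aff}:=\mathcal{B}(V_{\rm aff})$. The algebra $\mathcal{B}_{\rm aff}$ acts on $S$ by $[\alpha,k]\mapsto\partial_\alpha$. The algebra $\mathcal{B}_{\rm aff}(S)=\mathcal{B}_{\rm aff}\ltimes S$ is the cross product (as a vector space $S\otimes\mathcal{B}_{\rm aff}$, containing $S$ and $\mathcal{B}_{\rm aff}$ as subalgebras) with cross relations $[\alpha,k]f=\partial_\alpha f+s_{\alpha,0}(f)[\alpha,k]$, $f\in S$. The assignment in the claim is known to define an algebra homomorphism $\varphi$. *)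

theory Defs
  imports
    "HOL-Analysis.Analysis"
    "HOL-Algebra.QuotRing"
    "HOL-Algebra.Bij"
    "HOL-Algebra.Multiplicative_Group"
    "HOL-Library.Poly_Mapping"
    "HOL-Combinatorics.Permutations"
begin

abbreviation lookup :: "('a \<Rightarrow>\<^sub>0 'b::zero) \<Rightarrow> 'a \<Rightarrow> 'b"
  where "lookup \<equiv> Poly_Mapping.lookup"

abbreviation keys :: "('a \<Rightarrow>\<^sub>0 'b::zero) \<Rightarrow> 'a set"
  where "keys \<equiv> Poly_Mapping.keys"

abbreviation single :: "'a \<Rightarrow> 'b::zero \<Rightarrow> ('a \<Rightarrow>\<^sub>0 'b)"
  where "single \<equiv> Poly_Mapping.single"

abbreviation scale :: "'b::mult_zero \<Rightarrow> ('a \<Rightarrow>\<^sub>0 'b) \<Rightarrow> ('a \<Rightarrow>\<^sub>0 'b)"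
  where "scale c \<equiv> Poly_Mapping.map ((*) c)"


section \<open>Root data\<close>

text \<open>
  Roots live in a real Euclidean space \<open>'v\<close> whose inner product identifies
  \<open>Q\<^sup>\<or> \<otimes> \<real>\<close> with its dual \<open>P \<otimes> \<real>\<close>.  The coroot of \<open>\<alpha>\<close> becomes
  \<open>2\<alpha> / (\<alpha> \<bullet> \<alpha>)\<close>, and the pairing of \<open>\<lambda> \<in> Q\<^sup>\<or> \<otimes> \<real>\<close> with a weight is the
  inner product.
\<close>

definition coroot :: "'v::euclidean_space \<Rightarrow> 'v"
  where "coroot \<alpha> = (2 / (\<alpha> \<bullet> \<alpha>)) *\<^sub>R \<alpha>"

definition affine_reflection :: "'v::euclidean_space \<Rightarrow> int \<Rightarrow> 'v \<Rightarrow> 'v"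
  where "affine_reflection \<alpha> k v = v - (v \<bullet> \<alpha> - of_int k) *\<^sub>R coroot \<alpha>"

abbreviation reflection :: "'v::euclidean_space \<Rightarrow> 'v \<Rightarrow> 'v"
  where "reflection \<alpha> \<equiv> affine_reflection \<alpha> 0"

text \<open>Reduced crystallographic root systems, as they arise from complex semisimple groups.\<close>

definition root_system :: "'v::euclidean_space set \<Rightarrow> bool"
  where "root_system \<Delta> \<longleftrightarrow>
    finite \<Delta> \<and> span \<Delta> = UNIV \<and> 0 \<notin> \<Delta> \<and>
    (\<forall>\<alpha>\<in>\<Delta>. \<forall>\<beta>\<in>\<Delta>. reflection \<alpha> \<beta> \<in> \<Delta>) \<and>
    (\<forall>\<alpha>\<in>\<Delta>. \<forall>\<beta>\<in>\<Delta>. coroot \<alpha> \<bullet> \<beta> \<in> \<int>) \<and>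
    (\<forall>\<alpha>\<in>\<Delta>. \<forall>c. c *\<^sub>R \<alpha> \<in> \<Delta> \<longrightarrow> c = 1 \<or> c = -1)"

definition irreducible_root_system :: "'v::euclidean_space set \<Rightarrow> bool"
  where "irreducible_root_system \<Delta> \<longleftrightarrow>
    root_system \<Delta> \<and> \<Delta> \<noteq> {} \<and>
    \<not> (\<exists>A B. A \<noteq> {} \<and> B \<noteq> {} \<and> A \<union> B = \<Delta> \<and> A \<inter> B = {} \<and> (\<forall>\<alpha>\<in>A. \<forall>\<beta>\<in>B. \<alpha> \<bullet> \<beta> = 0))"

text \<open>
  The simple roots \<open>\<alpha>\<^sub>1, \<dots>, \<alpha>\<^sub>r\<close> are a family \<open>a\<close> indexed by a finite type with \<open>r\<close> elements.
\<close>

definition nonneg_combs :: "('i::finite \<Rightarrow> 'v::euclidean_space) \<Rightarrow> 'v set"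
  where "nonneg_combs a = {\<Sum>i\<in>UNIV. real (c i) *\<^sub>R a i | c. True}"

definition simple_roots :: "'v::euclidean_space set \<Rightarrow> ('i::finite \<Rightarrow> 'v) \<Rightarrow> bool"
  where "simple_roots \<Delta> a \<longleftrightarrow>
    inj a \<and> range a \<subseteq> \<Delta> \<and> independent (range a) \<and>
    (\<forall>\<beta>\<in>\<Delta>. \<beta> \<in> nonneg_combs a \<or> - \<beta> \<in> nonneg_combs a)"

definition positive_roots :: "'v::euclidean_space set \<Rightarrow> ('i::finite \<Rightarrow> 'v) \<Rightarrow> 'v set"
  where "positive_roots \<Delta> a = \<Delta> \<inter> nonneg_combs a"

definition highest_root :: "'v::euclidean_space set \<Rightarrow> ('i::finite \<Rightarrow> 'v) \<Rightarrow> 'v \<Rightarrow> bool"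
  where "highest_root \<Delta> a \<theta> \<longleftrightarrow> \<theta> \<in> \<Delta> \<and> (\<forall>\<beta>\<in>\<Delta>. \<theta> - \<beta> \<in> nonneg_combs a)"


section \<open>The symmetric algebra of the weight lattice\<close>

text \<open>
  The weight lattice \<open>P\<close> is free on the fundamental weights, so \<open>Sym(P \<otimes> \<rat>)\<close> is the
  polynomial ring over \<open>\<rat>\<close> in one variable for each fundamental weight.  A weight \<open>\<mu>\<close> is
  the linear form whose coefficients are the integers \<open>\<langle>\<alpha>\<^sub>i\<^sup>\<or>, \<mu>\<rangle>\<close>; the floor function only
  converts the type of these integers.
\<close>

type_synonym 'i sym = "('i \<Rightarrow>\<^sub>0 nat) \<Rightarrow>\<^sub>0 rat"

definition fund_weight :: "('i::finite \<Rightarrow> 'v::euclidean_space) \<Rightarrow> 'i \<Rightarrow> 'v"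
  where "fund_weight a i = (THE \<omega>. \<forall>j. coroot (a j) \<bullet> \<omega> = (if i = j then 1 else 0))"

definition sym_weight :: "('i::finite \<Rightarrow> 'v::euclidean_space) \<Rightarrow> 'v \<Rightarrow> 'i sym"
  where "sym_weight a \<mu> = (\<Sum>i\<in>UNIV. single (single i 1) (of_int \<lfloor>coroot (a i) \<bullet> \<mu>\<rfloor>))"

definition sym_subst :: "('i::finite \<Rightarrow> 'i sym) \<Rightarrow> 'i sym \<Rightarrow> 'i sym"
  where "sym_subst h f = (\<Sum>m\<in>keys f. single 0 (lookup f m) * (\<Prod>i\<in>UNIV. h i ^ lookup m i))"

text \<open>The algebra automorphism of \<open>S\<close> extending the reflection \<open>s\<^sub>\<alpha>\<close> of \<open>P\<close>.\<close>

definition sym_reflection :: "('i::finite \<Rightarrow> 'v::euclidean_space) \<Rightarrow> 'v \<Rightarrow> 'i sym \<Rightarrow> 'i sym"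
  where "sym_reflection a \<alpha> = sym_subst (\<lambda>i. sym_weight a (reflection \<alpha> (fund_weight a i)))"

definition divided_difference :: "('i::finite \<Rightarrow> 'v::euclidean_space) \<Rightarrow> 'v \<Rightarrow> 'i sym \<Rightarrow> 'i sym"
  where "divided_difference a \<alpha> f = (THE g. sym_weight a \<alpha> * g = f - sym_reflection a \<alpha> f)"


section \<open>Free algebras\<close>

text \<open>
  Lists under concatenation form the free monoid.  With this instance \<open>'x list \<Rightarrow>\<^sub>0 rat\<close>, with
  the convolution product of \<open>poly_mapping\<close>, is the free associative \<open>\<rat>\<close>-algebra
  on \<open>'x\<close>, that is, the tensor algebra of the vector space with basis \<open>'x\<close>.
\<close>

instantiation list :: (type) monoid_add
begin

definition zero_list_def: "(0 :: 'a list) = []"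
definition plus_list_def: "(xs :: 'a list) + ys = xs @ ys"

instance
  by standard (simp_all add: zero_list_def plus_list_def)

end

definition free_algebra :: "'x set \<Rightarrow> ('x list \<Rightarrow>\<^sub>0 rat) ring"
  where "free_algebra X =
    \<lparr>carrier = {p. keys p \<subseteq> lists X}, mult = (*), one = 1, zero = 0, add = (+)\<rparr>"

abbreviation word :: "'x list \<Rightarrow> ('x list \<Rightarrow>\<^sub>0 rat)"
  where "word w \<equiv> single w 1"


section \<open>Cross products\<close>

text \<open>
  Let every letter \<open>x\<close> come with an algebra endomorphism \<open>s x\<close> of \<open>S\<close> and an
  \<open>s x\<close>-twisted derivation \<open>d x\<close> of \<open>S\<close>.  Write \<open>T\<close> for the free algebra on \<open>X\<close>.
  The elements of \<open>S \<otimes> T\<close> are represented with coefficients in \<open>S\<close> written on the left of words.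
  The product is determined by the cross relations \<open>x f = d x f + s x f \<cdot> x\<close>:
  \<open>letter_mult\<close> is left multiplication by a letter.  It is not the convolution product of
  \<open>poly_mapping\<close>, in which coefficients commute with words.
\<close>

definition letter_mult ::
    "('x \<Rightarrow> 's \<Rightarrow> 's) \<Rightarrow> ('x \<Rightarrow> 's \<Rightarrow> 's) \<Rightarrow> 'x \<Rightarrow> ('x list \<Rightarrow>\<^sub>0 's) \<Rightarrow> ('x list \<Rightarrow>\<^sub>0 's::comm_ring_1)"
  where "letter_mult s d x q =
    (\<Sum>v\<in>keys q. single v (d x (lookup q v)) + single (x # v) (s x (lookup q v)))"

definition cross_mult ::
    "('x \<Rightarrow> 's \<Rightarrow> 's) \<Rightarrow> ('x \<Rightarrow> 's \<Rightarrow> 's) \<Rightarrow>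
     ('x list \<Rightarrow>\<^sub>0 's) \<Rightarrow> ('x list \<Rightarrow>\<^sub>0 's) \<Rightarrow> ('x list \<Rightarrow>\<^sub>0 's::comm_ring_1)"
  where "cross_mult s d p q = (\<Sum>w\<in>keys p. scale (lookup p w) (foldr (letter_mult s d) w q))"

definition free_cross_product ::
    "'x set \<Rightarrow> ('x \<Rightarrow> 's \<Rightarrow> 's) \<Rightarrow> ('x \<Rightarrow> 's \<Rightarrow> 's) \<Rightarrow> ('x list \<Rightarrow>\<^sub>0 's::comm_ring_1) ring"
  where "free_cross_product X s d =
    \<lparr>carrier = {p. keys p \<subseteq> lists X}, mult = cross_mult s d, one = single [] 1, zero = 0, add = (+)\<rparr>"

lemma free_cross_relation:
  fixes s d :: "'x \<Rightarrow> 's \<Rightarrow> 's::comm_ring_1"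
  assumes "s x 0 = 0" "d x 0 = 0"
  shows "single [x] 1 \<otimes>\<^bsub>free_cross_product X s d\<^esub> single [] f = single [] (d x f) + single [x] (s x f)"
proof -
  have m1: "scale 1 q = q" for q :: "'x list \<Rightarrow>\<^sub>0 's"
    by (rule poly_mapping_eqI) (simp add: map.rep_eq when_def)
  show ?thesis
    using assms by (cases "f = 0") (simp_all add: free_cross_product_def cross_mult_def letter_mult_def m1)
qed

definition sym_extend :: "('x list \<Rightarrow>\<^sub>0 rat) \<Rightarrow> ('x list \<Rightarrow>\<^sub>0 'i sym)"
  where "sym_extend = Poly_Mapping.map (single 0)"

definition sym_span :: "('x list \<Rightarrow>\<^sub>0 rat) set \<Rightarrow> ('x list \<Rightarrow>\<^sub>0 'i sym) set"
  where "sym_span I = {\<Sum>p\<in>F. scale (g p) (sym_extend p) | F g. finite F \<and> F \<subseteq> I}"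

text \<open>
  For an ideal \<open>I\<close> of \<open>T\<close> such that \<open>T/I\<close> acts on \<open>S\<close>, the cross product of \<open>T/I\<close> with \<open>S\<close> has
  the underlying space \<open>S \<otimes> (T/I) = (S \<otimes> T) / (S \<otimes> I)\<close>; \<open>sym_span I\<close> is \<open>S \<otimes> I\<close>.
\<close>

definition cross_product ::
    "'x set \<Rightarrow> ('x \<Rightarrow> 'i sym \<Rightarrow> 'i sym) \<Rightarrow> ('x \<Rightarrow> 'i sym \<Rightarrow> 'i sym) \<Rightarrow> ('x list \<Rightarrow>\<^sub>0 rat) set \<Rightarrow>
     ('x list \<Rightarrow>\<^sub>0 'i sym) set ring"
  where "cross_product X s d I = free_cross_product X s d Quot sym_span I"

text \<open>The inclusions of \<open>T/I\<close> (given on representatives in \<open>T\<close>) and of \<open>S\<close> in the cross product.\<close>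

definition cross_of_alg ::
    "'x set \<Rightarrow> ('x \<Rightarrow> 'i sym \<Rightarrow> 'i sym) \<Rightarrow> ('x \<Rightarrow> 'i sym \<Rightarrow> 'i sym) \<Rightarrow> ('x list \<Rightarrow>\<^sub>0 rat) set \<Rightarrow>
     ('x list \<Rightarrow>\<^sub>0 rat) \<Rightarrow> ('x list \<Rightarrow>\<^sub>0 'i sym) set"
  where "cross_of_alg X s d I p = sym_span I +>\<^bsub>free_cross_product X s d\<^esub> sym_extend p"

definition cross_of_sym ::
    "'x set \<Rightarrow> ('x \<Rightarrow> 'i sym \<Rightarrow> 'i sym) \<Rightarrow> ('x \<Rightarrow> 'i sym \<Rightarrow> 'i sym) \<Rightarrow> ('x list \<Rightarrow>\<^sub>0 rat) set \<Rightarrow>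
     'i sym \<Rightarrow> ('x list \<Rightarrow>\<^sub>0 'i sym) set"
  where "cross_of_sym X s d I f = sym_span I +>\<^bsub>free_cross_product X s d\<^esub> single [] f"


section \<open>The affine nil-Hecke algebra\<close>

text \<open>The index \<open>None\<close> stands for the affine node \<open>0\<close>.\<close>

fun node_root :: "('i \<Rightarrow> 'v::euclidean_space) \<Rightarrow> 'v \<Rightarrow> 'i option \<Rightarrow> 'v" where
  "node_root a \<theta> None = - \<theta>"
| "node_root a \<theta> (Some i) = a i"

fun simple_reflection :: "('i \<Rightarrow> 'v::euclidean_space) \<Rightarrow> 'v \<Rightarrow> 'i option \<Rightarrow> 'v \<Rightarrow> 'v" where
  "simple_reflection a \<theta> None = affine_reflection \<theta> 1"
| "simple_reflection a \<theta> (Some i) = affine_reflection (a i) 0"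

text \<open>
  The order of \<open>s\<^sub>i s\<^sub>j\<close> may be computed in the group of all bijections of \<open>'v\<close>;
  \<^const>\<open>group.ord\<close> is \<open>0\<close> on elements of infinite order.
\<close>

definition coxeter_order ::
    "('i \<Rightarrow> 'v::euclidean_space) \<Rightarrow> 'v \<Rightarrow> 'i option \<Rightarrow> 'i option \<Rightarrow> nat"
  where "coxeter_order a \<theta> i j =
    group.ord (BijGroup UNIV) (simple_reflection a \<theta> i \<circ> simple_reflection a \<theta> j)"

fun alternating :: "'x \<Rightarrow> 'x \<Rightarrow> nat \<Rightarrow> 'x list" where
  "alternating i j 0 = []"
| "alternating i j (Suc n) = i # alternating j i n"

definition nil_coxeter_ideal ::
    "('i \<Rightarrow> 'v::euclidean_space) \<Rightarrow> 'v \<Rightarrow> ('i option list \<Rightarrow>\<^sub>0 rat) set"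
  where "nil_coxeter_ideal a \<theta> =
    Idl\<^bsub>free_algebra UNIV\<^esub>
     ({word [i, i] | i. True} \<union>
      {word (alternating i j (coxeter_order a \<theta> i j)) - word (alternating j i (coxeter_order a \<theta> i j))
       | i j. i \<noteq> j \<and> coxeter_order a \<theta> i j \<noteq> 0})"

definition nil_hecke ::
    "('i::finite \<Rightarrow> 'v::euclidean_space) \<Rightarrow> 'v \<Rightarrow> ('i option list \<Rightarrow>\<^sub>0 'i sym) set ring"
  where "nil_hecke a \<theta> =
    cross_product UNIV
      (\<lambda>i. sym_reflection a (node_root a \<theta> i)) (\<lambda>i. divided_difference a (node_root a \<theta> i))
      (nil_coxeter_ideal a \<theta>)"

definition nil_hecke_tau ::
    "('i::finite \<Rightarrow> 'v::euclidean_space) \<Rightarrow> 'v \<Rightarrow> 'i option \<Rightarrow> ('i option list \<Rightarrow>\<^sub>0 'i sym) set"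
  where "nil_hecke_tau a \<theta> i =
    cross_of_alg UNIV
      (\<lambda>i. sym_reflection a (node_root a \<theta> i)) (\<lambda>i. divided_difference a (node_root a \<theta> i))
      (nil_coxeter_ideal a \<theta>) (word [i])"

definition nil_hecke_of_sym ::
    "('i::finite \<Rightarrow> 'v::euclidean_space) \<Rightarrow> 'v \<Rightarrow> 'i sym \<Rightarrow> ('i option list \<Rightarrow>\<^sub>0 'i sym) set"
  where "nil_hecke_of_sym a \<theta> f =
    cross_of_sym UNIV
      (\<lambda>i. sym_reflection a (node_root a \<theta> i)) (\<lambda>i. divided_difference a (node_root a \<theta> i))
      (nil_coxeter_ideal a \<theta>) f"


section \<open>Nichols-Woronowicz algebras\<close>

text \<open>
  A braiding of the vector space \<open>M\<close> with basis \<open>X\<close> is given by its values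
  \<open>c x y = \<psi>(x \<otimes> y)\<close> on basis elements, which lie in the degree-two part of the tensor algebra.
  Positions in words and the symmetric group on \<open>{..<n}\<close> count from \<open>0\<close>.
\<close>

definition braid_at ::
    "('x \<Rightarrow> 'x \<Rightarrow> ('x list \<Rightarrow>\<^sub>0 rat)) \<Rightarrow> nat \<Rightarrow> ('x list \<Rightarrow>\<^sub>0 rat) \<Rightarrow> ('x list \<Rightarrow>\<^sub>0 rat)"
  where "braid_at c i p =
    (\<Sum>u\<in>keys p. scale (lookup p u)
      (word (take i u) * c (u ! i) (u ! Suc i) * word (drop (Suc (Suc i)) u)))"

definition expression_for :: "nat \<Rightarrow> (nat \<Rightarrow> nat) \<Rightarrow> nat list \<Rightarrow> bool"
  where "expression_for n w ks \<longleftrightarrow>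
    (\<forall>k\<in>set ks. Suc k < n) \<and> foldr (\<lambda>k u. Transposition.transpose k (Suc k) \<circ> u) ks id = w"

definition reduced_expression :: "nat \<Rightarrow> (nat \<Rightarrow> nat) \<Rightarrow> nat list \<Rightarrow> bool"
  where "reduced_expression n w ks \<longleftrightarrow>
    expression_for n w ks \<and> (\<forall>ls. expression_for n w ls \<longrightarrow> length ks \<le> length ls)"

text \<open>By the braid relation for \<open>c\<close>, the choice of the reduced expression does not matter.\<close>

definition braid_lift ::
    "('x \<Rightarrow> 'x \<Rightarrow> ('x list \<Rightarrow>\<^sub>0 rat)) \<Rightarrow> nat \<Rightarrow> (nat \<Rightarrow> nat) \<Rightarrow>
     ('x list \<Rightarrow>\<^sub>0 rat) \<Rightarrow> ('x list \<Rightarrow>\<^sub>0 rat)"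
  where "braid_lift c n w = foldr (braid_at c) (SOME ks. reduced_expression n w ks)"

definition braided_symmetrizer ::
    "('x \<Rightarrow> 'x \<Rightarrow> ('x list \<Rightarrow>\<^sub>0 rat)) \<Rightarrow> nat \<Rightarrow> ('x list \<Rightarrow>\<^sub>0 rat) \<Rightarrow> ('x list \<Rightarrow>\<^sub>0 rat)"
  where "braided_symmetrizer c n p = (\<Sum>w | w permutes {..<n}. braid_lift c n w p)"

definition degree_part :: "nat \<Rightarrow> ('x list \<Rightarrow>\<^sub>0 rat) \<Rightarrow> ('x list \<Rightarrow>\<^sub>0 rat)"
  where "degree_part n p = (\<Sum>u | u \<in> keys p \<and> length u = n. single u (lookup p u))"

text \<open>
  The Nichols-Woronowicz algebra \<open>\<Oplus>\<^sub>n M\<^bsup>\<otimes>n\<^esup> / ker \<sigma>\<^sub>n\<close> is the quotient of the tensor algebra by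
  \<open>\<Oplus>\<^sub>n ker \<sigma>\<^sub>n\<close>.
\<close>

definition nichols_ideal ::
    "'x set \<Rightarrow> ('x \<Rightarrow> 'x \<Rightarrow> ('x list \<Rightarrow>\<^sub>0 rat)) \<Rightarrow> ('x list \<Rightarrow>\<^sub>0 rat) set"
  where "nichols_ideal X c =
    {p \<in> carrier (free_algebra X). \<forall>n. braided_symmetrizer c n (degree_part n p) = 0}"

text \<open>
  The braiding \<open>x \<otimes> y \<mapsto> g(y) \<otimes> x\<close> of a Yetter-Drinfeld module with a homogeneous basis;
  \<open>gdeg x\<close> is the group degree \<open>g\<close> of \<open>x\<close>, and \<open>act g y\<close> is the vector \<open>g(y)\<close>.
\<close>

definition yd_braiding ::
    "('x \<Rightarrow> 'g) \<Rightarrow> ('g \<Rightarrow> 'x \<Rightarrow> ('x list \<Rightarrow>\<^sub>0 rat)) \<Rightarrow> 'x \<Rightarrow> 'x \<Rightarrow> ('x list \<Rightarrow>\<^sub>0 rat)"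
  where "yd_braiding gdeg act x y = act (gdeg x) y * word [x]"


section \<open>The affine Nichols-Woronowicz algebra\<close>

text \<open>
  The vector space spanned by the symbols \<open>[\<alpha>,k]\<close> modulo \<open>[\<alpha>,k] + [-\<alpha>,-k] = 0\<close> has as a basis
  the \<open>[\<alpha>,k]\<close> with \<open>\<alpha>\<close> positive.  These are the letters; \<open>affine_symbol\<close> is the class of
  \<open>[\<alpha>,k]\<close> for an arbitrary root \<open>\<alpha>\<close>.
\<close>

definition affine_basis :: "'v::euclidean_space set \<Rightarrow> ('i::finite \<Rightarrow> 'v) \<Rightarrow> ('v \<times> int) set"
  where "affine_basis \<Delta> a = positive_roots \<Delta> a \<times> UNIV"

definition affine_symbol ::
    "'v::euclidean_space set \<Rightarrow> ('i::finite \<Rightarrow> 'v) \<Rightarrow> 'v \<Rightarrow> int \<Rightarrow> (('v \<times> int) list \<Rightarrow>\<^sub>0 rat)"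
  where "affine_symbol \<Delta> a \<alpha> k =
    (if \<alpha> \<in> positive_roots \<Delta> a then word [(\<alpha>, k)] else - word [(- \<alpha>, - k)])"

text \<open>
  An element \<open>g = t\<^sub>\<lambda> w\<close> of the affine Weyl group is an affine transformation of \<open>'v\<close>, with
  translation vector \<open>\<lambda> = g 0\<close> and linear part \<open>w v = g v - g 0\<close>.  It maps \<open>[\<beta>,l]\<close> to
  \<open>[w \<beta>, l + \<langle>\<lambda>, w \<beta>\<rangle>]\<close>, the pairing being an integer.
\<close>

definition affine_action ::
    "'v::euclidean_space set \<Rightarrow> ('i::finite \<Rightarrow> 'v) \<Rightarrow> ('v \<Rightarrow> 'v) \<Rightarrow> 'v \<times> int \<Rightarrow>
     (('v \<times> int) list \<Rightarrow>\<^sub>0 rat)"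
  where "affine_action \<Delta> a g = (\<lambda>(\<beta>, l).
    affine_symbol \<Delta> a (g \<beta> - g 0) (l + \<lfloor>g 0 \<bullet> (g \<beta> - g 0)\<rfloor>))"

lemma nonneg_combs_both:
  assumes "simple_roots \<Delta> a" "\<beta> \<in> nonneg_combs a" "- \<beta> \<in> nonneg_combs a"
  shows "\<beta> = 0"
proof -
  obtain c d where c: "\<beta> = (\<Sum>i\<in>UNIV. real (c i) *\<^sub>R a i)" and d: "- \<beta> = (\<Sum>i\<in>UNIV. real (d i) *\<^sub>R a i)"
    using assms(2,3) by (auto simp: nonneg_combs_def)
  have inj: "inj a" and ind: "independent (range a)"
    using assms(1) by (auto simp: simple_roots_def)
  have "(\<Sum>i\<in>UNIV. (real (c i) + real (d i)) *\<^sub>R a i) = \<beta> + - \<beta>"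
    unfolding d by (simp add: c scaleR_left_distrib sum.distrib)
  then have "(\<Sum>v\<in>range a. (real (c (inv_into UNIV a v)) + real (d (inv_into UNIV a v))) *\<^sub>R v) = 0"
    using inj by (simp add: sum.reindex)
  then have "real (c (inv_into UNIV a v)) + real (d (inv_into UNIV a v)) = 0" if "v \<in> range a" for v
    using ind that unfolding independent_explicit by auto
  then have "c i = 0" for i
    using inj by (metis add_nonneg_eq_0_iff inv_f_f of_nat_0_le_iff of_nat_eq_0_iff rangeI)
  then show ?thesis by (simp add: c)
qed

lemma affine_symbol_relation:
  assumes "root_system \<Delta>" "simple_roots \<Delta> a" "\<alpha> \<in> \<Delta>"
  shows "affine_symbol \<Delta> a \<alpha> k + affine_symbol \<Delta> a (- \<alpha>) (- k) = 0"
proof -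
  have "\<alpha> \<noteq> 0" using assms by (auto simp: root_system_def)
  moreover have "- \<alpha> \<in> \<Delta>"
  proof -
    have "reflection \<alpha> \<alpha> \<in> \<Delta>" using assms by (auto simp: root_system_def)
    moreover have "reflection \<alpha> \<alpha> = - \<alpha>"
      using \<open>\<alpha> \<noteq> 0\<close> by (simp add: affine_reflection_def coroot_def scaleR_2)
    ultimately show ?thesis by simp
  qed
  moreover have "\<alpha> \<in> nonneg_combs a \<or> - \<alpha> \<in> nonneg_combs a"
    using assms by (auto simp: simple_roots_def)
  ultimately show ?thesis
    using assms nonneg_combs_both[of \<Delta> a \<alpha>]
    by (auto simp: affine_symbol_def positive_roots_def)
qed

lemma affine_action_reflection:
  assumes "root_system \<Delta>" "\<alpha> \<in> \<Delta>" "\<beta> \<in> \<Delta>"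
  shows "affine_action \<Delta> a (affine_reflection \<alpha> k) (\<beta>, l) =
    affine_symbol \<Delta> a (reflection \<alpha> \<beta>) (l - k * \<lfloor>coroot \<alpha> \<bullet> \<beta>\<rfloor>)"
proof -
  have "\<alpha> \<noteq> 0" and "coroot \<alpha> \<bullet> \<beta> \<in> \<int>" using assms by (auto simp: root_system_def)
  then obtain m where m: "coroot \<alpha> \<bullet> \<beta> = of_int m" by (auto elim: Ints_cases)
  have lin: "affine_reflection \<alpha> k \<beta> - affine_reflection \<alpha> k 0 = reflection \<alpha> \<beta>"
    by (simp add: affine_reflection_def algebra_simps)
  have "coroot \<alpha> \<bullet> reflection \<alpha> \<beta> = - (coroot \<alpha> \<bullet> \<beta>)"
    using \<open>\<alpha> \<noteq> 0\<close> by (simp add: affine_reflection_def coroot_def inner_diff_right inner_commute field_simps)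
  then have "affine_reflection \<alpha> k 0 \<bullet> reflection \<alpha> \<beta> = of_int (- (k * m))"
    by (simp add: affine_reflection_def m)
  then show ?thesis by (simp only: affine_action_def lin prod.case m floor_of_int) simp
qed

definition affine_braiding ::
    "'v::euclidean_space set \<Rightarrow> ('i::finite \<Rightarrow> 'v) \<Rightarrow> 'v \<times> int \<Rightarrow> 'v \<times> int \<Rightarrow>
     (('v \<times> int) list \<Rightarrow>\<^sub>0 rat)"
  where "affine_braiding \<Delta> a =
    yd_braiding (\<lambda>(\<alpha>, k). affine_reflection \<alpha> k) (affine_action \<Delta> a)"

definition affine_nichols_ideal ::
    "'v::euclidean_space set \<Rightarrow> ('i::finite \<Rightarrow> 'v) \<Rightarrow> (('v \<times> int) list \<Rightarrow>\<^sub>0 rat) set"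
  where "affine_nichols_ideal \<Delta> a = nichols_ideal (affine_basis \<Delta> a) (affine_braiding \<Delta> a)"

definition nichols_cross ::
    "'v::euclidean_space set \<Rightarrow> ('i::finite \<Rightarrow> 'v) \<Rightarrow> (('v \<times> int) list \<Rightarrow>\<^sub>0 'i sym) set ring"
  where "nichols_cross \<Delta> a =
    cross_product (affine_basis \<Delta> a)
      (\<lambda>(\<alpha>, k). sym_reflection a \<alpha>) (\<lambda>(\<alpha>, k). divided_difference a \<alpha>)
      (affine_nichols_ideal \<Delta> a)"

definition nichols_cross_symbol ::
    "'v::euclidean_space set \<Rightarrow> ('i::finite \<Rightarrow> 'v) \<Rightarrow> 'v \<Rightarrow> int \<Rightarrow>
     (('v \<times> int) list \<Rightarrow>\<^sub>0 'i sym) set"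
  where "nichols_cross_symbol \<Delta> a \<alpha> k =
    cross_of_alg (affine_basis \<Delta> a)
      (\<lambda>(\<alpha>, k). sym_reflection a \<alpha>) (\<lambda>(\<alpha>, k). divided_difference a \<alpha>)
      (affine_nichols_ideal \<Delta> a) (affine_symbol \<Delta> a \<alpha> k)"

definition nichols_cross_of_sym ::
    "'v::euclidean_space set \<Rightarrow> ('i::finite \<Rightarrow> 'v) \<Rightarrow> 'i sym \<Rightarrow>
     (('v \<times> int) list \<Rightarrow>\<^sub>0 'i sym) set"
  where "nichols_cross_of_sym \<Delta> a f =
    cross_of_sym (affine_basis \<Delta> a)
      (\<lambda>(\<alpha>, k). sym_reflection a \<alpha>) (\<lambda>(\<alpha>, k). divided_difference a \<alpha>)
      (affine_nichols_ideal \<Delta> a) f"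

end

theory Submission
  imports Defs
begin

text \<open>
  Why \<open>\<phi>\<close> is injective.  The relations of the nil-Coxeter algebra \<open>A\<^sub>0\<close> make a word in the
  generators \<open>\<tau>\<^sub>i\<close> vanish unless it is reduced in \<open>W\<^sub>a\<^sub>f\<^sub>f\<close>, and identify the reduced words of the same
  element.  This is Tits' solution of the word problem, consisting of \<open>Matsumoto\<close> and
  \<open>nonreduced_braid_equiv_square\<close>.  It rests on the exchange condition, which holds because a simple
  reflection makes only one positive affine root negative.  So \<open>A\<close> is spanned over \<open>S\<close> by one
  reduced word for each element of \<open>W\<^sub>a\<^sub>f\<^sub>f\<close> (\<open>reduce_mod_ideal\<close>), and it remains to see that the images
  of these words are linearly independent over \<open>S\<close>.  Comparing coefficients of monomials of \<open>S\<close>, it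
  is enough to look at the Nichols-Woronowicz algebra, that is, at the symmetrizer \<open>\<sigma>\<^sub>n\<close>.

  The braiding sends a word in the letters \<open>[\<alpha>,k]\<close> to plus or minus another such word and acts on the
  degrees of the letters by the Hurwitz moves \<open>(s, t) \<mapsto> (s t s, s)\<close>.  These preserve the product of
  the degrees, so reduced words of different elements do not interfere.  The summand of \<open>\<sigma>\<^sub>n\<close> of a
  permutation other than the identity never sends a reduced word to a multiple of itself
  (\<open>hurwitz_fixes_no_reduced_word\<close>): otherwise part of the word could be shortened.  Hence a reduced
  word occurs in its own symmetrization with coefficient \<open>1\<close>, whatever the signs are
  (\<open>symmetrizer_coefficient\<close>), and independence follows (\<open>free_map_injective_on_normal_words\<close>).

  To apply this, the value of \<open>\<phi>\<close> on \<open>f \<tau>\<^sub>i \<tau>\<^sub>j \<cdots>\<close> has to be derived from the values on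
  generators (\<open>hom_free_map\<close>).  The product of a cross product is a union of cosets taken over all
  representatives.  In the source only products with right factors in \<open>A\<^sub>0\<close> are formed.  These are
  single cosets because \<open>S \<otimes> I\<close> is stable under multiplication by letters on both sides, where
  stability on the left comes from the \<open>\<rat>\<close>-linearity of divided differences.  In the target, \<open>\<phi>\<close>
  being a map between the carriers forces the union to be the coset of any one product of
  representatives.
\<close>

section \<open>Words in involutions\<close>

definition composite :: "('i \<Rightarrow> 'p \<Rightarrow> 'p) \<Rightarrow> 'i list \<Rightarrow> 'p \<Rightarrow> 'p"
  where "composite s u = foldr (\<lambda>i g. s i \<circ> g) u id"

lemma composite_simps [simp]:
  "composite s [] = id" "composite s (i # u) = s i \<circ> composite s u"
  by (simp_all add: composite_def)

lemma composite_append [simp]: "composite s (u @ v) = composite s u \<circ> composite s v"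
  by (induction u) (simp_all add: o_assoc)

text \<open>
  Two words represent the same group element if their composites are equal as functions on the space
  on which the letters act; for affine reflections the composite is the element of \<open>W\<^sub>a\<^sub>f\<^sub>f\<close>.
\<close>

definition reduced_word :: "('i \<Rightarrow> 'p \<Rightarrow> 'p) \<Rightarrow> 'i list \<Rightarrow> bool"
  where "reduced_word s u \<longleftrightarrow> (\<forall>v. composite s v = composite s u \<longrightarrow> length u \<le> length v)"

lemma reduced_word_exists: "\<exists>u. reduced_word s u \<and> composite s u = composite s v"
proof -
  define u where "u = arg_min length (\<lambda>u. composite s u = composite s v)"
  have "composite s u = composite s v \<and> (\<forall>x. composite s x = composite s v \<longrightarrow> length u \<le> length x)"
    unfolding u_def by (rule arg_min_nat_lemma) (rule refl)
  then show ?thesis by (intro exI[of _ u]) (simp add: reduced_word_def)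
qed

lemma reduced_wordD: "reduced_word s u \<Longrightarrow> composite s v = composite s u \<Longrightarrow> length u \<le> length v"
  by (simp add: reduced_word_def)

lemma reduced_word_same_length:
  assumes "reduced_word s u" "composite s v = composite s u" "length v \<le> length u"
  shows "reduced_word s v"
  using assms by (metis le_trans reduced_word_def)

lemma reduced_word_middle:
  assumes "reduced_word s (x @ u @ y)" shows "reduced_word s u"
  unfolding reduced_word_def
proof (intro allI impI)
  fix v assume "composite s v = composite s u"
  then have "composite s (x @ v @ y) = composite s (x @ u @ y)" by simp
  from reduced_wordD[OF assms this] show "length u \<le> length v" by simp
qed

lemma reduced_word_tl: "reduced_word s (i # u) \<Longrightarrow> reduced_word s u"
  using reduced_word_middle[of s "[i]" u "[]"] by simp

lemma reduced_word_butlast: "reduced_word s (u @ [i]) \<Longrightarrow> reduced_word s u"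
  using reduced_word_middle[of s "[]" u "[i]"] by simp

text \<open>
  The congruence on words generated by the braid relations; \<open>m i j = 0\<close> stands for infinite order,
  for which there is no relation.
\<close>

inductive braid_equiv :: "('i \<Rightarrow> 'i \<Rightarrow> nat) \<Rightarrow> 'i list \<Rightarrow> 'i list \<Rightarrow> bool" for m where
  refl: "braid_equiv m u u"
| sym: "braid_equiv m u v \<Longrightarrow> braid_equiv m v u"
| trans: "braid_equiv m u v \<Longrightarrow> braid_equiv m v w \<Longrightarrow> braid_equiv m u w"
| braid: "i \<noteq> j \<Longrightarrow> m i j \<noteq> 0 \<Longrightarrow>
    braid_equiv m (x @ alternating i j (m i j) @ y) (x @ alternating j i (m i j) @ y)"

lemma braid_equiv_context: "braid_equiv m u v \<Longrightarrow> braid_equiv m (x @ u @ y) (x @ v @ y)"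
proof (induction rule: braid_equiv.induct)
  case (braid i j x' y')
  then show ?case using braid_equiv.braid[of i j m "x @ x'" "y' @ y"] by simp
qed (blast intro: braid_equiv.intros)+

lemma braid_equiv_Cons: "braid_equiv m u v \<Longrightarrow> braid_equiv m (i # u) (i # v)"
  using braid_equiv_context[of m u v "[i]" "[]"] by simp

lemma braid_equiv_snoc: "braid_equiv m u v \<Longrightarrow> braid_equiv m (u @ [i]) (v @ [i])"
  using braid_equiv_context[of m u v "[]" "[i]"] by simp

lemma length_alternating [simp]: "length (alternating i j n) = n"
  by (induction n arbitrary: i j) auto

lemma alternating_snoc: "alternating i j (Suc n) = alternating i j n @ [if even n then i else j]"
  by (induction n arbitrary: i j) auto

lemma alternating_add: "\<exists>r. alternating i j (n + k) = alternating i j n @ r"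
proof (induction n arbitrary: i j)
  case (Suc n)
  then obtain r where "alternating j i (n + k) = alternating j i n @ r" by blast
  then show ?case by auto
qed simp

text \<open>
  This turns the equation \<open>s\<^sub>i s\<^sub>j s\<^sub>i \<cdots> = s\<^sub>j s\<^sub>i s\<^sub>j \<cdots>\<close> with \<open>q\<close> factors on both sides into
  \<open>(s\<^sub>i s\<^sub>j)\<^sup>q = 1\<close>, for even and odd \<open>q\<close> alike.
\<close>

lemma alternating_double: "alternating i j (2 * q) = alternating i j q @ rev (alternating j i q)"
proof (induction q arbitrary: i j)
  case (Suc q)
  have "alternating i j (2 * Suc q) = i # alternating j i (2 * q) @ [j]"
    using alternating_snoc[of j i "2 * q"] by simp
  then show ?case using Suc[of j i] by simp
qed simp

lemma composite_alternating_double: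
  "composite s (alternating i j (2 * q)) = (s i \<circ> s j) ^^ q"
  by (induction q) (simp_all add: o_assoc)

section \<open>The exchange condition and the word problem\<close>

text \<open>
  Abstract form of the geometry behind the exchange condition: involutions \<open>s i\<close> permute a set of
  roots and \<open>s i\<close> makes only one positive root, \<open>root i\<close>, negative.  The reflection
  \<open>refl \<beta>\<close> in \<open>\<beta>\<close> is the same for the negative of \<open>\<beta>\<close>.
  The instances are the affine roots, and the pairs \<open>(i, j)\<close> for the symmetric group.
\<close>

locale reflection_words =
  fixes s :: "'i \<Rightarrow> 'p \<Rightarrow> 'p"
    and act :: "'i \<Rightarrow> 'b \<Rightarrow> 'b"
    and roots :: "'b set"
    and root :: "'i \<Rightarrow> 'b"
    and pos :: "'b \<Rightarrow> bool"
    and refl :: "'b \<Rightarrow> 'p \<Rightarrow> 'p"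
  assumes involution: "s i \<circ> s i = id"
    and root_in: "root i \<in> roots"
    and act_in: "\<beta> \<in> roots \<Longrightarrow> act i \<beta> \<in> roots"
    and act_act: "\<beta> \<in> roots \<Longrightarrow> act i (act i \<beta>) = \<beta>"
    and pos_root: "pos (root i)"
    and neg_root: "\<not> pos (act i (root i))"
    and pos_act: "\<beta> \<in> roots \<Longrightarrow> pos \<beta> \<Longrightarrow> \<beta> \<noteq> root i \<Longrightarrow> pos (act i \<beta>)"
    and refl_root: "refl (root i) = s i"
    and refl_act: "\<beta> \<in> roots \<Longrightarrow> refl (act i \<beta>) = s i \<circ> refl \<beta> \<circ> s i"
begin

abbreviation "acts \<equiv> foldr act"
abbreviation "\<pi> \<equiv> composite s"
abbreviation "is_reduced \<equiv> reduced_word s"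

lemma involution_apply [simp]: "s i (s i x) = x"
  using involution[of i] by (simp add: fun_eq_iff)

lemma involution_comp [simp]: "s i \<circ> (s i \<circ> f) = f"
  by (simp add: o_assoc involution)

lemma composite_rev: "\<pi> (rev u) \<circ> \<pi> u = id" "\<pi> u \<circ> \<pi> (rev u) = id"
proof -
  have 1: "\<pi> (rev u) \<circ> \<pi> u = id" for u
  proof (induction u)
    case (Cons i u)
    have "\<pi> (rev (i # u)) \<circ> \<pi> (i # u) = \<pi> (rev u) \<circ> (s i \<circ> (s i \<circ> \<pi> u))" by (simp add: o_assoc)
    then show ?case using Cons by (simp add: involution)
  qed simp
  show "\<pi> (rev u) \<circ> \<pi> u = id" by (rule 1)
  show "\<pi> u \<circ> \<pi> (rev u) = id" using 1[of "rev u"] by simp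
qed

lemma composite_cancel_left: "\<pi> u \<circ> f = \<pi> u \<circ> g \<longleftrightarrow> f = g"
  by (metis comp_assoc composite_rev(1) id_comp)

lemma composite_Cons_cancel: "s i \<circ> f = s i \<circ> g \<longleftrightarrow> f = g"
  using composite_cancel_left[of "[i]"] by simp

lemma acts_in: "\<beta> \<in> roots \<Longrightarrow> acts u \<beta> \<in> roots"
  by (induction u) (auto intro: act_in)

lemma refl_acts: "\<beta> \<in> roots \<Longrightarrow> refl (acts u \<beta>) = \<pi> u \<circ> refl \<beta> \<circ> \<pi> (rev u)"
  by (induction u) (simp_all add: refl_act acts_in o_assoc)

lemma sign_change:
  assumes "\<beta> \<in> roots" "pos (act k \<beta>) \<noteq> pos \<beta>"
  shows "refl \<beta> = s k"
proof (cases "pos \<beta>")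
  case True
  then show ?thesis using assms pos_act refl_root by metis
next
  case False
  then have "pos (act k \<beta>)" "\<not> pos (act k (act k \<beta>))" using assms act_act by auto
  then have "act k \<beta> = root k" using assms(1) pos_act act_in by blast
  then have "s k \<circ> refl \<beta> \<circ> s k = s k" using refl_act[OF assms(1), of k] refl_root by simp
  then have "s k \<circ> (refl \<beta> \<circ> s k) = s k \<circ> id" by (simp add: comp_assoc)
  then have "refl \<beta> \<circ> s k = id" by (simp only: composite_Cons_cancel)
  then have "refl \<beta> \<circ> (s k \<circ> s k) = s k" by (simp only: o_assoc) simp
  then show ?thesis by (simp add: involution)
qed

text \<open>
  Along the letters of a word the sign of a root can change only at a letter whose simple reflection
  is the reflection in the current root.
\<close>

lemma sign_change_split:
  assumes "\<beta> \<in> roots" "pos (acts (rev u) \<beta>) \<noteq> pos \<beta>"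
  shows "\<exists>xs k ys. u = xs @ k # ys \<and> refl (acts (rev xs) \<beta>) = s k"
  using assms(2)
proof (induction u rule: rev_induct)
  case (snoc k u)
  show ?case
  proof (cases "pos (acts (rev u) \<beta>) = pos \<beta>")
    case True
    then have "pos (act k (acts (rev u) \<beta>)) \<noteq> pos (acts (rev u) \<beta>)" using snoc.prems by simp
    then have "refl (acts (rev u) \<beta>) = s k" using sign_change acts_in assms(1) by blast
    then show ?thesis by blast
  next
    case False
    then obtain xs l ys where "u = xs @ l # ys" "refl (acts (rev xs) \<beta>) = s l" using snoc.IH by blast
    then show ?thesis by (intro exI[of _ xs] exI[of _ l] exI[of _ "ys @ [k]"]) simp
  qed
qed simp

text \<open>
  If \<open>u\<^sup>-\<^sup>1\<close> changes the sign of \<open>\<beta>\<close>, it does so at some letter \<open>k\<close>, say \<open>u = xs k ys\<close>, and then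
  \<open>xs\<^sup>-\<^sup>1 s\<^sub>\<beta> xs = s\<^sub>k\<close>.  So multiplying \<open>u\<close> by \<open>s\<^sub>\<beta>\<close> from the left cancels the letter \<open>k\<close>.
\<close>

lemma deletion:
  assumes "\<beta> \<in> roots" "refl \<beta> = s i" "pos (acts (rev u) \<beta>) \<noteq> pos \<beta>"
  shows "\<exists>xs k ys. u = xs @ k # ys \<and> \<pi> (i # u) = \<pi> (xs @ ys)"
proof -
  obtain xs k ys where u: "u = xs @ k # ys" and k: "refl (acts (rev xs) \<beta>) = s k"
    using sign_change_split assms(1,3) by blast
  have "\<pi> (rev xs) \<circ> s i \<circ> \<pi> xs = s k" using k refl_acts[OF assms(1), of "rev xs"] assms(2) by simp
  then have "\<pi> xs \<circ> (\<pi> (rev xs) \<circ> (s i \<circ> \<pi> xs)) = \<pi> xs \<circ> s k" by (simp add: o_assoc)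
  then have "s i \<circ> \<pi> xs = \<pi> xs \<circ> s k" by (simp add: o_assoc composite_rev)
  then have "\<pi> (i # u) = \<pi> xs \<circ> (s k \<circ> (s k \<circ> \<pi> ys))" unfolding u by (simp add: o_assoc)
  then show ?thesis using u by auto
qed

lemma reduced_sign:
  assumes "\<beta> \<in> roots" "refl \<beta> = s i" "is_reduced (i # u)"
  shows "pos (acts (rev u) \<beta>) = pos \<beta>"
proof (rule ccontr)
  assume "\<not> ?thesis"
  then obtain xs k ys where "u = xs @ k # ys" "\<pi> (xs @ ys) = \<pi> (i # u)"
    using deletion[OF assms(1,2)] by metis
  with reduced_wordD[OF assms(3), of "xs @ ys"] show False by simp
qed

lemma refl_neg_root: "refl (act i (root i)) = s i"
  using refl_act[OF root_in, of i i] refl_root by (simp add: involution)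

end

text \<open>
  In addition, the action on roots depends only on the group element, and \<open>m i j\<close> is the order of
  \<open>s\<^sub>i s\<^sub>j\<close>, or \<open>0\<close> if the order is infinite.
\<close>

locale coxeter_words = reflection_words s act roots root pos refl
  for s :: "'i \<Rightarrow> 'p \<Rightarrow> 'p" and act and roots :: "'b set" and root pos refl +
  fixes m :: "'i \<Rightarrow> 'i \<Rightarrow> nat"
  assumes acts_cong: "\<beta> \<in> roots \<Longrightarrow> composite s u = composite s v \<Longrightarrow> foldr act u \<beta> = foldr act v \<beta>"
    and power_order: "(s i \<circ> s j) ^^ m i j = id"
    and order_least: "0 < q \<Longrightarrow> (s i \<circ> s j) ^^ q = id \<Longrightarrow> 0 < m i j \<and> m i j \<le> q"
begin

lemma acts_rev_cong:
  assumes "\<beta> \<in> roots" "\<pi> u = \<pi> v" shows "acts (rev u) \<beta> = acts (rev v) \<beta>"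
proof (rule acts_cong[OF assms(1)])
  have "\<pi> u \<circ> \<pi> (rev u) = \<pi> v \<circ> \<pi> (rev v)" by (simp add: composite_rev(2))
  then have "\<pi> u \<circ> \<pi> (rev u) = \<pi> u \<circ> \<pi> (rev v)" by (simp only: assms(2))
  then show "\<pi> (rev u) = \<pi> (rev v)" by (simp add: composite_cancel_left)
qed

text \<open>
  As \<open>i v\<close> is reduced, the inverse of the group element makes \<open>root i\<close> negative, whichever word
  represents the element.  So the deletion lemma applies to \<open>u\<close>.
\<close>

lemma exchange:
  assumes "is_reduced u" "is_reduced (i # v)" "\<pi> u = \<pi> (i # v)"
  shows "\<exists>xs k ys. u = xs @ k # ys \<and> \<pi> u = \<pi> (i # xs @ ys)"
proof -
  have "acts (rev u) (root i) = acts (rev v) (act i (root i))"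
    using acts_rev_cong[OF root_in assms(3), of i] by simp
  moreover have "\<not> pos (acts (rev v) (act i (root i)))"
    using reduced_sign[OF act_in[OF root_in] refl_neg_root assms(2)] neg_root by simp
  ultimately have "pos (acts (rev u) (root i)) \<noteq> pos (root i)" using pos_root by simp
  from deletion[OF root_in refl_root this] obtain xs k ys
    where u: "u = xs @ k # ys" and d: "\<pi> (i # u) = \<pi> (xs @ ys)" by blast
  have "\<pi> u = s i \<circ> \<pi> (i # u)" by simp
  also have "\<dots> = \<pi> (i # xs @ ys)" unfolding d by simp
  finally show ?thesis using u by blast
qed

lemma composite_alternating_iff:
  "\<pi> (alternating i j q) = \<pi> (alternating j i q) \<longleftrightarrow> (s i \<circ> s j) ^^ q = id"
proof -
  let ?A = "\<pi> (alternating i j q)" and ?B = "\<pi> (alternating j i q)"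
  let ?B' = "\<pi> (rev (alternating j i q))"
  have "(s i \<circ> s j) ^^ q = ?A \<circ> ?B'"
    by (simp flip: composite_alternating_double add: alternating_double)
  moreover have "?A \<circ> ?B' = id \<longleftrightarrow> ?A = ?B"
    by (metis comp_assoc comp_id composite_rev id_comp)
  ultimately show ?thesis by simp
qed

lemma braid_equiv_composite: "braid_equiv m u v \<Longrightarrow> \<pi> u = \<pi> v"
proof (induction rule: braid_equiv.induct)
  case (braid i j x y)
  then show ?case using composite_alternating_iff[of i j "m i j"] power_order by simp
qed simp_all

lemma braid_equiv_same_head:
  assumes IH: "\<And>u v. length u < q \<Longrightarrow> is_reduced u \<Longrightarrow> is_reduced v \<Longrightarrow> \<pi> u = \<pi> v \<Longrightarrow> braid_equiv m u v"
    and "length (i # u) = q" "is_reduced (i # u)" "is_reduced (i # v)" "\<pi> (i # u) = \<pi> (i # v)"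
  shows "braid_equiv m (i # u) (i # v)"
proof (rule braid_equiv_Cons, rule IH)
  show "\<pi> u = \<pi> v" using assms(5) by (simp add: composite_Cons_cancel)
qed (use assms in \<open>auto dest: reduced_word_tl\<close>)

lemma braid_equiv_same_last:
  assumes IH: "\<And>u v. length u < q \<Longrightarrow> is_reduced u \<Longrightarrow> is_reduced v \<Longrightarrow> \<pi> u = \<pi> v \<Longrightarrow> braid_equiv m u v"
    and "length (u @ [i]) = q" "is_reduced (u @ [i])" "is_reduced (v @ [i])" "\<pi> (u @ [i]) = \<pi> (v @ [i])"
  shows "braid_equiv m (u @ [i]) (v @ [i])"
proof (rule braid_equiv_snoc, rule IH)
  have "\<pi> u \<circ> s i \<circ> s i = \<pi> v \<circ> s i \<circ> s i" using assms(5) by simp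
  then show "\<pi> u = \<pi> v" by (simp add: comp_assoc involution)
qed (use assms in \<open>auto dest: reduced_word_butlast\<close>)

text \<open>
  Equality of the two products means that the order \<open>m i j\<close> is finite and at most \<open>q\<close>, so a braid
  relation applies to the first \<open>m i j\<close> letters and makes the first letters agree.
\<close>

lemma alternating_braid_equiv:
  assumes IH: "\<And>u v. length u < q \<Longrightarrow> is_reduced u \<Longrightarrow> is_reduced v \<Longrightarrow> \<pi> u = \<pi> v \<Longrightarrow> braid_equiv m u v"
    and "i \<noteq> j" "0 < q" "is_reduced (alternating i j q)" "is_reduced (alternating j i q)"
    and eq: "\<pi> (alternating i j q) = \<pi> (alternating j i q)"
  shows "braid_equiv m (alternating i j q) (alternating j i q)"
proof -
  have "(s i \<circ> s j) ^^ q = id" using eq by (simp add: composite_alternating_iff)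
  then have m: "0 < m i j" "m i j \<le> q" using order_least assms(3) by blast+
  obtain r where r: "alternating i j q = alternating i j (m i j) @ r"
    using alternating_add[of i j "m i j" "q - m i j"] m by auto
  let ?w = "alternating j i (m i j) @ r"
  have b: "braid_equiv m (alternating i j q) ?w"
    using braid[of i j m "[]" r] assms(2) m r by simp
  have pi: "\<pi> ?w = \<pi> (alternating i j q)" using braid_equiv_composite[OF b] by simp
  have len: "length ?w = q" using arg_cong[OF r, of length] by simp
  have red: "is_reduced ?w"
    using reduced_word_same_length[OF assms(4) pi] len by simp
  obtain w' where w': "?w = j # w'" using m by (cases "m i j") auto
  obtain q' where q': "q = Suc q'" using assms(3) gr0_implies_Suc by blast
  have "braid_equiv m (j # w') (j # alternating i j q')"
    by (rule braid_equiv_same_head[OF IH]) (use len red pi assms w' q' in auto)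
  then show ?thesis using b w' q' by (auto intro: braid_equiv.trans)
qed

text \<open>
  Tits' argument, by induction on the length.  Words sharing their first or their last letter are
  handled by the induction hypothesis.  If \<open>u\<close> and \<open>v\<close> begin with different letters \<open>i\<close> and \<open>j\<close>, the
  exchange condition writes the element as \<open>i\<close> followed by \<open>v\<close> with a letter deleted.  If that letter
  is not the last one, the new word shares its first letter with \<open>u\<close> and its last letter with \<open>v\<close>.
  Otherwise, and symmetrically for \<open>j\<close> and \<open>u\<close>, the two new words begin with longer alternating
  words in \<open>i\<close> and \<open>j\<close>, until they are alternating altogether.
\<close>

theorem Matsumoto:
  assumes "is_reduced u" "is_reduced v" "\<pi> u = \<pi> v"
  shows "braid_equiv m u v"
  using assms
proof (induction "length u" arbitrary: u v rule: less_induct)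
  case (less u v)
  define q where "q = length u"
  have IH: "braid_equiv m u v"
    if "length u < q" "is_reduced u" "is_reduced v" "\<pi> u = \<pi> v" for u v
    using less.hyps that q_def by blast
  have same: "length v = q" if "is_reduced u" "is_reduced v" "\<pi> u = \<pi> v" "length u = q" for u v
    using reduced_wordD[OF that(1), of v] reduced_wordD[OF that(2), of u] that(3,4) by simp
  have key: "braid_equiv m u v"
    if "is_reduced u" "is_reduced v" "\<pi> u = \<pi> v" "length u = q" "i \<noteq> j" "0 < k" "k \<le> q"
      "u = alternating i j k @ x" "v = alternating j i k @ y" for u v i j k x y
    using that
  proof (induction "q - k" arbitrary: u v i j k x y)
    case 0
    then have "k = q" by simp
    then have x: "u = alternating i j q" "v = alternating j i q"
      using 0 same[OF 0(2-5)] by auto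
    show ?case unfolding x
      by (rule alternating_braid_equiv[OF IH]) (use x 0 \<open>k = q\<close> in auto)
  next
    case (Suc d)
    then have kq: "k < q" by simp
    have lv: "length v = q" using same Suc.prems by blast
    obtain u' where u': "u = i # u'" using Suc.prems by (cases k) auto
    obtain v' where v': "v = j # v'" using Suc.prems by (cases k) auto
    obtain x' c where x: "x = x' @ [c]" using Suc.prems(4,8) kq by (cases x rule: rev_cases) auto
    obtain y' e where y: "y = y' @ [e]" using Suc.prems(9) lv kq by (cases y rule: rev_cases) auto
    \<comment> \<open>Either some letter other than the last is deleted, and a word sharing the first letter of one side
      and the last letter of the other links both, or the alternating prefixes grow.\<close>
    have step: "braid_equiv m u v \<or> \<pi> v = \<pi> (i # butlast v)"
      if r: "is_reduced u" "is_reduced v" "\<pi> u = \<pi> v" "length u = q" "length v = q" "u = i # u'" for u v i u'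
    proof -
      obtain xs c ys where v: "v = xs @ c # ys" and eq: "\<pi> v = \<pi> (i # xs @ ys)"
        using exchange[of v i u'] r by auto
      show ?thesis
      proof (cases ys rule: rev_cases)
        case Nil
        then show ?thesis using v eq by (simp add: butlast_append)
      next
        case (snoc zs e)
        let ?w = "i # xs @ zs @ [e]"
        have red: "is_reduced ?w" using reduced_word_same_length[OF r(2), of ?w] eq v snoc by simp
        have 1: "braid_equiv m u ?w" unfolding r(6)
          by (rule braid_equiv_same_head[OF IH]) (use r red eq snoc in auto)
        have 2: "braid_equiv m ((i # xs @ zs) @ [e]) ((xs @ c # zs) @ [e])"
          by (rule braid_equiv_same_last[OF IH]) (use r red eq snoc v in auto)
        then show ?thesis using 1 v snoc by (auto intro: braid_equiv.trans)
      qed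
    qed
    show ?case
    proof (cases "\<pi> v = \<pi> (i # butlast v) \<and> \<pi> u = \<pi> (j # butlast u)")
      case False
      then show ?thesis
        using step[of u v i u'] step[of v u j v'] Suc.prems(1-4) lv u' v' braid_equiv.sym by metis
    next
      case True
      let ?u = "i # butlast v" and ?v = "j # butlast u"
      have red: "is_reduced ?u" "is_reduced ?v"
        using reduced_word_same_length[OF Suc.prems(2), of ?u] reduced_word_same_length[OF Suc.prems(1), of ?v]
          True lv Suc.prems(4) kq by auto
      have "?u = alternating i j (Suc k) @ y'" "?v = alternating j i (Suc k) @ x'"
        using Suc.prems(8,9) x y by (simp_all add: butlast_append)
      then have "braid_equiv m ?u ?v"
        using Suc.hyps(1)[of "Suc k" ?u ?v i j y' x'] Suc.hyps(2) red True Suc.prems kq lv x y by auto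
      moreover have "braid_equiv m u ?u" unfolding u'
        by (rule braid_equiv_same_head[OF IH]) (use Suc.prems u' True red in auto)
      moreover have "braid_equiv m ?v v" unfolding v'
        by (rule braid_equiv_same_head[OF IH]) (use Suc.prems v' True red lv kq in auto)
      ultimately show ?thesis by (blast intro: braid_equiv.trans)
    qed
  qed
  have lv: "length v = q" using same less.prems q_def by blast
  show ?case
  proof (cases u)
    case Nil
    then show ?thesis using lv q_def by (auto intro: braid_equiv.refl)
  next
    case (Cons i u')
    then obtain j v' where v: "v = j # v'" using lv q_def by (cases v) auto
    show ?thesis
    proof (cases "i = j")
      case True
      have "braid_equiv m (i # u') (i # v')"
        by (rule braid_equiv_same_head[OF IH]) (use less.prems v True Cons q_def in auto)
      then show ?thesis using v True Cons by simp
    next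
      case False
      show ?thesis
        by (rule key[of u v i j 1 u' v']) (use less.prems v False Cons q_def in auto)
    qed
  qed
qed

text \<open>
  Let \<open>i u\<close> be a shortest suffix that is not reduced.  The deletion property shows that the element
  of \<open>u\<close> also has a reduced word beginning with \<open>i\<close>, to which \<open>u\<close> is equivalent by Matsumoto's theorem.
\<close>

theorem nonreduced_braid_equiv_square:
  assumes "\<not> is_reduced u"
  shows "\<exists>x i y. braid_equiv m u (x @ [i, i] @ y)"
  using assms
proof (induction u)
  case Nil
  then show ?case by (simp add: reduced_word_def)
next
  case (Cons i u)
  show ?case
  proof (cases "is_reduced u")
    case False
    then obtain x j y where "braid_equiv m u (x @ [j, j] @ y)" using Cons.IH by blast
    from braid_equiv_Cons[OF this, of i] show ?thesis by (metis append_Cons)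
  next
    case True
    have "pos (acts (rev u) (root i)) \<noteq> pos (root i)"
    proof
      assume p: "pos (acts (rev u) (root i)) = pos (root i)"
      obtain v where v: "\<pi> v = \<pi> (i # u)" "length v \<le> length u"
        using Cons.prems by (auto simp: reduced_word_def)
      have u: "\<pi> u = \<pi> (i # v)" using v(1) by simp
      have "acts (rev u) (root i) = acts (rev v) (act i (root i))"
        using acts_rev_cong[OF root_in u, of i] by simp
      then have "pos (acts (rev v) (act i (root i))) \<noteq> pos (act i (root i))"
        using p pos_root neg_root by simp
      then obtain xs k ys where "v = xs @ k # ys" "\<pi> (i # v) = \<pi> (xs @ ys)"
        using deletion[OF act_in[OF root_in] refl_neg_root] by blast
      then have "\<pi> (xs @ ys) = \<pi> u" "length (xs @ ys) < length u" using u v(2) by simp_all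
      then show False using reduced_wordD[OF True] by fastforce
    qed
    from deletion[OF root_in refl_root this] obtain xs k ys
      where d: "u = xs @ k # ys" "\<pi> (i # u) = \<pi> (xs @ ys)" by blast
    have eq: "\<pi> (i # xs @ ys) = \<pi> u"
    proof -
      have "\<pi> u = s i \<circ> \<pi> (i # u)" by simp
      then show ?thesis unfolding d(2) by simp
    qed
    moreover have "is_reduced (i # xs @ ys)"
      using reduced_word_same_length[OF True eq] d(1) by simp
    ultimately have "braid_equiv m u (i # xs @ ys)" using Matsumoto True by simp
    from braid_equiv_Cons[OF this, of i] show ?thesis by (metis append_Cons append_Nil)
  qed
qed

end

section \<open>Reduced expressions of permutations\<close>

abbreviation adjacent_transpose :: "nat \<Rightarrow> nat \<Rightarrow> nat"
  where "adjacent_transpose k \<equiv> Transposition.transpose k (Suc k)"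

lemma expression_for_iff:
  "expression_for n w ks \<longleftrightarrow> (\<forall>k\<in>set ks. Suc k < n) \<and> composite adjacent_transpose ks = w"
  by (simp add: expression_for_def composite_def)

lemma expression_permutes: "expression_for n w ks \<Longrightarrow> w permutes {..<n}"
proof (induction ks arbitrary: w)
  case Nil
  then show ?case by (simp add: expression_for_iff id_def[symmetric] permutes_id)
next
  case (Cons k ks)
  then have "composite adjacent_transpose ks permutes {..<n}" by (simp add: expression_for_iff)
  moreover have "adjacent_transpose k permutes {..<n}"
    using Cons.prems by (intro permutes_swap_id) (auto simp: expression_for_iff)
  ultimately show ?case using Cons.prems permutes_compose by (fastforce simp: expression_for_iff)
qed

text \<open>
  The root system of type A: the pair \<open>(i, j)\<close> is the root \<open>e\<^sub>i - e\<^sub>j\<close>.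
\<close>

lemma reflection_words_adjacent:
  "reflection_words adjacent_transpose (\<lambda>k. map_prod (adjacent_transpose k) (adjacent_transpose k))
     {(i, j). i \<noteq> j} (\<lambda>k. (k, Suc k)) (\<lambda>(i, j). i < j) (\<lambda>(i, j). Transposition.transpose i j)"
proof
  fix \<beta> :: "nat \<times> nat" and k
  assume "\<beta> \<in> {(i, j). i \<noteq> j}"
  then obtain i j where \<beta>: "\<beta> = (i, j)" "i \<noteq> j" by auto
  let ?t = "adjacent_transpose k"
  show "map_prod ?t ?t \<beta> \<in> {(i, j). i \<noteq> j}" "map_prod ?t ?t (map_prod ?t ?t \<beta>) = \<beta>"
    using \<beta> by (auto simp: transpose_eq_iff)
  have "Transposition.transpose (?t i) (?t j) \<circ> ?t = ?t \<circ> Transposition.transpose i j"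
    using transpose_comp_eq[of ?t "?t i" "?t j"] by simp
  then have "Transposition.transpose (?t i) (?t j) \<circ> (?t \<circ> ?t) = ?t \<circ> Transposition.transpose i j \<circ> ?t"
    by (metis comp_assoc)
  then show "(case map_prod ?t ?t \<beta> of (i, j) \<Rightarrow> Transposition.transpose i j) =
      ?t \<circ> (case \<beta> of (i, j) \<Rightarrow> Transposition.transpose i j) \<circ> ?t"
    using \<beta> by simp
  assume "case \<beta> of (i, j) \<Rightarrow> i < j" "\<beta> \<noteq> (k, Suc k)"
  then show "case map_prod ?t ?t \<beta> of (i, j) \<Rightarrow> i < j"
    using \<beta> by (auto simp: Transposition.transpose_def)
qed auto

text \<open>
  The last factor of a product of adjacent transpositions acts first, so for a reduced expression
  \<open>k # ks\<close> the transposition of the positions \<open>k\<close> and \<open>k + 1\<close> is applied after \<open>ks\<close>.  The values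
  arriving there are still in increasing order: every pair of entries is interchanged at most once.
\<close>

lemma reduced_expression_tail:
  assumes "reduced_expression n w (k # ks)"
  shows "reduced_expression n (composite adjacent_transpose ks) ks"
    and "Suc k < n"
    and "composite adjacent_transpose (rev ks) k < composite adjacent_transpose (rev ks) (Suc k)"
proof -
  interpret reflection_words adjacent_transpose
    "\<lambda>k. map_prod (adjacent_transpose k) (adjacent_transpose k)"
    "{(i, j). i \<noteq> j}" "\<lambda>k. (k, Suc k)" "\<lambda>(i, j). i < j" "\<lambda>(i, j). Transposition.transpose i j"
    by (rule reflection_words_adjacent)
  have e: "\<forall>l\<in>set (k # ks). Suc l < n" "adjacent_transpose k \<circ> \<pi> ks = w"
    using assms by (auto simp: reduced_expression_def expression_for_iff)
  show "Suc k < n" using e by simp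
  show "reduced_expression n (\<pi> ks) ks"
    unfolding reduced_expression_def
  proof (intro conjI allI impI)
    show "expression_for n (\<pi> ks) ks" using e by (simp add: expression_for_iff)
    fix ls assume "expression_for n (\<pi> ks) ls"
    then have "expression_for n w (k # ls)" using e by (simp add: expression_for_iff)
    then show "length ks \<le> length ls" using assms by (auto simp: reduced_expression_def)
  qed
  have acts_eq: "acts u (i, j) = (\<pi> u i, \<pi> u j)" for u i j by (induction u) simp_all
  have "(case acts (rev ks) (k, Suc k) of (i, j) \<Rightarrow> i < j) = (case (k, Suc k) of (i, j) \<Rightarrow> i < j)"
  proof (rule ccontr)
    assume "\<not> ?thesis"
    from deletion[OF _ _ this, of k] obtain xs l ys
      where d: "ks = xs @ l # ys" "\<pi> (k # ks) = \<pi> (xs @ ys)" by auto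
    then have "expression_for n w (xs @ ys)" using e by (auto simp: expression_for_iff)
    then have "length (k # ks) \<le> length (xs @ ys)" using assms by (auto simp: reduced_expression_def)
    then show False using d(1) by simp
  qed
  then show "\<pi> (rev ks) k < \<pi> (rev ks) (Suc k)" by (simp add: acts_eq)
qed

lemma expression_exists:
  assumes "w permutes {..<n}" shows "\<exists>ks. expression_for n w ks"
  using assms
proof (induction n arbitrary: w)
  case 0
  then have "w = id" by simp
  then show ?case by (intro exI[of _ "[]"]) (simp add: expression_for_iff id_def)
next
  case (Suc n)
  have move: "\<exists>ks. (\<forall>k\<in>set ks. Suc k < Suc n) \<and> composite adjacent_transpose ks (n - d) = n"
    if "d \<le> n" for d
    using that
  proof (induction d)
    case (Suc d)
    then obtain ks where ks: "\<forall>k\<in>set ks. Suc k < Suc n" "composite adjacent_transpose ks (n - d) = n"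
      by auto
    show ?case
    proof (intro exI conjI)
      show "\<forall>k\<in>set (ks @ [n - Suc d]). Suc k < Suc n" using ks Suc.prems by auto
      have "adjacent_transpose (n - Suc d) (n - Suc d) = n - d" using Suc.prems by simp
      then show "composite adjacent_transpose (ks @ [n - Suc d]) (n - Suc d) = n" using ks by simp
    qed
  qed (intro exI[of _ "[]"], simp)
  have "w n \<le> n" using permutes_in_image[OF Suc.prems, of n] by simp
  then obtain ks where ks: "\<forall>k\<in>set ks. Suc k < Suc n" "composite adjacent_transpose ks (w n) = n"
    using move[of "n - w n"] by auto
  let ?c = "composite adjacent_transpose ks"
  have c: "?c permutes {..<Suc n}" using expression_permutes ks by (simp add: expression_for_iff)
  have "?c \<circ> w permutes {..<Suc n}" using Suc.prems c by (rule permutes_compose)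
  moreover have "(?c \<circ> w) x = x" if "x \<in> {..<Suc n} - {..<n}" for x
  proof -
    have "x = n" using that by auto
    then show ?thesis using ks(2) by simp
  qed
  ultimately have "?c \<circ> w permutes {..<n}" by (rule permutes_superset)
  then obtain ls where ls: "expression_for n (?c \<circ> w) ls" using Suc.IH by blast
  interpret reflection_words adjacent_transpose
    "\<lambda>k. map_prod (adjacent_transpose k) (adjacent_transpose k)"
    "{(i, j). i \<noteq> j}" "\<lambda>k. (k, Suc k)" "\<lambda>(i, j). i < j" "\<lambda>(i, j). Transposition.transpose i j"
    by (rule reflection_words_adjacent)
  have "composite adjacent_transpose (rev ks @ ls) = \<pi> (rev ks) \<circ> ?c \<circ> w"
    using ls by (simp add: expression_for_iff o_assoc)
  also have "\<dots> = w" by (simp add: composite_rev)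
  finally have "expression_for (Suc n) w (rev ks @ ls)"
    using ls ks by (auto simp: expression_for_iff less_SucI)
  then show ?case by blast
qed

lemma reduced_expression_exists:
  assumes "w permutes {..<n}" shows "\<exists>ks. reduced_expression n w ks"
proof -
  define ks where "ks = arg_min length (expression_for n w)"
  obtain ls where "expression_for n w ls" using expression_exists[OF assms] by blast
  from arg_min_nat_lemma[of "expression_for n w" ls length, OF this]
  have "reduced_expression n w ks" by (simp add: reduced_expression_def ks_def)
  then show ?thesis by blast
qed

section \<open>Hurwitz moves\<close>

text \<open>
  The move \<open>(s, t) \<mapsto> (s t s\<^sup>-\<^sup>1, s)\<close> at the positions \<open>k\<close> and \<open>k + 1\<close>, for involutions.  It is the
  effect of the braiding of a Yetter-Drinfeld module on the degrees of the letters.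
\<close>

definition hurwitz :: "nat \<Rightarrow> ('p \<Rightarrow> 'p) list \<Rightarrow> ('p \<Rightarrow> 'p) list"
  where "hurwitz k ts = take k ts @ [ts ! k \<circ> ts ! Suc k \<circ> ts ! k, ts ! k] @ drop (Suc (Suc k)) ts"

abbreviation product :: "('p \<Rightarrow> 'p) list \<Rightarrow> 'p \<Rightarrow> 'p"
  where "product \<equiv> composite (\<lambda>t. t)"

lemma product_map: "product (map s u) = composite s u"
  by (induction u) simp_all

lemma product_nths_split:
  assumes "i < length ts"
  shows "product (nths ts A) = product (nths (take i ts) A) \<circ> (if i \<in> A then ts ! i else id)
    \<circ> product (nths (drop (Suc i) ts) {j. Suc i + j \<in> A})"
proof -
  have "nths ts A = nths (take i ts @ ts ! i # drop (Suc i) ts) A"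
    using id_take_nth_drop[OF assms] by simp
  then show ?thesis
    using assms by (simp add: nths_append nths_Cons o_assoc add.commute)
qed

lemma nths_cong:
  assumes "\<And>j. j < length ts \<Longrightarrow> j \<in> A \<longleftrightarrow> j \<in> B" shows "nths ts A = nths ts B"
  unfolding nths_def by (rule arg_cong[where f = "map fst"], rule filter_cong) (use assms in \<open>auto dest: set_zip_rightD\<close>)

lemma surj_product: "\<forall>t\<in>set ts. t \<circ> t = id \<Longrightarrow> surj (product ts)"
proof (induction ts)
  case (Cons t ts)
  then have "surj t" by (intro surjI[of t t]) (simp add: fun_eq_iff)
  moreover have "surj (product ts)" using Cons by simp
  ultimately show ?case by (simp only: composite_simps comp_surj)
qed simp

lemma surj_comp_cancel: "f \<circ> h = g \<circ> h \<Longrightarrow> surj h \<Longrightarrow> f = g"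
  by (metis comp_assoc comp_id surj_iff)

lemma hurwitz_length [simp]: "Suc k < length ts \<Longrightarrow> length (hurwitz k ts) = length ts"
  by (simp add: hurwitz_def)

lemma split_two_at:
  assumes "Suc k < length ts" "p \<le> k"
  shows "drop p ts = take (k - p) (drop p ts) @ [ts ! k, ts ! Suc k] @ drop (Suc (Suc k)) ts"
proof -
  have "drop p ts = take (k - p) (drop p ts) @ drop k ts"
    using append_take_drop_id[of "k - p" "drop p ts"] assms by simp
  moreover have "drop k ts = [ts ! k, ts ! Suc k] @ drop (Suc (Suc k)) ts"
    using assms by (simp add: Cons_nth_drop_Suc)
  ultimately show ?thesis by simp
qed

lemma hurwitz_suffix:
  assumes "Suc k < length ts" "ts ! k \<circ> ts ! k = id"
  shows "product (drop p (hurwitz k ts)) =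
    (if p = Suc k then ts ! k \<circ> product (drop (Suc (Suc k)) ts) else product (drop p ts))"
proof -
  consider "p \<le> k" | "p = Suc k" | "Suc k < p" by linarith
  then show ?thesis
  proof cases
    case 1
    have "product (drop p (hurwitz k ts)) = product (drop p (take k ts)) \<circ>
        (ts ! k \<circ> ts ! Suc k \<circ> (ts ! k \<circ> ts ! k) \<circ> product (drop (Suc (Suc k)) ts))"
      using 1 assms(1) by (simp add: hurwitz_def o_assoc)
    also have "\<dots> = product (drop p ts)"
      using 1 assms by (subst split_two_at[of k ts p]) (simp_all add: drop_take o_assoc)
    finally show ?thesis using 1 by simp
  next
    case 2
    then show ?thesis using assms(1) by (simp add: hurwitz_def)
  next
    case 3
    then obtain d where "p = Suc (Suc k) + d" using le_Suc_ex[of "Suc (Suc k)" p] by auto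
    then have "drop p (hurwitz k ts) = drop p ts"
      using assms(1) by (simp add: hurwitz_def add.commute)
    then show ?thesis using 3 by simp
  qed
qed

lemma hurwitz_involutions:
  assumes "Suc k < length ts" "\<forall>t\<in>set ts. t \<circ> t = id"
  shows "\<forall>t\<in>set (hurwitz k ts). t \<circ> t = id"
proof -
  have k: "ts ! k \<circ> ts ! k = id" "ts ! Suc k \<circ> ts ! Suc k = id"
    using assms by simp_all
  have "(ts ! k \<circ> ts ! Suc k \<circ> ts ! k) \<circ> (ts ! k \<circ> ts ! Suc k \<circ> ts ! k) = id"
    using k by (simp add: fun_eq_iff)
  then show ?thesis
    using assms k by (auto simp: hurwitz_def dest: in_set_takeD in_set_dropD)
qed

text \<open>
  After the moves of a reduced expression of \<open>w\<close>, the product of the degrees from position \<open>p\<close> on is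
  the product, in the original order, of those entries that \<open>w\<close> sends to positions \<open>\<ge> p\<close>.  A move at
  \<open>k\<close> changes only the product from position \<open>k + 1\<close> on.  There it replaces the entry \<open>j\<close> that has
  arrived at position \<open>k + 1\<close> by the entry \<open>i\<close> at position \<open>k\<close>; the formula survives because \<open>i < j\<close>
  in a reduced expression.
\<close>

lemma hurwitz_suffix_products:
  assumes "reduced_expression (length ts) w ks" "\<forall>t\<in>set ts. t \<circ> t = id"
  shows "length (foldr hurwitz ks ts) = length ts \<and> (\<forall>t\<in>set (foldr hurwitz ks ts). t \<circ> t = id) \<and>
    (\<forall>p. product (drop p (foldr hurwitz ks ts)) = product (nths ts {j. p \<le> w j}))"
  using assms(1)
proof (induction ks arbitrary: w)
  case Nil
  then have "w = id" by (simp add: reduced_expression_def expression_for_iff)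
  moreover have "drop p ts = nths ts {j. p \<le> j}" for p
    by (metis atLeast_def drop_eq_nths)
  ultimately show ?case using assms(2) by simp
next
  case (Cons k ks)
  interpret reflection_words adjacent_transpose
    "\<lambda>k. map_prod (adjacent_transpose k) (adjacent_transpose k)"
    "{(i, j). i \<noteq> j}" "\<lambda>k. (k, Suc k)" "\<lambda>(i, j). i < j" "\<lambda>(i, j). Transposition.transpose i j"
    by (rule reflection_words_adjacent)
  let ?n = "length ts" and ?v = "\<pi> ks"
  let ?hs = "foldr hurwitz ks ts"
  note tail = reduced_expression_tail[OF Cons.prems]
  have w: "w = adjacent_transpose k \<circ> ?v"
    using Cons.prems by (simp add: reduced_expression_def expression_for_iff)
  have IH: "length ?hs = ?n" "\<forall>t\<in>set ?hs. t \<circ> t = id"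
      "\<And>p. product (drop p ?hs) = product (nths ts {j. p \<le> ?v j})"
    using Cons.IH[OF tail(1)] by blast+
  have k: "Suc k < length ?hs" using tail(2) IH(1) by simp
  have kk: "?hs ! k \<circ> ?hs ! k = id" using IH(2) k by simp
  have suffix: "product (drop p (hurwitz k ?hs)) = product (nths ts {j. p \<le> w j})" for p
  proof (cases "p = Suc k")
    case False
    then have "{j. p \<le> w j} = {j. p \<le> ?v j}"
      by (auto simp: w Transposition.transpose_def split: if_splits)
    then show ?thesis using hurwitz_suffix[OF k kk] False IH(3) by simp
  next
    case True
    define i where "i = \<pi> (rev ks) k"
    define j where "j = \<pi> (rev ks) (Suc k)"
    have v_rev: "?v (\<pi> (rev ks) x) = x" "\<pi> (rev ks) (?v x) = x" for x
      using fun_cong[OF composite_rev(1)[of ks], of x] fun_cong[OF composite_rev(2)[of ks], of x] by simp_all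
    have vi: "?v x = k \<longleftrightarrow> x = i" "?v x = Suc k \<longleftrightarrow> x = j" for x
      using v_rev unfolding i_def j_def by metis+
    have ij: "i < j" using tail(3) by (simp add: i_def j_def)
    have "?v permutes {..<?n}" using tail(1) expression_permutes by (auto simp: reduced_expression_def)
    moreover have "?v i = k" using vi by simp
    ultimately have i: "i < ?n" using tail(2) permutes_in_image[of ?v "{..<?n}" i] by simp
    let ?q1 = "product (nths (take i ts) {x. Suc (Suc k) \<le> ?v x})"
    let ?q2 = "product (nths (drop (Suc i) ts) {x. Suc (Suc k) \<le> ?v (Suc i + x)})"
    let ?q2' = "product (nths (drop (Suc i) ts) {x. Suc k \<le> ?v (Suc i + x)})"
    have le: "k \<le> ?v x \<longleftrightarrow> Suc (Suc k) \<le> ?v x \<or> x = i \<or> x = j"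
      "Suc k \<le> ?v x \<longleftrightarrow> Suc (Suc k) \<le> ?v x \<or> x = j" for x
      using vi[of x] by linarith+
    have wle: "Suc k \<le> w x \<longleftrightarrow> Suc (Suc k) \<le> ?v x \<or> x = i" for x
      using vi[of x] by (auto simp: w Transposition.transpose_def)
    have nle: "\<not> Suc k \<le> ?v i" using vi[of i] by simp
    \<comment> \<open>The four products below share the part before \<open>i\<close>; they differ in whether \<open>i\<close> and \<open>j\<close> are selected.\<close>
    have R0: "product (drop k ?hs) = ?q1 \<circ> ts ! i \<circ> ?q2'"
    proof -
      have "nths (take i ts) {x. k \<le> ?v x} = nths (take i ts) {x. Suc (Suc k) \<le> ?v x}"
        by (rule nths_cong) (use ij le in auto)
      moreover have "nths (drop (Suc i) ts) {x. Suc i + x \<in> {x. k \<le> ?v x}} =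
          nths (drop (Suc i) ts) {x. Suc k \<le> ?v (Suc i + x)}"
        by (rule nths_cong) (use le in auto)
      ultimately show ?thesis
        unfolding IH(3) by (subst product_nths_split[OF i]) (use vi(1)[of i] in simp)
    qed
    have R1: "product (drop (Suc k) ?hs) = ?q1 \<circ> ?q2'"
    proof -
      have "nths (take i ts) {x. Suc k \<le> ?v x} = nths (take i ts) {x. Suc (Suc k) \<le> ?v x}"
        by (rule nths_cong) (use ij le in auto)
      then show ?thesis
        unfolding IH(3) by (subst product_nths_split[OF i]) (use nle in simp)
    qed
    have R2: "product (drop (Suc (Suc k)) ?hs) = ?q1 \<circ> ?q2"
      unfolding IH(3) by (subst product_nths_split[OF i]) (use nle in simp)
    have T: "product (nths ts {x. Suc k \<le> w x}) = ?q1 \<circ> ts ! i \<circ> ?q2"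
    proof -
      have "nths (take i ts) {x. Suc k \<le> w x} = nths (take i ts) {x. Suc (Suc k) \<le> ?v x}"
        by (rule nths_cong) (use wle in auto)
      moreover have "nths (drop (Suc i) ts) {x. Suc i + x \<in> {x. Suc k \<le> w x}} =
          nths (drop (Suc i) ts) {x. Suc (Suc k) \<le> ?v (Suc i + x)}"
        by (rule nths_cong) (use wle in auto)
      ultimately show ?thesis
        by (subst product_nths_split[OF i]) (use wle in simp)
    qed
    have "product (drop k ?hs) = ?hs ! k \<circ> product (drop (Suc k) ?hs)"
      using k by (simp flip: Cons_nth_drop_Suc)
    then have "(?q1 \<circ> ts ! i) \<circ> ?q2' = (?hs ! k \<circ> ?q1) \<circ> ?q2'"
      unfolding R0 R1 by (simp add: o_assoc)
    moreover have "surj ?q2'"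
    proof (rule surj_product, rule ballI)
      fix t assume "t \<in> set (nths (drop (Suc i) ts) {x. Suc k \<le> ?v (Suc i + x)})"
      then have "t \<in> set ts" by (rule in_set_dropD[OF in_set_nthsD])
      with assms(2) show "t \<circ> t = id" by (rule bspec)
    qed
    ultimately have "?q1 \<circ> ts ! i = ?hs ! k \<circ> ?q1"
      by (rule surj_comp_cancel)
    then have "?hs ! k \<circ> (?q1 \<circ> ?q2) = ?q1 \<circ> ts ! i \<circ> ?q2"
      by (simp only: o_assoc)
    then show ?thesis
      using hurwitz_suffix[OF k kk, of p] True R2 T by simp
  qed
  show ?case using suffix hurwitz_involutions[OF k IH(2)] k IH(1) by simp
qed

text \<open>
  Let \<open>p\<close> be the first position moved by \<open>w\<close>.  If the moves gave back the word \<open>u\<close>, its suffix behind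
  \<open>p\<close> would have the same product as a subword of equal length that begins with the letter at \<open>p\<close>.
  Cancelling this letter, the suffix of \<open>u\<close> from \<open>p\<close> on would have a shorter expression.
\<close>

theorem hurwitz_fixes_no_reduced_word:
  assumes "reduced_word s u" "\<And>i. s i \<circ> s i = id"
    and "reduced_expression (length u) w ks" "w \<noteq> id"
  shows "foldr hurwitz ks (map s u) \<noteq> map s u"
proof
  assume eq: "foldr hurwitz ks (map s u) = map s u"
  let ?n = "length u"
  have suffix: "product (drop p (map s u)) = product (nths (map s u) {j. p \<le> w j})" for p
    using hurwitz_suffix_products[of "map s u" w ks] assms eq by auto
  have perm: "w permutes {..<?n}"
    using assms(3) expression_permutes by (auto simp: reduced_expression_def)
  have bij: "bij w" using perm by (rule permutes_bij)
  have "\<exists>p. w p \<noteq> p" using assms(4) by (auto simp: fun_eq_iff)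
  define p where "p = (LEAST p. w p \<noteq> p)"
  have wp: "w p \<noteq> p" unfolding p_def using \<open>\<exists>p. w p \<noteq> p\<close> by (rule LeastI_ex)
  have fixed: "w l = l" if "l < p" for l using not_less_Least that unfolding p_def by blast
  have "p < w p"
  proof (rule ccontr)
    assume "\<not> p < w p"
    then have "w (w p) = w p" using wp by (intro fixed) simp
    then show False using bij wp by (metis bij_pointE)
  qed
  have pn: "p < ?n" using wp perm by (metis lessThan_iff permutes_def)
  let ?B = "{l. Suc p \<le> w l}"
  let ?x = "nths (drop (Suc p) u) {l. Suc p + l \<in> ?B}"
  have "nths (take p (map s u)) ?B = nths (take p (map s u)) {}"
    by (rule nths_cong) (use fixed in auto)
  moreover have "p \<in> ?B" using \<open>p < w p\<close> by simp
  ultimately have "product (nths (map s u) ?B) = s (u ! p) \<circ> product (nths (drop (Suc p) (map s u)) {l. Suc p + l \<in> ?B})"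
    using product_nths_split[of p "map s u" ?B] pn by simp
  then have "product (drop (Suc p) (map s u)) = s (u ! p) \<circ> composite s ?x"
    unfolding suffix by (simp add: product_map nths_map drop_map)
  then have "composite s (drop (Suc p) u) = s (u ! p) \<circ> composite s ?x"
    by (simp add: product_map drop_map)
  then have "composite s (drop p u) = s (u ! p) \<circ> (s (u ! p) \<circ> composite s ?x)"
    using pn by (simp flip: Cons_nth_drop_Suc)
  also have "\<dots> = composite s ?x" using assms(2) by (simp add: o_assoc)
  finally have "composite s ?x = composite s (drop p u)" by simp
  moreover have "reduced_word s (drop p u)"
    using reduced_word_middle[of s "take p u" "drop p u" "[]"] assms(1) by simp
  ultimately have "length (drop p u) \<le> length ?x" using reduced_wordD by blast
  moreover have "length ?x \<le> ?n - Suc p"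
    unfolding length_nths by (rule order_trans[OF card_mono[of "{..<?n - Suc p}"]]) auto
  ultimately show False using pn by simp
qed

section \<open>Affine reflections and affine roots\<close>

lemma coroot_self: "\<alpha> \<noteq> 0 \<Longrightarrow> coroot \<alpha> \<bullet> \<alpha> = 2"
  by (simp add: coroot_def)

lemma coroot_uminus [simp]: "coroot (- \<alpha>) = - coroot \<alpha>"
  by (simp add: coroot_def)

lemma reflection_eq: "reflection \<alpha> v = v - (coroot \<alpha> \<bullet> v) *\<^sub>R \<alpha>"
  by (simp add: affine_reflection_def coroot_def inner_commute)

lemma affine_reflection_uminus: "affine_reflection (- \<alpha>) (- k) = affine_reflection \<alpha> k"
  by (rule ext) (simp add: affine_reflection_def algebra_simps)

lemma affine_reflection_involution:
  assumes "\<alpha> \<noteq> 0" shows "affine_reflection \<alpha> k \<circ> affine_reflection \<alpha> k = id"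
proof
  fix v
  have "affine_reflection \<alpha> k v \<bullet> \<alpha> - of_int k = - (v \<bullet> \<alpha> - of_int k)"
    using coroot_self[OF assms] by (simp add: affine_reflection_def inner_diff_left)
  then show "(affine_reflection \<alpha> k \<circ> affine_reflection \<alpha> k) v = id v"
    by (simp add: affine_reflection_def[of \<alpha> k "affine_reflection \<alpha> k v"])
       (simp add: affine_reflection_def algebra_simps)
qed

lemma reflection_inner:
  assumes "\<alpha> \<noteq> 0" shows "reflection \<alpha> u \<bullet> reflection \<alpha> v = u \<bullet> v"
  using assms by (simp add: affine_reflection_def coroot_def inner_diff_left inner_diff_right inner_commute)

lemma coroot_reflection:
  assumes "\<alpha> \<noteq> 0" shows "coroot (reflection \<alpha> \<beta>) = reflection \<alpha> (coroot \<beta>)"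
  using reflection_inner[OF assms, of \<beta> \<beta>]
  by (simp add: coroot_def[of "reflection \<alpha> \<beta>"] coroot_def[of \<beta>]) (simp add: affine_reflection_def algebra_simps)

text \<open>The affine-linear form vanishing on the hyperplane of \<open>s\<^sub>\<beta>\<^sub>,\<^sub>l\<close>.\<close>

definition affine_form :: "'v::euclidean_space \<times> int \<Rightarrow> 'v \<Rightarrow> real"
  where "affine_form = (\<lambda>(\<beta>, l) v. v \<bullet> \<beta> - of_int l)"

lemma affine_form_inj:
  assumes "affine_form x = affine_form y" shows "x = y"
proof -
  obtain \<beta> l \<gamma> m where xy: "x = (\<beta>, l)" "y = (\<gamma>, m)" by fastforce
  have eq: "v \<bullet> \<beta> - of_int l = v \<bullet> \<gamma> - of_int m" for v
    using fun_cong[OF assms, of v] by (simp add: xy affine_form_def)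
  have "l = m" using eq[of 0] by simp
  moreover have "v \<bullet> (\<beta> - \<gamma>) = 0" for v
    using eq[of v] \<open>l = m\<close> by (simp add: inner_diff_right)
  then have "\<beta> = \<gamma>" by (metis eq_iff_diff_eq_0 inner_eq_zero_iff)
  ultimately show ?thesis by (simp add: xy)
qed

text \<open>
  The action of \<open>s\<^sub>\<alpha>\<^sub>,\<^sub>k\<close> on the symbol \<open>[\<beta>,l]\<close> before the identification of \<open>[\<beta>,l]\<close> with
  \<open>- [-\<beta>,-l]\<close>.
\<close>

definition affine_reflect_root :: "'v::euclidean_space \<times> int \<Rightarrow> 'v \<times> int \<Rightarrow> 'v \<times> int"
  where "affine_reflect_root = (\<lambda>(\<alpha>, k) (\<beta>, l). (reflection \<alpha> \<beta>, l - k * \<lfloor>coroot \<alpha> \<bullet> \<beta>\<rfloor>))"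

abbreviation affine_root_reflection :: "'v::euclidean_space \<times> int \<Rightarrow> 'v \<Rightarrow> 'v"
  where "affine_root_reflection \<equiv> \<lambda>(\<alpha>, k). affine_reflection \<alpha> k"

lemma affine_form_reflect:
  assumes "coroot (fst x) \<bullet> fst y \<in> \<int>"
  shows "affine_form (affine_reflect_root x y) v = affine_form y (affine_root_reflection x v)"
proof -
  obtain \<alpha> k \<beta> l where xy: "x = (\<alpha>, k)" "y = (\<beta>, l)" by fastforce
  obtain n where n: "coroot \<alpha> \<bullet> \<beta> = of_int n" using assms by (auto simp: xy elim: Ints_cases)
  show ?thesis
    by (simp add: xy affine_reflect_root_def affine_form_def reflection_eq n
      affine_reflection_def[of \<alpha> k] inner_diff_left inner_diff_right algebra_simps)
qed

text \<open>
  This is the Yetter-Drinfeld condition: \<open>s\<^sub>\<alpha>\<^sub>,\<^sub>k[\<beta>,l]\<close> has degree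
  \<open>s\<^sub>\<alpha>\<^sub>,\<^sub>k s\<^sub>\<beta>\<^sub>,\<^sub>l s\<^sub>\<alpha>\<^sub>,\<^sub>k\<close>.
\<close>

lemma affine_root_reflection_conjugate:
  assumes "fst x \<noteq> 0" "coroot (fst x) \<bullet> fst y \<in> \<int>"
  shows "affine_root_reflection (affine_reflect_root x y) =
    affine_root_reflection x \<circ> affine_root_reflection y \<circ> affine_root_reflection x"
proof
  fix v
  obtain \<alpha> k \<beta> l where xy: "x = (\<alpha>, k)" "y = (\<beta>, l)" by fastforce
  let ?R = "affine_reflection \<alpha> k"
  have \<alpha>: "\<alpha> \<noteq> 0" using assms(1) xy by simp
  have form: "affine_reflection \<beta> l v = v - affine_form (\<beta>, l) v *\<^sub>R coroot \<beta>" for \<beta> l and v :: 'a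
    by (simp add: affine_reflection_def affine_form_def)
  have linear: "?R (u - t *\<^sub>R w) = ?R u - t *\<^sub>R reflection \<alpha> w" for u t w
    by (simp add: affine_reflection_def inner_diff_left algebra_simps)
  have "?R (affine_reflection \<beta> l (?R v)) = ?R (?R v) - affine_form y (?R v) *\<^sub>R reflection \<alpha> (coroot \<beta>)"
    unfolding form[of \<beta> l] linear xy ..
  also have "?R (?R v) = v" using fun_cong[OF affine_reflection_involution[OF \<alpha>, of k], of v] by simp
  also have "affine_form y (?R v) = affine_form (affine_reflect_root x y) v"
    using affine_form_reflect[OF assms(2), of v] by (simp add: xy)
  finally show "affine_root_reflection (affine_reflect_root x y) v =
    (affine_root_reflection x \<circ> affine_root_reflection y \<circ> affine_root_reflection x) v"
    using form coroot_reflection[OF \<alpha>, of \<beta>] by (simp add: xy affine_reflect_root_def)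
qed

lemma affine_reflect_root_twice:
  assumes "fst x \<noteq> 0" "coroot (fst x) \<bullet> fst y \<in> \<int>"
  shows "affine_reflect_root x (affine_reflect_root x y) = y"
proof -
  obtain \<alpha> k \<beta> l where xy: "x = (\<alpha>, k)" "y = (\<beta>, l)" by fastforce
  obtain n where n: "coroot \<alpha> \<bullet> \<beta> = of_int n" using assms by (auto simp: xy elim: Ints_cases)
  have \<alpha>: "\<alpha> \<noteq> 0" using assms(1) xy by simp
  have "coroot \<alpha> \<bullet> reflection \<alpha> \<beta> = of_int (- n)"
    using coroot_self[OF \<alpha>] by (simp add: reflection_eq inner_diff_right n)
  moreover from this have "reflection \<alpha> (reflection \<alpha> \<beta>) = \<beta>"
    by (simp add: reflection_eq[of \<alpha> "reflection \<alpha> \<beta>"]) (simp add: reflection_eq n)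
  ultimately show ?thesis
    by (simp only: xy affine_reflect_root_def prod.case n floor_of_int) simp
qed

lemma affine_reflect_root_self:
  "\<alpha> \<noteq> 0 \<Longrightarrow> affine_reflect_root (\<alpha>, k) (\<alpha>, k) = (- \<alpha>, - k)"
  by (simp add: affine_reflect_root_def reflection_eq coroot_self scaleR_2)

lemma dual_basis:
  fixes a :: "'i::finite \<Rightarrow> 'v::euclidean_space"
  assumes "inj a" "independent (range a)"
  shows "\<exists>d. \<forall>i j. a i \<bullet> d j = (if i = j then 1 else 0)"
proof -
  have "\<exists>v. \<forall>i. a i \<bullet> v = (if i = j then 1 else 0)" for j
  proof -
    obtain g :: "'v \<Rightarrow> real" where g: "linear g" "\<forall>x\<in>range a. g x = (if x = a j then 1 else 0)"
      using linear_independent_extend[OF assms(2), of "\<lambda>x. if x = a j then 1 else 0"] by blast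
    have "a i \<bullet> adjoint g 1 = g (a i)" for i
      using adjoint_works[OF g(1), of "a i" 1] by simp
    then have "\<forall>i. a i \<bullet> adjoint g 1 = (if i = j then 1 else 0)"
      using g(2) assms(1) by (auto simp: inj_eq)
    then show ?thesis by blast
  qed
  then show ?thesis by metis
qed

lemma nonneg_combsI: "(\<Sum>i\<in>UNIV. real (c i) *\<^sub>R a i) \<in> nonneg_combs a"
  by (auto simp: nonneg_combs_def)

lemma nonneg_combs_add: "u \<in> nonneg_combs a \<Longrightarrow> v \<in> nonneg_combs a \<Longrightarrow> u + v \<in> nonneg_combs a"
proof -
  assume "u \<in> nonneg_combs a" "v \<in> nonneg_combs a"
  then obtain c d where "u = (\<Sum>i\<in>UNIV. real (c i) *\<^sub>R a i)" "v = (\<Sum>i\<in>UNIV. real (d i) *\<^sub>R a i)"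
    by (auto simp: nonneg_combs_def)
  then have "u + v = (\<Sum>i\<in>UNIV. real (c i + d i) *\<^sub>R a i)"
    by (simp add: scaleR_add_left sum.distrib)
  then show ?thesis by (simp only: nonneg_combsI)
qed

lemma nonneg_combs_0: "0 \<in> nonneg_combs a"
  using nonneg_combsI[of "\<lambda>_. 0"] by simp

lemma nonneg_combs_scale: "v \<in> nonneg_combs a \<Longrightarrow> real n *\<^sub>R v \<in> nonneg_combs a"
  by (induction n) (auto simp: nonneg_combs_0 scaleR_add_left intro: nonneg_combs_add)

lemma nonneg_combs_single: "a i \<in> nonneg_combs a"
proof -
  have "(\<Sum>j\<in>UNIV. real (if j = i then 1 else 0) *\<^sub>R a j) = (\<Sum>j\<in>UNIV. if j = i then a j else 0)"
    by (rule sum.cong) auto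
  then show ?thesis using nonneg_combsI[of "\<lambda>j. if j = i then 1 else 0" a] by simp
qed

locale affine_root_datum =
  fixes \<Delta> :: "'v::euclidean_space set" and a :: "'i::finite \<Rightarrow> 'v" and \<theta> :: 'v
  assumes root_system: "root_system \<Delta>"
    and simple: "simple_roots \<Delta> a"
    and highest: "highest_root \<Delta> a \<theta>"
begin

lemma root_nonzero: "\<alpha> \<in> \<Delta> \<Longrightarrow> \<alpha> \<noteq> 0"
  using root_system by (auto simp: root_system_def)

lemma root_reflection: "\<alpha> \<in> \<Delta> \<Longrightarrow> \<beta> \<in> \<Delta> \<Longrightarrow> reflection \<alpha> \<beta> \<in> \<Delta>"
  using root_system by (auto simp: root_system_def)

lemma root_integral: "\<alpha> \<in> \<Delta> \<Longrightarrow> \<beta> \<in> \<Delta> \<Longrightarrow> coroot \<alpha> \<bullet> \<beta> \<in> \<int>"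
  using root_system by (auto simp: root_system_def)

lemma root_reduced: "\<alpha> \<in> \<Delta> \<Longrightarrow> c *\<^sub>R \<alpha> \<in> \<Delta> \<Longrightarrow> c = 1 \<or> c = -1"
  using root_system by (auto simp: root_system_def)

lemma root_uminus: "\<alpha> \<in> \<Delta> \<Longrightarrow> - \<alpha> \<in> \<Delta>"
  using root_reflection[of \<alpha> \<alpha>] by (simp add: reflection_eq coroot_self[OF root_nonzero] scaleR_2)

lemma simple_root: "a i \<in> \<Delta>"
  using simple by (auto simp: simple_roots_def)

lemma theta_root: "\<theta> \<in> \<Delta>"
  using highest by (simp add: highest_root_def)

lemma node_root_in: "node_root a \<theta> i \<in> \<Delta>"
  by (cases i) (simp_all add: simple_root theta_root root_uminus)

definition dual :: "'i \<Rightarrow> 'v"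
  where "dual = (SOME d. \<forall>i j. a i \<bullet> d j = (if i = j then 1 else 0))"

lemma inner_dual [simp]: "a i \<bullet> dual j = (if i = j then 1 else 0)"
proof -
  have "\<exists>d. \<forall>i j. a i \<bullet> d j = (if i = j then 1 else 0)"
    using simple by (intro dual_basis) (auto simp: simple_roots_def)
  from someI_ex[OF this] show ?thesis unfolding dual_def by blast
qed

lemma span_simple: "span (range a) = UNIV"
proof -
  have "nonneg_combs a \<subseteq> span (range a)"
    by (auto simp: nonneg_combs_def intro!: span_sum span_scale[OF span_base])
  then have "\<beta> \<in> span (range a)" if "\<beta> \<in> \<Delta>" for \<beta>
    using simple that span_neg[of "- \<beta>" "range a"] by (auto simp: simple_roots_def)
  then have "span \<Delta> \<subseteq> span (range a)" by (intro span_minimal) auto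
  then show ?thesis using root_system by (auto simp: root_system_def)
qed

lemma simple_expansion: "v = (\<Sum>i\<in>UNIV. (v \<bullet> dual i) *\<^sub>R a i)"
proof -
  have "v \<in> span (range a)" by (simp add: span_simple)
  then show ?thesis
  proof (induction rule: span_induct_alt)
    case (step c x y)
    then obtain j where x: "x = a j" by blast
    have "(\<Sum>i\<in>UNIV. ((c *\<^sub>R x + y) \<bullet> dual i) *\<^sub>R a i) =
        (\<Sum>i\<in>UNIV. (c * (if j = i then 1 else 0)) *\<^sub>R a i) + (\<Sum>i\<in>UNIV. (y \<bullet> dual i) *\<^sub>R a i)"
      by (simp add: x inner_add_left scaleR_add_left sum.distrib)
    also have "(\<Sum>i\<in>UNIV. (c * (if j = i then 1 else 0)) *\<^sub>R a i) = c *\<^sub>R x"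
      by (simp add: x if_distrib[of "\<lambda>t. c * t"] if_distrib[of "\<lambda>t. t *\<^sub>R _"] cong: if_cong)
    finally show ?case using step by simp
  qed simp
qed

lemma inner_dual_nonneg: "v \<in> nonneg_combs a \<Longrightarrow> 0 \<le> v \<bullet> dual j"
  by (auto simp: nonneg_combs_def inner_sum_left intro!: sum_nonneg)

lemma theta_nonneg: "\<theta> \<in> nonneg_combs a"
proof (rule ccontr)
  assume "\<theta> \<notin> nonneg_combs a"
  then have m: "- \<theta> \<in> nonneg_combs a" using simple theta_root by (auto simp: simple_roots_def)
  have "\<theta> - (- \<theta>) \<in> nonneg_combs a"
    using highest root_uminus[OF theta_root] by (auto simp: highest_root_def)
  then have "0 \<le> (\<theta> + \<theta>) \<bullet> dual j" for j by (intro inner_dual_nonneg) simp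
  then have "\<theta> \<bullet> dual j = 0" for j
    using inner_dual_nonneg[OF m, of j] by (smt (verit) inner_add_left inner_minus_left)
  then have "\<theta> = 0" by (subst simple_expansion) simp
  then show False using root_nonzero[OF theta_root] by simp
qed

text \<open>
  With this level, \<open>(\<alpha>\<^sub>i, level)\<close> is the symbol to which \<open>\<tau>\<^sub>i\<close> is sent, namely \<open>[-\<theta>,-1]\<close> or
  \<open>[\<alpha>\<^sub>i,0]\<close>.  Its form \<open>v \<mapsto> \<langle>v,\<alpha>\<^sub>i\<rangle> - level\<close> is positive on the fundamental alcove.
\<close>

fun node_level :: "'i option \<Rightarrow> int" where
  "node_level None = -1"
| "node_level (Some i) = 0"

abbreviation affine_simple_root :: "'i option \<Rightarrow> 'v \<times> int"
  where "affine_simple_root i \<equiv> (node_root a \<theta> i, node_level i)"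

text \<open>
  The pair \<open>(\<beta>, l)\<close> is the affine root \<open>\<beta> - l\<delta>\<close>, where \<open>\<delta> = \<alpha>\<^sub>0 + \<theta>\<close>.  Since
  \<open>\<beta> - l\<delta> = (\<beta> - l\<theta>) - l\<alpha>\<^sub>0\<close>, these are its coefficients in the affine simple roots.
\<close>

fun affine_coord :: "'v \<times> int \<Rightarrow> 'i option \<Rightarrow> real" where
  "affine_coord (\<beta>, l) None = - of_int l"
| "affine_coord (\<beta>, l) (Some j) = (\<beta> - of_int l *\<^sub>R \<theta>) \<bullet> dual j"

definition affine_positive :: "'v \<times> int \<Rightarrow> bool"
  where "affine_positive = (\<lambda>(\<beta>, l). l \<le> 0 \<and> \<beta> - of_int l *\<^sub>R \<theta> \<in> nonneg_combs a)"

lemma simple_reflection_eq: "simple_reflection a \<theta> i = affine_root_reflection (affine_simple_root i)"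
  using affine_reflection_uminus[of \<theta> 1] by (cases i) simp_all

lemma affine_positive_coord: "affine_positive x \<Longrightarrow> 0 \<le> affine_coord x j"
  by (cases x; cases j) (auto simp: affine_positive_def intro: inner_dual_nonneg)

lemma affine_coord_simple: "affine_coord (affine_simple_root i) j = (if i = j then 1 else 0)"
  by (cases i; cases j) simp_all

lemma affine_coord_uminus: "affine_coord (- \<beta>, - l) j = - affine_coord (\<beta>, l) j"
  by (cases j) (simp_all add: inner_diff_left)

text \<open>
  For \<open>l < 0\<close> write \<open>\<beta> - l\<theta> = (\<theta> - (-\<beta>)) + (-l - 1)\<theta>\<close>; the first summand is a
  nonnegative combination of simple roots as \<open>\<theta>\<close> is the highest root.
\<close>

lemma affine_root_sign:
  assumes "\<beta> \<in> \<Delta>" shows "affine_positive (\<beta>, l) \<or> affine_positive (- \<beta>, - l)"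
proof -
  have neg: "affine_positive (\<beta>, l)" if "l < 0" "\<beta> \<in> \<Delta>" for \<beta> l
  proof -
    have "\<theta> - (- \<beta>) \<in> nonneg_combs a"
      using highest root_uminus[OF that(2)] by (auto simp: highest_root_def)
    moreover have "real (nat (- l - 1)) *\<^sub>R \<theta> \<in> nonneg_combs a"
      by (rule nonneg_combs_scale[OF theta_nonneg])
    moreover have "\<beta> - of_int l *\<^sub>R \<theta> = (\<theta> - (- \<beta>)) + real (nat (- l - 1)) *\<^sub>R \<theta>"
      using that(1) by (simp add: algebra_simps)
    ultimately have "\<beta> - of_int l *\<^sub>R \<theta> \<in> nonneg_combs a" by (simp only: nonneg_combs_add)
    then show ?thesis using that(1) by (simp add: affine_positive_def)
  qed
  show ?thesis
  proof (cases l "0 :: int" rule: linorder_cases)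
    case equal
    then show ?thesis using assms simple by (auto simp: simple_roots_def affine_positive_def)
  qed (use neg[of l \<beta>] neg[of "- l" "- \<beta>"] assms root_uminus in auto)
qed

lemma affine_coord_reflect:
  assumes "\<beta> \<in> \<Delta>" "i \<noteq> j"
  shows "affine_coord (affine_reflect_root (affine_simple_root i) (\<beta>, l)) j = affine_coord (\<beta>, l) j"
proof -
  obtain n where n: "coroot (node_root a \<theta> i) \<bullet> \<beta> = of_int n"
    using root_integral[OF node_root_in assms(1)] by (auto elim: Ints_cases)
  show ?thesis
  proof (cases i)
    case None
    then have "coroot \<theta> \<bullet> \<beta> = of_int (- n)" using n by simp
    then show ?thesis using None assms(2)
      by (cases j) (simp_all add: affine_reflect_root_def reflection_eq inner_diff_left algebra_simps)
  next
    case (Some k)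
    then show ?thesis using n assms(2)
      by (cases j) (auto simp add: affine_reflect_root_def reflection_eq inner_diff_left algebra_simps)
  qed
qed

lemma affine_simple_root_multiple:
  assumes "\<beta> \<in> \<Delta>" "affine_positive (\<beta>, l)" "\<And>j. j \<noteq> i \<Longrightarrow> affine_coord (\<beta>, l) j = 0"
  shows "(\<beta>, l) = affine_simple_root i"
proof (cases i)
  case None
  have "\<beta> - of_int l *\<^sub>R \<theta> = 0"
    using assms(3)[of "Some _"] None by (subst simple_expansion) simp
  then have \<beta>: "\<beta> = of_int l *\<^sub>R \<theta>" by simp
  then have "of_int l = (1 :: real) \<or> of_int l = (-1 :: real)" using root_reduced[OF theta_root] assms(1) by blast
  then have "l = -1" using assms(2) by (auto simp: affine_positive_def)
  then show ?thesis using \<beta> None by simp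
next
  case (Some k)
  have l: "l = 0" using assms(3)[of None] Some by simp
  have c: "\<beta> \<bullet> dual j = 0" if "j \<noteq> k" for j
    using assms(3)[of "Some j"] Some l that by simp
  have "\<beta> = (\<Sum>i\<in>UNIV. (\<beta> \<bullet> dual i) *\<^sub>R a i)" by (rule simple_expansion)
  also have "\<dots> = (\<Sum>i\<in>UNIV. if i = k then (\<beta> \<bullet> dual k) *\<^sub>R a k else 0)"
    by (rule sum.cong) (use c in auto)
  also have "\<dots> = (\<beta> \<bullet> dual k) *\<^sub>R a k" by simp
  finally have \<beta>: "\<beta> = (\<beta> \<bullet> dual k) *\<^sub>R a k" .
  then have "\<beta> \<bullet> dual k = 1 \<or> \<beta> \<bullet> dual k = -1"
    using root_reduced[OF simple_root, of "\<beta> \<bullet> dual k" k] assms(1) by simp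
  moreover have "0 \<le> \<beta> \<bullet> dual k" using affine_positive_coord[OF assms(2), of "Some k"] l by simp
  ultimately have "\<beta> \<bullet> dual k = 1" by linarith
  then show ?thesis using \<beta> l Some by simp
qed

lemma BijGroup_UNIV_power: "bij f \<Longrightarrow> f [^]\<^bsub>BijGroup UNIV\<^esub> (n::nat) = f ^^ n"
proof (induction n)
  case 0
  then show ?case by (simp add: BijGroup_def id_def nat_pow_def)
next
  case (Suc n)
  have "f [^]\<^bsub>BijGroup UNIV\<^esub> Suc n = f [^]\<^bsub>BijGroup UNIV\<^esub> n \<otimes>\<^bsub>BijGroup UNIV\<^esub> f"
    by (simp add: nat_pow_def)
  then show ?case
    using Suc bij_fn[OF Suc.prems, of n]
    by (simp add: BijGroup_def Bij_def compose_def comp_def funpow_swap1 extensional_def)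
qed

lemma coxeter_order_dvd:
  assumes "\<And>i. simple_reflection a \<theta> i \<circ> simple_reflection a \<theta> i = id"
  shows "(simple_reflection a \<theta> i \<circ> simple_reflection a \<theta> j) ^^ n = id \<longleftrightarrow> coxeter_order a \<theta> i j dvd n"
proof -
  interpret G: group "BijGroup (UNIV :: 'v set)" by (rule group_BijGroup)
  have one: "\<one>\<^bsub>BijGroup (UNIV :: 'v set)\<^esub> = id" by (simp add: BijGroup_def fun_eq_iff)
  have "bij (simple_reflection a \<theta> k)" for k
    using assms[of k] by (intro o_bij)
  then have b: "bij (simple_reflection a \<theta> i \<circ> simple_reflection a \<theta> j)" (is "bij ?f")
    by (intro bij_comp)
  then have "?f \<in> carrier (BijGroup UNIV)" by (simp add: BijGroup_def Bij_def extensional_def)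
  from G.pow_eq_id[OF this, of n] show ?thesis
    using BijGroup_UNIV_power[OF b, of n] by (simp add: coxeter_order_def one)
qed

text \<open>
  A positive affine root other than \<open>\<alpha>\<^sub>i\<close> is no multiple of \<open>\<alpha>\<^sub>i\<close>, so it has a positive coefficient
  at another simple root.  The reflection \<open>s\<^sub>i\<close> leaves this coefficient alone, and since the
  coefficients of a root have the same sign, the reflected root is positive as well.
\<close>

sublocale reflection_words "simple_reflection a \<theta>" "\<lambda>i. affine_reflect_root (affine_simple_root i)"
  "\<Delta> \<times> UNIV" affine_simple_root affine_positive affine_root_reflection
proof
  fix i :: "'i option" and \<beta> :: "'v \<times> int"
  let ?\<alpha> = "affine_simple_root i"
  have nz: "node_root a \<theta> i \<noteq> 0" using root_nonzero[OF node_root_in] .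
  show "simple_reflection a \<theta> i \<circ> simple_reflection a \<theta> i = id"
    using affine_reflection_involution[OF nz] by (simp add: simple_reflection_eq)
  show "?\<alpha> \<in> \<Delta> \<times> UNIV" using node_root_in by simp
  show "affine_positive ?\<alpha>"
    by (cases i) (simp_all add: affine_positive_def nonneg_combs_single nonneg_combs_0)
  show "\<not> affine_positive (affine_reflect_root ?\<alpha> ?\<alpha>)"
  proof
    assume "affine_positive (affine_reflect_root ?\<alpha> ?\<alpha>)"
    from affine_positive_coord[OF this, of i] show False
      using affine_coord_simple[of i i] by (simp add: affine_reflect_root_self[OF nz] affine_coord_uminus)
  qed
  show "affine_root_reflection ?\<alpha> = simple_reflection a \<theta> i" by (simp add: simple_reflection_eq)
  assume \<beta>: "\<beta> \<in> \<Delta> \<times> UNIV"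
  then have int: "coroot (fst ?\<alpha>) \<bullet> fst \<beta> \<in> \<int>" using root_integral[OF node_root_in] by auto
  show in_roots: "affine_reflect_root ?\<alpha> \<beta> \<in> \<Delta> \<times> UNIV"
    using \<beta> root_reflection[OF node_root_in] by (auto simp: affine_reflect_root_def)
  show "affine_reflect_root ?\<alpha> (affine_reflect_root ?\<alpha> \<beta>) = \<beta>"
    using affine_reflect_root_twice[OF _ int] nz by simp
  show "affine_root_reflection (affine_reflect_root ?\<alpha> \<beta>) =
      simple_reflection a \<theta> i \<circ> affine_root_reflection \<beta> \<circ> simple_reflection a \<theta> i"
    using affine_root_reflection_conjugate[OF _ int] nz by (simp add: simple_reflection_eq)
  assume pos: "affine_positive \<beta>" and ne: "\<beta> \<noteq> ?\<alpha>"
  show "affine_positive (affine_reflect_root ?\<alpha> \<beta>)"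
  proof (rule ccontr)
    assume np: "\<not> ?thesis"
    obtain \<gamma> m where g: "affine_reflect_root ?\<alpha> \<beta> = (\<gamma>, m)" by fastforce
    then have "affine_positive (- \<gamma>, - m)"
      using affine_root_sign[of \<gamma> m] np in_roots by auto
    then have le: "affine_coord (affine_reflect_root ?\<alpha> \<beta>) j \<le> 0" for j
      using affine_positive_coord[of "(- \<gamma>, - m)" j] by (simp add: g affine_coord_uminus)
    obtain \<delta> l where b: "\<beta> = (\<delta>, l)" "\<delta> \<in> \<Delta>" using \<beta> by auto
    have "affine_coord \<beta> j = 0" if "j \<noteq> i" for j
      using le[of j] affine_positive_coord[OF pos, of j] affine_coord_reflect[OF b(2), of i j l] that b(1)
      by simp
    then show False using affine_simple_root_multiple[of \<delta> l i] pos ne b by simp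
  qed
qed

lemma affine_form_acts:
  assumes "\<beta> \<in> \<Delta> \<times> UNIV"
  shows "affine_form (acts u \<beta>) v = affine_form \<beta> (\<pi> (rev u) v)"
proof (induction u arbitrary: v)
  case (Cons i u)
  have "coroot (node_root a \<theta> i) \<bullet> fst (acts u \<beta>) \<in> \<int>"
    using acts_in[OF assms, of u] root_integral[OF node_root_in] by auto
  then show ?case using Cons by (simp add: affine_form_reflect simple_reflection_eq)
qed simp

sublocale coxeter_words "simple_reflection a \<theta>" "\<lambda>i. affine_reflect_root (affine_simple_root i)"
  "\<Delta> \<times> UNIV" affine_simple_root affine_positive affine_root_reflection "coxeter_order a \<theta>"
proof
  fix \<beta> :: "'v \<times> int" and u v :: "'i option list"
  assume \<beta>: "\<beta> \<in> \<Delta> \<times> UNIV" and eq: "\<pi> u = \<pi> v"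
  have "\<pi> u \<circ> \<pi> (rev u) = \<pi> v \<circ> \<pi> (rev v)" by (simp add: composite_rev(2))
  then have "\<pi> u \<circ> \<pi> (rev u) = \<pi> u \<circ> \<pi> (rev v)" by (simp only: eq)
  then have "\<pi> (rev u) = \<pi> (rev v)" by (simp add: composite_cancel_left)
  then have "affine_form (acts u \<beta>) = affine_form (acts v \<beta>)"
    by (simp add: fun_eq_iff affine_form_acts[OF \<beta>])
  then show "acts u \<beta> = acts v \<beta>" by (rule affine_form_inj)
next
  fix i j :: "'i option" and q :: nat
  have dvd: "(simple_reflection a \<theta> i \<circ> simple_reflection a \<theta> j) ^^ n = id \<longleftrightarrow> coxeter_order a \<theta> i j dvd n" for n
    by (rule coxeter_order_dvd[OF involution])
  show "(simple_reflection a \<theta> i \<circ> simple_reflection a \<theta> j) ^^ coxeter_order a \<theta> i j = id"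
    by (simp add: dvd)
  assume "0 < q" "(simple_reflection a \<theta> i \<circ> simple_reflection a \<theta> j) ^^ q = id"
  then show "0 < coxeter_order a \<theta> i j \<and> coxeter_order a \<theta> i j \<le> q"
    using dvd[of q] by (auto dest: dvd_imp_le intro: Nat.gr0I)
qed

text \<open>
  Passing to the basis of positive roots changes a symbol only by a sign, and not its degree.
\<close>

lemma affine_symbol_letter:
  assumes "\<beta> \<in> \<Delta>"
  shows "\<exists>e y. y \<in> affine_basis \<Delta> a \<and> affine_symbol \<Delta> a \<beta> l = single [y] e \<and>
    affine_root_reflection y = affine_root_reflection (\<beta>, l)"
proof (cases "\<beta> \<in> positive_roots \<Delta> a")
  case True
  then show ?thesis by (intro exI[of _ 1] exI[of _ "(\<beta>, l)"]) (simp add: affine_basis_def affine_symbol_def)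
next
  case False
  then have "- \<beta> \<in> positive_roots \<Delta> a"
    using assms simple root_uminus by (auto simp: simple_roots_def positive_roots_def)
  then show ?thesis
    using False affine_reflection_uminus[of \<beta> l]
    by (intro exI[of _ "-1"] exI[of _ "(- \<beta>, - l)"])
       (simp add: affine_basis_def affine_symbol_def single_uminus)
qed

lemma affine_braiding_letters:
  assumes "x \<in> affine_basis \<Delta> a" "y \<in> affine_basis \<Delta> a"
  shows "\<exists>e z. z \<in> affine_basis \<Delta> a \<and> affine_braiding \<Delta> a x y = single [z, x] e \<and>
    affine_root_reflection z = affine_root_reflection x \<circ> affine_root_reflection y \<circ> affine_root_reflection x"
proof -
  obtain \<alpha> k \<beta> l where xy: "x = (\<alpha>, k)" "y = (\<beta>, l)" "\<alpha> \<in> \<Delta>" "\<beta> \<in> \<Delta>"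
    using assms by (auto simp: affine_basis_def positive_roots_def)
  obtain \<gamma> m where g: "affine_reflect_root x y = (\<gamma>, m)" by fastforce
  have "\<gamma> \<in> \<Delta>" using g xy root_reflection by (auto simp: affine_reflect_root_def)
  then obtain e z where z: "z \<in> affine_basis \<Delta> a" "affine_symbol \<Delta> a \<gamma> m = single [z] e"
    "affine_root_reflection z = affine_root_reflection (\<gamma>, m)"
    using affine_symbol_letter by blast
  have "affine_braiding \<Delta> a x y = affine_symbol \<Delta> a \<gamma> m * word [x]"
    using affine_action_reflection[OF root_system xy(3,4), of a k l] g
    by (auto simp: affine_braiding_def yd_braiding_def xy affine_reflect_root_def)
  then have "affine_braiding \<Delta> a x y = single [z, x] e"
    using z(2) by (simp add: mult_single plus_list_def)
  moreover have "affine_root_reflection z = affine_root_reflection x \<circ> affine_root_reflection y \<circ> affine_root_reflection x"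
    using z(3) affine_root_reflection_conjugate[of x y] g xy root_nonzero root_integral by simp
  ultimately show ?thesis using z(1) by blast
qed

end

section \<open>Divided differences on the symmetric algebra\<close>

lemma sum_keys_superset:
  assumes "finite A" "keys p \<subseteq> A" "\<And>m. F m 0 = 0"
  shows "(\<Sum>m\<in>keys p. F m (lookup p m)) = (\<Sum>m\<in>A. F m (lookup p m))"
  by (rule sum.mono_neutral_left) (use assms in \<open>auto simp: in_keys_iff\<close>)

lemma poly_mapping_sum_single: "p = (\<Sum>m\<in>keys p. single m (lookup p m))"
proof (rule poly_mapping_eqI)
  fix k
  have "lookup (\<Sum>m\<in>keys p. single m (lookup p m)) k = (\<Sum>m\<in>keys p. if m = k then lookup p k else 0)"
    unfolding lookup_sum by (rule sum.cong) (auto simp: lookup_single when_def)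
  then show "lookup p k = lookup (\<Sum>m\<in>keys p. single m (lookup p m)) k"
    by (simp add: in_keys_iff)
qed

abbreviation const :: "rat \<Rightarrow> 'i sym"
  where "const \<equiv> single 0"

lemma lookup_const_mult: "lookup (const c * f) m = c * lookup f m"
  by (simp flip: mult_map_scale_conv_mult add: map.rep_eq when_def)

lemma sym_subst_const_mult: "sym_subst h (const c * f) = const c * sym_subst h f"
proof -
  have "keys (const c * f) \<subseteq> keys f" by (auto simp: in_keys_iff lookup_const_mult)
  then have "sym_subst h (const c * f) =
      (\<Sum>m\<in>keys f. const (lookup (const c * f) m) * (\<Prod>i\<in>UNIV. h i ^ lookup m i))"
    unfolding sym_subst_def by (intro sum_keys_superset) auto
  also have "\<dots> = const c * sym_subst h f"
    unfolding sym_subst_def sum_distrib_left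
    by (rule sum.cong) (simp_all add: lookup_const_mult mult_single flip: mult.assoc)
  finally show ?thesis .
qed

lemma sym_subst_add: "sym_subst h (f + g) = sym_subst h f + sym_subst h g"
  unfolding sym_subst_def by (rule setsum_keys_plus_distrib) (simp_all add: single_add distrib_right)

lemma sym_subst_1: "sym_subst h 1 = 1"
  by (simp add: sym_subst_def)

abbreviation sym_var :: "'i \<Rightarrow> 'i sym"
  where "sym_var i \<equiv> single (single i 1) 1"

lemma sym_var_power: "sym_var i ^ n = single (single i n) 1"
  by (induction n) (simp_all add: mult_single flip: single_add)

lemma prod_single: "(\<Prod>i\<in>A. single (g i) 1) = single (\<Sum>i\<in>A. g i) (1 :: rat)"
  by (induction A rule: infinite_finite_induct) (simp_all add: mult_single)

lemma sym_monomial: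
  fixes m :: "'i::finite \<Rightarrow>\<^sub>0 nat"
  shows "(\<Prod>i\<in>UNIV. sym_var i ^ lookup m i) = single m 1"
proof -
  have "(\<Sum>i\<in>UNIV. single i (lookup m i)) = m"
    by (rule poly_mapping_eqI) (simp add: lookup_sum lookup_single when_def)
  then show ?thesis unfolding sym_var_power prod_single by simp
qed

lemma sym_subst_var: "sym_subst sym_var f = f"
  unfolding sym_subst_def sym_monomial by (simp add: mult_single flip: poly_mapping_sum_single)

lemma dvd_mult_diff:
  fixes x y u v d :: "'a::comm_ring_1"
  assumes "d dvd x - y" "d dvd u - v" shows "d dvd x * u - y * v"
proof -
  have "x * u - y * v = x * (u - v) + (x - y) * v" by (simp add: algebra_simps)
  then show ?thesis using assms by simp
qed

lemma dvd_prod_power_diff: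
  fixes x y :: "'k \<Rightarrow> 'a::comm_ring_1"
  assumes "\<And>i. d dvd x i - y i"
  shows "d dvd (\<Prod>i\<in>A. x i ^ n i) - (\<Prod>i\<in>A. y i ^ n i)"
proof -
  have "d dvd x i ^ k - y i ^ k" for i k
    by (induction k) (simp_all add: dvd_mult_diff assms)
  then show ?thesis
    by (induction A rule: infinite_finite_induct) (simp_all add: dvd_mult_diff)
qed

text \<open>Modulo \<open>d\<close> the substitution fixes every variable, hence every polynomial.\<close>

lemma dvd_diff_sym_subst:
  assumes "\<And>i. d dvd sym_var i - h i" shows "d dvd f - sym_subst h f"
proof -
  have "f - sym_subst h f = sym_subst sym_var f - sym_subst h f" by (simp only: sym_subst_var)
  also have "\<dots> = (\<Sum>m\<in>keys f. const (lookup f m) *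
      ((\<Prod>i\<in>UNIV. sym_var i ^ lookup m i) - (\<Prod>i\<in>UNIV. h i ^ lookup m i)))"
    by (simp add: sym_subst_def sum_subtractf right_diff_distrib)
  finally show ?thesis using assms by (simp add: dvd_sum dvd_mult dvd_prod_power_diff)
qed

lemma sym_weight_diff_multiple:
  assumes "\<And>i. coroot (a i) \<bullet> \<mu> \<in> \<int>" "\<And>i. coroot (a i) \<bullet> \<alpha> \<in> \<int>"
  shows "sym_weight a (\<mu> - of_int n *\<^sub>R \<alpha>) = sym_weight a \<mu> - of_int n * sym_weight a \<alpha>"
proof -
  have fl: "\<lfloor>coroot (a i) \<bullet> (\<mu> - of_int n *\<^sub>R \<alpha>)\<rfloor> = \<lfloor>coroot (a i) \<bullet> \<mu>\<rfloor> - n * \<lfloor>coroot (a i) \<bullet> \<alpha>\<rfloor>" for i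
  proof -
    obtain p q where "coroot (a i) \<bullet> \<mu> = of_int p" "coroot (a i) \<bullet> \<alpha> = of_int q"
      using assms by (meson Ints_cases)
    then have "coroot (a i) \<bullet> (\<mu> - of_int n *\<^sub>R \<alpha>) = of_int (p - n * q)" by (simp add: inner_diff_right)
    then show ?thesis
      using \<open>coroot (a i) \<bullet> \<mu> = of_int p\<close> \<open>coroot (a i) \<bullet> \<alpha> = of_int q\<close> by (simp only: floor_of_int)
  qed
  have "single k (of_int (p - n * q)) = single k (of_int p) - of_int n * single k (of_int q :: rat)"
    for k :: "'a \<Rightarrow>\<^sub>0 nat" and p q
    by (simp add: single_diff mult_single flip: single_of_int)
  then show ?thesis
    unfolding sym_weight_def fl by (simp only: sum_subtractf sum_distrib_left)
qed

context affine_root_datum begin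

lemma eq_0_if_orthogonal:
  assumes "\<And>i. coroot (a i) \<bullet> v = 0" shows "v = 0"
proof -
  have "a i \<bullet> v = 0" for i
    using assms[of i] root_nonzero[OF simple_root, of i] by (simp add: coroot_def)
  then have "(\<Sum>i\<in>UNIV. (v \<bullet> dual i) *\<^sub>R a i) \<bullet> v = 0" by (simp add: inner_sum_left)
  then show ?thesis using simple_expansion[of v] by simp
qed

lemma coroot_fund_weight: "coroot (a j) \<bullet> fund_weight a i = (if i = j then 1 else 0)"
proof -
  let ?P = "\<lambda>\<omega>. \<forall>j. coroot (a j) \<bullet> \<omega> = (if i = j then 1 else 0)"
  have "\<exists>!\<omega>. ?P \<omega>"
  proof (rule ex1I)
    show "?P (((a i \<bullet> a i) / 2) *\<^sub>R dual i)"
      using root_nonzero[OF simple_root] by (auto simp: coroot_def)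
    fix \<omega> assume "?P \<omega>"
    then have "coroot (a j) \<bullet> (\<omega> - ((a i \<bullet> a i) / 2) *\<^sub>R dual i) = 0" for j
      using root_nonzero[OF simple_root] by (auto simp: inner_diff_right coroot_def)
    from eq_0_if_orthogonal[OF this] show "\<omega> = ((a i \<bullet> a i) / 2) *\<^sub>R dual i" by simp
  qed
  from theI'[OF this] show ?thesis unfolding fund_weight_def by blast
qed

lemma sym_weight_nonzero:
  assumes "\<alpha> \<in> \<Delta>" shows "sym_weight a \<alpha> \<noteq> 0"
proof
  assume z: "sym_weight a \<alpha> = 0"
  have "coroot (a j) \<bullet> \<alpha> = 0" for j
  proof -
    have "lookup (sym_weight a \<alpha>) (single j 1) =
        (\<Sum>i\<in>UNIV. if i = j then rat_of_int \<lfloor>coroot (a j) \<bullet> \<alpha>\<rfloor> else 0)"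
      unfolding sym_weight_def lookup_sum
      by (rule sum.cong) (auto simp: lookup_single when_def dest: arg_cong[of _ _ keys])
    then have "\<lfloor>coroot (a j) \<bullet> \<alpha>\<rfloor> = 0" by (simp add: z)
    then show ?thesis using root_integral[OF simple_root assms, of j] by (auto elim: Ints_cases)
  qed
  then show False using eq_0_if_orthogonal root_nonzero[OF assms] by blast
qed

text \<open>
  Coroots are integral combinations of simple coroots.  By induction on the height, a positive root
  that is not simple is reflected by some simple \<open>s\<^sub>i\<close> to a positive root of smaller height, and this
  changes the coroot by an integral multiple of the \<open>i\<close>-th simple coroot.
\<close>

lemma coroot_weight_integral_positive:
  assumes "\<beta> \<in> \<Delta>" "\<beta> \<in> nonneg_combs a" "(\<Sum>i\<in>UNIV. \<beta> \<bullet> dual i) \<le> real h"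
  shows "coroot \<beta> \<bullet> fund_weight a j \<in> \<int>"
  using assms
proof (induction h arbitrary: \<beta>)
  case 0
  have "\<beta> \<bullet> dual i = 0" for i
    using 0 inner_dual_nonneg[of \<beta>] sum_nonneg_eq_0_iff[of UNIV "\<lambda>i. \<beta> \<bullet> dual i"]
      sum_nonneg[of UNIV "\<lambda>i. \<beta> \<bullet> dual i"] by auto
  then have "\<beta> = 0" by (subst simple_expansion) simp
  then show ?case using root_nonzero 0 by blast
next
  case (Suc h)
  show ?case
  proof (cases "\<beta> \<in> range a")
    case True
    then show ?thesis using coroot_fund_weight by auto
  next
    case False
    have "\<exists>i. 0 < a i \<bullet> \<beta>"
    proof (rule ccontr)
      assume "\<not> ?thesis"
      then have "(\<Sum>i\<in>UNIV. (\<beta> \<bullet> dual i) * (a i \<bullet> \<beta>)) \<le> 0"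
        using inner_dual_nonneg[OF Suc.prems(2)] by (intro sum_nonpos mult_nonneg_nonpos) (auto simp: not_less)
      moreover have "\<beta> \<bullet> \<beta> = (\<Sum>i\<in>UNIV. (\<beta> \<bullet> dual i) * (a i \<bullet> \<beta>))"
        by (subst simple_expansion) (simp add: inner_sum_left)
      ultimately show False using root_nonzero[OF Suc.prems(1)] by (metis inner_gt_zero_iff not_less)
    qed
    then obtain i where i: "0 < a i \<bullet> \<beta>" by blast
    let ?\<gamma> = "reflection (a i) \<beta>"
    have nz: "a i \<noteq> 0" using root_nonzero[OF simple_root] .
    obtain n where n: "coroot (a i) \<bullet> \<beta> = of_int n"
      using root_integral[OF simple_root Suc.prems(1)] by (auto elim: Ints_cases)
    have "0 < coroot (a i) \<bullet> \<beta>" using i nz by (simp add: coroot_def)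
    then have n1: "1 \<le> n" using n by simp
    have \<gamma>: "?\<gamma> \<in> \<Delta>" using root_reflection[OF simple_root Suc.prems(1)] .
    have "affine_positive (affine_reflect_root (affine_simple_root (Some i)) (\<beta>, 0))"
      by (rule pos_act) (use Suc.prems False in \<open>auto simp: affine_positive_def\<close>)
    then have pos: "?\<gamma> \<in> nonneg_combs a"
      by (simp add: affine_reflect_root_def affine_positive_def)
    have "(\<Sum>k\<in>UNIV. ?\<gamma> \<bullet> dual k) = (\<Sum>k\<in>UNIV. \<beta> \<bullet> dual k) - (\<Sum>k\<in>UNIV. of_int n * (if i = k then 1 else 0))"
      by (simp add: reflection_eq n inner_diff_left sum_subtractf)
    also have "(\<Sum>k\<in>UNIV. of_int n * (if i = k then 1 else 0)) = (of_int n :: real)"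
      by (simp flip: sum_distrib_left)
    finally have "(\<Sum>k\<in>UNIV. ?\<gamma> \<bullet> dual k) \<le> real h"
      using Suc.prems(3) n1 by simp
    then have IH: "coroot ?\<gamma> \<bullet> fund_weight a j \<in> \<int>" using Suc.IH \<gamma> pos by blast
    have "\<beta> = reflection (a i) ?\<gamma>"
      using fun_cong[OF affine_reflection_involution[OF nz, of 0], of \<beta>] by simp
    then have "coroot \<beta> = reflection (a i) (coroot ?\<gamma>)" using coroot_reflection[OF nz] by metis
    then have "coroot \<beta> = coroot ?\<gamma> - (coroot ?\<gamma> \<bullet> a i) *\<^sub>R coroot (a i)"
      by (simp add: affine_reflection_def[of "a i" 0 "coroot ?\<gamma>"])
    then have "coroot \<beta> \<bullet> fund_weight a j = coroot ?\<gamma> \<bullet> fund_weight a j -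
        (coroot ?\<gamma> \<bullet> a i) * (coroot (a i) \<bullet> fund_weight a j)"
      by (simp add: inner_diff_left)
    then show ?thesis
      using IH root_integral[OF \<gamma> simple_root, of i] coroot_fund_weight[of i j] by simp
  qed
qed

lemma coroot_weight_integral:
  assumes "\<beta> \<in> \<Delta>" shows "coroot \<beta> \<bullet> fund_weight a j \<in> \<int>"
proof -
  have pos: "coroot \<beta> \<bullet> fund_weight a j \<in> \<int>" if "\<beta> \<in> \<Delta>" "\<beta> \<in> nonneg_combs a" for \<beta>
  proof -
    obtain h where "(\<Sum>i\<in>UNIV. \<beta> \<bullet> dual i) \<le> real h" using real_arch_simple by blast
    then show ?thesis using coroot_weight_integral_positive that by blast
  qed
  show ?thesis
  proof (cases "\<beta> \<in> nonneg_combs a")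
    case False
    then have "- \<beta> \<in> nonneg_combs a" using assms simple by (auto simp: simple_roots_def)
    then show ?thesis using pos[of "- \<beta>"] root_uminus[OF assms] by simp
  qed (use pos assms in blast)
qed

lemma sym_weight_fund_weight: "sym_weight a (fund_weight a i) = sym_var i"
proof -
  have "sym_weight a (fund_weight a i) = (\<Sum>j\<in>UNIV. if i = j then sym_var i else 0)"
    unfolding sym_weight_def by (rule sum.cong) (simp_all add: coroot_fund_weight)
  then show ?thesis by simp
qed

text \<open>
  On a fundamental weight, \<open>s\<^sub>\<alpha>\<close> subtracts an integral multiple of \<open>\<alpha>\<close>.  Integrality is what makes
  the image under \<open>sym_weight\<close>, which is defined by rounding, the one expected.
\<close>

lemma sym_weight_dvd:
  assumes "\<alpha> \<in> \<Delta>" shows "sym_weight a \<alpha> dvd f - sym_reflection a \<alpha> f"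
  unfolding sym_reflection_def
proof (rule dvd_diff_sym_subst)
  fix i
  obtain n where n: "coroot \<alpha> \<bullet> fund_weight a i = of_int n"
    using coroot_weight_integral[OF assms] by (auto elim: Ints_cases)
  have "sym_weight a (reflection \<alpha> (fund_weight a i)) = sym_var i - of_int n * sym_weight a \<alpha>"
    unfolding reflection_eq n sym_weight_fund_weight[symmetric]
    using root_integral[OF simple_root assms] by (intro sym_weight_diff_multiple) (simp_all add: coroot_fund_weight)
  then show "sym_weight a \<alpha> dvd sym_var i - sym_weight a (reflection \<alpha> (fund_weight a i))" by simp
qed

end

text \<open>
  A linear order on the index set makes the polynomial ring \<open>S\<close> an integral domain, so that the
  quotient defining a divided difference is unique.
\<close>

locale affine_root_datum_sym = affine_root_datum \<Delta> a \<theta>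
  for \<Delta> :: "'v::euclidean_space set" and a :: "'i::{finite,linorder} \<Rightarrow> 'v" and \<theta> :: 'v
begin

lemma divided_difference_eq_iff:
  assumes "\<alpha> \<in> \<Delta>"
  shows "divided_difference a \<alpha> f = g \<longleftrightarrow> sym_weight a \<alpha> * g = f - sym_reflection a \<alpha> f"
proof -
  obtain g' where g': "f - sym_reflection a \<alpha> f = sym_weight a \<alpha> * g'"
    using sym_weight_dvd[OF assms] by (auto elim: dvdE)
  have "divided_difference a \<alpha> f = g'"
    unfolding divided_difference_def g' using sym_weight_nonzero[OF assms] by (intro the_equality) auto
  then show ?thesis using g' sym_weight_nonzero[OF assms] by auto
qed

lemma sym_weight_divided_difference:
  "\<alpha> \<in> \<Delta> \<Longrightarrow> sym_weight a \<alpha> * divided_difference a \<alpha> f = f - sym_reflection a \<alpha> f"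
  using divided_difference_eq_iff by blast

lemma sym_reflection_linear:
  "sym_reflection a \<alpha> (f + g) = sym_reflection a \<alpha> f + sym_reflection a \<alpha> g"
  "sym_reflection a \<alpha> (const c * f) = const c * sym_reflection a \<alpha> f"
  "sym_reflection a \<alpha> 1 = 1"
  by (simp_all add: sym_reflection_def sym_subst_add sym_subst_const_mult sym_subst_1)

lemma divided_difference_linear:
  assumes "\<alpha> \<in> \<Delta>"
  shows "divided_difference a \<alpha> (f + g) = divided_difference a \<alpha> f + divided_difference a \<alpha> g"
    and "divided_difference a \<alpha> (const c * f) = const c * divided_difference a \<alpha> f"
    and "divided_difference a \<alpha> 1 = 0"
proof -
  note dd = sym_weight_divided_difference[OF assms]
  show "divided_difference a \<alpha> (f + g) = divided_difference a \<alpha> f + divided_difference a \<alpha> g"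
    using dd by (simp add: divided_difference_eq_iff[OF assms] sym_reflection_linear distrib_left)
  show "divided_difference a \<alpha> 1 = 0"
    by (simp add: divided_difference_eq_iff[OF assms] sym_reflection_linear)
  have "sym_weight a \<alpha> * (const c * divided_difference a \<alpha> f) = const c * (f - sym_reflection a \<alpha> f)"
    by (simp only: mult.left_commute[of "sym_weight a \<alpha>"] dd)
  then show "divided_difference a \<alpha> (const c * f) = const c * divided_difference a \<alpha> f"
    by (simp add: divided_difference_eq_iff[OF assms] sym_reflection_linear right_diff_distrib)
qed

end

section \<open>Cross products\<close>

lemma lookup_scale: "lookup (scale c p) k = c * lookup p k"
  by (simp add: map.rep_eq when_def)

lemma lookup_sym_extend: "lookup (sym_extend p) k = const (lookup p k)"
  by (simp add: sym_extend_def map.rep_eq when_def)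

lemma scale_simps [simp]:
  fixes p q :: "'x \<Rightarrow>\<^sub>0 'b::comm_ring_1"
  shows "scale 0 p = 0" "scale 1 p = p" "scale f 0 = 0"
    "scale f (p + q) = scale f p + scale f q" "scale (f + g) p = scale f p + scale g p"
    "scale f (scale g p) = scale (f * g) p" "scale f (single v g) = single v (f * g)"
    "scale f (- p) = - scale f p" "scale (- f) p = - scale f p"
  by (rule poly_mapping_eqI; simp add: lookup_scale lookup_add lookup_single when_def algebra_simps)+

lemma map_zero_function [simp]: "Poly_Mapping.map (\<lambda>_. 0) p = 0"
  by (rule poly_mapping_eqI) (simp add: map.rep_eq)

lemma scale_sum: "scale f (sum F A) = (\<Sum>x\<in>A. scale f (F x :: 'x \<Rightarrow>\<^sub>0 'b::comm_ring_1))"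
  by (induction A rule: infinite_finite_induct) simp_all

lemma sym_extend_simps [simp]:
  "sym_extend 0 = 0" "sym_extend (p + q) = sym_extend p + sym_extend q"
  "sym_extend (scale c p) = scale (const c) (sym_extend p)"
  "sym_extend (single v c) = single v (const c)"
  by (rule poly_mapping_eqI; simp add: lookup_scale lookup_sym_extend lookup_add lookup_single when_def
      single_add mult_single)+

lemma sym_extend_sum: "sym_extend (sum F A) = (\<Sum>x\<in>A. sym_extend (F x))"
  by (induction A rule: infinite_finite_induct) simp_all

lemma sym_extend_diff: "sym_extend (p - q) = sym_extend p - sym_extend q"
  by (rule poly_mapping_eqI) (simp add: lookup_sym_extend lookup_minus single_diff)

lemma scale_diff: "scale f (p - q) = scale f p - scale f (q :: 'x \<Rightarrow>\<^sub>0 'b::comm_ring_1)"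
  by (rule poly_mapping_eqI) (simp add: lookup_scale lookup_minus right_diff_distrib)

lemma scale_keys: "keys (scale f p) \<subseteq> keys (p :: 'x \<Rightarrow>\<^sub>0 'b::comm_ring_1)"
  by (auto simp: in_keys_iff lookup_scale)

lemma single_mult_scale: "single w c * q = scale c (word w * q)" for q :: "'x list \<Rightarrow>\<^sub>0 rat"
proof -
  have "single w c = single 0 c * word w" by (simp add: mult_single)
  then show ?thesis by (simp only: mult_map_scale_conv_mult mult.assoc)
qed

lemma additive_0:
  assumes "\<And>p q. F (p + q) = (F p + F q :: 'b::ab_group_add)" shows "F (0 :: 'a::monoid_add) = 0"
  using assms[of 0 0] by simp

lemma additive_sum:
  assumes "\<And>p q. F (p + q) = (F p + F q :: 'b::ab_group_add)"
  shows "F (sum G A) = (\<Sum>x\<in>A. F (G x :: 'a::comm_monoid_add))"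
  by (induction A rule: infinite_finite_induct) (simp_all add: assms additive_0[of F])

lemma additive_eqI:
  fixes F G :: "('x \<Rightarrow>\<^sub>0 'a::comm_monoid_add) \<Rightarrow> 'b::ab_group_add"
  assumes "\<And>p q. F (p + q) = F p + F q" "\<And>p q. G (p + q) = G p + G q"
    and "\<And>v c. F (single v c) = G (single v c)"
  shows "F p = G p"
proof -
  have "F (\<Sum>m\<in>keys p. single m (lookup p m)) = G (\<Sum>m\<in>keys p. single m (lookup p m))"
    using assms by (simp add: additive_sum[of F] additive_sum[of G])
  then show ?thesis by (simp flip: poly_mapping_sum_single)
qed

text \<open>
  Each letter acts on \<open>S\<close> by two \<open>\<rat>\<close>-linear maps \<open>s x\<close> and \<open>d x\<close> that treat the constants as an
  automorphism and a derivation do.  By the cross relation, letters then commute with constants, so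
  that a product with an element of the free algebra on the right is the product of the free algebra.
\<close>

locale twisted_letters =
  fixes X :: "'x set" and s d :: "'x \<Rightarrow> 'i sym \<Rightarrow> 'i sym"
  assumes s_add: "x \<in> X \<Longrightarrow> s x (f + g) = s x f + s x g"
    and s_const_mult: "x \<in> X \<Longrightarrow> s x (const c * f) = const c * s x f"
    and s_1: "x \<in> X \<Longrightarrow> s x 1 = 1"
    and d_add: "x \<in> X \<Longrightarrow> d x (f + g) = d x f + d x g"
    and d_const_mult: "x \<in> X \<Longrightarrow> d x (const c * f) = const c * d x f"
    and d_1: "x \<in> X \<Longrightarrow> d x 1 = 0"
begin

lemma s_0: "x \<in> X \<Longrightarrow> s x 0 = 0"
  using s_add[of x 0 0] by simp

lemma d_0: "x \<in> X \<Longrightarrow> d x 0 = 0"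
  using d_add[of x 0 0] by simp

lemma letter_mult_add:
  "x \<in> X \<Longrightarrow> letter_mult s d x (p + q) = letter_mult s d x p + letter_mult s d x q"
  unfolding letter_mult_def
  by (rule setsum_keys_plus_distrib) (simp_all add: s_0 d_0 s_add d_add single_add)

lemma letter_mult_single:
  "x \<in> X \<Longrightarrow> letter_mult s d x (single v f) = single v (d x f) + single (x # v) (s x f)"
  by (cases "f = 0") (simp_all add: letter_mult_def s_0 d_0)

lemma letter_mult_extend:
  assumes "x \<in> X"
  shows "letter_mult s d x (scale f (sym_extend p)) =
    scale (d x f) (sym_extend p) + scale (s x f) (sym_extend (word [x] * p))"
proof (rule additive_eqI[where p = p])
  fix v c
  have "d x (f * const c) = d x f * const c" "s x (f * const c) = s x f * const c"
    using d_const_mult[OF assms, of c f] s_const_mult[OF assms, of c f] by (simp_all add: mult.commute)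
  then show "letter_mult s d x (scale f (sym_extend (single v c))) =
      scale (d x f) (sym_extend (single v c)) + scale (s x f) (sym_extend (word [x] * single v c))"
    using assms by (simp add: letter_mult_single mult_single plus_list_def)
qed (use assms in \<open>simp_all add: letter_mult_add distrib_left\<close>)

lemma foldr_letter_mult_add:
  "w \<in> lists X \<Longrightarrow>
    foldr (letter_mult s d) w (p + q) = foldr (letter_mult s d) w p + foldr (letter_mult s d) w q"
  by (induction w) (simp_all add: letter_mult_add)

lemma foldr_letter_mult_extend:
  "w \<in> lists X \<Longrightarrow> foldr (letter_mult s d) w (sym_extend q) = sym_extend (word w * q)"
proof (induction w)
  case Nil
  have "word [] = (1 :: 'x list \<Rightarrow>\<^sub>0 rat)" by (simp flip: zero_list_def)
  then show ?case by simp
next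
  case (Cons x w)
  have "word (x # w) * q = word [x] * (word w * q)"
    by (simp add: mult_single plus_list_def flip: mult.assoc)
  then show ?case
    using Cons letter_mult_extend[of x 1 "word w * q"] by (simp add: d_1 s_1)
qed

lemma cross_mult_add_left: "cross_mult s d (p + p') q = cross_mult s d p q + cross_mult s d p' q"
  unfolding cross_mult_def by (rule setsum_keys_plus_distrib) simp_all

lemma cross_mult_add_right:
  "keys p \<subseteq> lists X \<Longrightarrow> cross_mult s d p (q + q') = cross_mult s d p q + cross_mult s d p q'"
  unfolding cross_mult_def by (simp add: subset_eq foldr_letter_mult_add sum.distrib)

lemma cross_mult_extend:
  assumes "keys p \<subseteq> lists X"
  shows "cross_mult s d (scale f (sym_extend p)) (sym_extend q) = scale f (sym_extend (p * q))"
proof -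
  have "keys (scale f (sym_extend p)) \<subseteq> keys p"
    by (auto simp: in_keys_iff lookup_scale lookup_sym_extend)
  then have "cross_mult s d (scale f (sym_extend p)) (sym_extend q) =
    (\<Sum>w\<in>keys p. scale (lookup (scale f (sym_extend p)) w) (foldr (letter_mult s d) w (sym_extend q)))"
    unfolding cross_mult_def by (intro sum_keys_superset) simp_all
  also have "\<dots> = (\<Sum>w\<in>keys p. scale f (sym_extend (single w (lookup p w) * q)))"
    using assms by (intro sum.cong)
      (auto simp: foldr_letter_mult_extend[OF subsetD[OF assms]] lookup_scale lookup_sym_extend single_mult_scale[of _ "lookup p _"])
  also have "\<dots> = scale f (sym_extend ((\<Sum>w\<in>keys p. single w (lookup p w)) * q))"
    by (simp add: sum_distrib_right sym_extend_sum scale_sum)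
  finally show ?thesis by (simp flip: poly_mapping_sum_single)
qed

end

lemma sym_span_0: "0 \<in> sym_span I"
  unfolding sym_span_def by (intro CollectI exI[of _ "{}"]) simp

lemma sym_span_add:
  assumes "x \<in> sym_span I" "y \<in> sym_span I" shows "x + y \<in> sym_span I"
proof -
  obtain F g where F: "finite F" "F \<subseteq> I" "x = (\<Sum>p\<in>F. scale (g p) (sym_extend p))"
    using assms(1) by (auto simp: sym_span_def)
  obtain F' g' where F': "finite F'" "F' \<subseteq> I" "y = (\<Sum>p\<in>F'. scale (g' p) (sym_extend p))"
    using assms(2) by (auto simp: sym_span_def)
  let ?g = "\<lambda>p. if p \<in> F then g p else 0" and ?g' = "\<lambda>p. if p \<in> F' then g' p else 0"
  have "x = (\<Sum>p\<in>F \<union> F'. scale (?g p) (sym_extend p))"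
    unfolding F by (rule sum.mono_neutral_cong_left) (use F F' in auto)
  moreover have "y = (\<Sum>p\<in>F \<union> F'. scale (?g' p) (sym_extend p))"
    unfolding F' by (rule sum.mono_neutral_cong_left) (use F F' in auto)
  ultimately have "x + y = (\<Sum>p\<in>F \<union> F'. scale (?g p + ?g' p) (sym_extend p))"
    by (simp add: sum.distrib)
  then show ?thesis
    unfolding sym_span_def using F F' by (intro CollectI exI[of _ "F \<union> F'"] exI[of _ "\<lambda>p. ?g p + ?g' p"]) simp
qed

lemma sym_span_base:
  assumes "p \<in> I" shows "scale f (sym_extend p) \<in> sym_span I"
  unfolding sym_span_def by (intro CollectI exI[of _ "{p}"] exI[of _ "\<lambda>_. f"]) (use assms in auto)

lemma sym_span_induct [consumes 1, case_names zero step]: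
  assumes "x \<in> sym_span I" "P 0"
    and "\<And>f p y. p \<in> I \<Longrightarrow> y \<in> sym_span I \<Longrightarrow> P y \<Longrightarrow> P (scale f (sym_extend p) + y)"
  shows "P x"
proof -
  obtain F g where F: "finite F" "F \<subseteq> I" "x = (\<Sum>p\<in>F. scale (g p) (sym_extend p))"
    using assms(1) by (auto simp: sym_span_def)
  have "(\<Sum>p\<in>F. scale (g p) (sym_extend p)) \<in> sym_span I \<and> P (\<Sum>p\<in>F. scale (g p) (sym_extend p))"
    using F(1,2)
  proof (induction F rule: finite_induct)
    case empty
    then show ?case using assms(2) by (simp add: sym_span_0)
  next
    case (insert p F)
    then show ?case using assms(3)[of p] by (auto intro: sym_span_add sym_span_base)
  qed
  then show ?thesis using F(3) by simp
qed

lemma sym_span_scale: "x \<in> sym_span I \<Longrightarrow> scale f x \<in> sym_span I"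
  by (induction rule: sym_span_induct) (auto intro: sym_span_0 sym_span_add sym_span_base)

lemma sym_span_uminus: "x \<in> sym_span I \<Longrightarrow> - x \<in> sym_span I"
  using sym_span_scale[of x I "-1"] by simp

lemma sym_span_diff: "x \<in> sym_span I \<Longrightarrow> y \<in> sym_span I \<Longrightarrow> x - y \<in> sym_span I"
  using sym_span_add[of x I "- y"] sym_span_uminus[of y I] by simp

lemma sym_span_sum: "(\<And>x. x \<in> A \<Longrightarrow> F x \<in> sym_span I) \<Longrightarrow> sum F A \<in> sym_span I"
  by (induction A rule: infinite_finite_induct) (auto intro: sym_span_0 sym_span_add)

lemma sym_coset_iff:
  "h \<in> sym_span I +>\<^bsub>free_cross_product X s d\<^esub> p \<longleftrightarrow> h - p \<in> sym_span I"
proof -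
  have "h \<in> sym_span I +>\<^bsub>free_cross_product X s d\<^esub> p \<longleftrightarrow> (\<exists>k\<in>sym_span I. h = k + p)"
    by (simp add: a_r_coset_def' free_cross_product_def)
  also have "\<dots> \<longleftrightarrow> h - p \<in> sym_span I" by (auto intro: bexI[of _ "h - p"])
  finally show ?thesis .
qed

lemma sym_coset_eq_iff:
  "sym_span I +>\<^bsub>free_cross_product X s d\<^esub> p = sym_span I +>\<^bsub>free_cross_product X s d\<^esub> q
    \<longleftrightarrow> p - q \<in> sym_span I" (is "?P = ?Q \<longleftrightarrow> _")
proof
  assume "?P = ?Q"
  then have "p \<in> ?P \<longleftrightarrow> p \<in> ?Q" by simp
  then show "p - q \<in> sym_span I" by (simp add: sym_coset_iff sym_span_0)
next
  assume pq: "p - q \<in> sym_span I"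
  have "h - p \<in> sym_span I \<longleftrightarrow> h - q \<in> sym_span I" for h
    using sym_span_add[OF _ pq, of "h - p"] sym_span_diff[OF _ pq, of "h - q"] by auto
  then show "?P = ?Q" by (auto simp: sym_coset_iff)
qed

lemma cross_product_carrier:
  "carrier (cross_product X s d I) = {sym_span I +>\<^bsub>free_cross_product X s d\<^esub> p | p. keys p \<subseteq> lists X}"
  by (auto simp: cross_product_def FactRing_def A_RCOSETS_def' free_cross_product_def)

lemma cross_product_add:
  "(sym_span I +>\<^bsub>free_cross_product X s d\<^esub> p) \<oplus>\<^bsub>cross_product X s d I\<^esub> (sym_span I +>\<^bsub>free_cross_product X s d\<^esub> q) =
    sym_span I +>\<^bsub>free_cross_product X s d\<^esub> (p + q)" (is "?P \<oplus>\<^bsub>_\<^esub> ?Q = ?R")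
proof -
  have "?P \<oplus>\<^bsub>cross_product X s d I\<^esub> ?Q = {h + k | h k. h \<in> ?P \<and> k \<in> ?Q}"
    by (auto simp: cross_product_def FactRing_def set_add_def set_mult_def) (auto simp: free_cross_product_def)
  also have "\<dots> = ?R"
  proof (intro Set.set_eqI iffI)
    fix x assume "x \<in> {h + k | h k. h \<in> ?P \<and> k \<in> ?Q}"
    then obtain h k where "x = h + k" "h - p \<in> sym_span I" "k - q \<in> sym_span I" by (auto simp: sym_coset_iff)
    then show "x \<in> ?R" using sym_span_add[of "h - p" I "k - q"] by (simp add: sym_coset_iff algebra_simps)
  next
    fix x assume "x \<in> ?R"
    then have "x = (x - q) + q" "x - q \<in> ?P" "q \<in> ?Q"
      by (simp_all add: sym_coset_iff sym_span_0 algebra_simps)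
    then show "x \<in> {h + k | h k. h \<in> ?P \<and> k \<in> ?Q}" by blast
  qed
  finally show ?thesis .
qed

lemma cross_product_mult:
  "A \<otimes>\<^bsub>cross_product X s d I\<^esub> B = (\<Union>p\<in>A. \<Union>q\<in>B. sym_span I +>\<^bsub>free_cross_product X s d\<^esub> cross_mult s d p q)"
  by (simp add: cross_product_def FactRing_def rcoset_mult_def) (simp add: free_cross_product_def)

lemma cross_product_one:
  "\<one>\<^bsub>cross_product X s d I\<^esub> = sym_span I +>\<^bsub>free_cross_product X s d\<^esub> single [] 1"
  by (simp add: cross_product_def FactRing_def) (simp add: free_cross_product_def)

text \<open>
  A product of cosets is by definition a union of cosets, one of which is that of the product of the
  given representatives.  If the union is a single coset, it has to be this one.
\<close>

lemma cross_product_mult_in_carrier: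
  assumes "(sym_span I +>\<^bsub>free_cross_product X s d\<^esub> p) \<otimes>\<^bsub>cross_product X s d I\<^esub>
      (sym_span I +>\<^bsub>free_cross_product X s d\<^esub> q) \<in> carrier (cross_product X s d I)"
  shows "(sym_span I +>\<^bsub>free_cross_product X s d\<^esub> p) \<otimes>\<^bsub>cross_product X s d I\<^esub>
      (sym_span I +>\<^bsub>free_cross_product X s d\<^esub> q) = sym_span I +>\<^bsub>free_cross_product X s d\<^esub> cross_mult s d p q"
    (is "?m = _")
proof -
  obtain c where c: "?m = sym_span I +>\<^bsub>free_cross_product X s d\<^esub> c"
    using assms by (auto simp: cross_product_carrier)
  have "p \<in> sym_span I +>\<^bsub>free_cross_product X s d\<^esub> p" "q \<in> sym_span I +>\<^bsub>free_cross_product X s d\<^esub> q"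
    "cross_mult s d p q \<in> sym_span I +>\<^bsub>free_cross_product X s d\<^esub> cross_mult s d p q"
    by (simp_all add: sym_coset_iff sym_span_0)
  then have "cross_mult s d p q \<in> ?m" unfolding cross_product_mult by blast
  then have "cross_mult s d p q - c \<in> sym_span I" unfolding c by (simp add: sym_coset_iff)
  from sym_span_uminus[OF this] show ?thesis unfolding c by (simp add: sym_coset_eq_iff)
qed

text \<open>
  For an ideal \<open>I\<close> of the free algebra \<open>T\<close>, the cross relation makes \<open>S \<otimes> I\<close> a left ideal of the
  cross product that is stable under right multiplication by \<open>T\<close>.
\<close>

locale twisted_letters_ideal = twisted_letters X s d
  for X :: "'x set" and s d :: "'x \<Rightarrow> 'i sym \<Rightarrow> 'i sym" +
  fixes I :: "('x list \<Rightarrow>\<^sub>0 rat) set"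
  assumes ideal_keys: "p \<in> I \<Longrightarrow> keys p \<subseteq> lists X"
    and ideal_left: "p \<in> I \<Longrightarrow> keys q \<subseteq> lists X \<Longrightarrow> q * p \<in> I"
    and ideal_right: "p \<in> I \<Longrightarrow> keys q \<subseteq> lists X \<Longrightarrow> p * q \<in> I"
begin

lemma span_keys: "k \<in> sym_span I \<Longrightarrow> keys k \<subseteq> lists X"
proof (induction rule: sym_span_induct)
  case (step f p y)
  have "keys (scale f (sym_extend p)) \<subseteq> keys p"
    by (auto simp: in_keys_iff lookup_scale lookup_sym_extend)
  then show ?case using step ideal_keys[of p] keys_add[of "scale f (sym_extend p)" y] by blast
qed simp

lemma letter_mult_span:
  assumes "x \<in> X" "k \<in> sym_span I" shows "letter_mult s d x k \<in> sym_span I"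
  using assms(2)
proof (induction rule: sym_span_induct)
  case zero
  then show ?case by (simp add: letter_mult_def sym_span_0)
next
  case (step f p y)
  then show ?case
    using assms(1) ideal_left[of p "word [x]"]
    by (auto simp: letter_mult_add letter_mult_extend intro!: sym_span_add sym_span_base)
qed

lemma cross_mult_span_right:
  assumes "keys p \<subseteq> lists X" "k \<in> sym_span I" shows "cross_mult s d p k \<in> sym_span I"
proof -
  have "foldr (letter_mult s d) w k \<in> sym_span I" if "w \<in> lists X" for w
    using that by (induction w) (simp_all add: assms(2) letter_mult_span)
  then show ?thesis
    unfolding cross_mult_def using assms(1) by (auto intro!: sym_span_sum sym_span_scale)
qed

lemma cross_mult_span_left:
  assumes "keys q \<subseteq> lists X" "k \<in> sym_span I" shows "cross_mult s d k (sym_extend q) \<in> sym_span I"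
  using assms(2)
proof (induction rule: sym_span_induct)
  case zero
  then show ?case by (simp add: cross_mult_def sym_span_0)
next
  case (step f p y)
  then show ?case
    using ideal_keys ideal_right[OF _ assms(1)]
    by (auto simp: cross_mult_add_left cross_mult_extend intro!: sym_span_add sym_span_base)
qed

text \<open>
  With a right factor from \<open>T + S \<otimes> I\<close>, changing the representatives \<open>x\<close> and \<open>y\<close> changes \<open>x y\<close> only
  by an element of \<open>S \<otimes> I\<close>.
\<close>

lemma cross_product_mult_extend:
  assumes "keys p \<subseteq> lists X" "keys q \<subseteq> lists X"
  shows "(sym_span I +>\<^bsub>free_cross_product X s d\<^esub> scale f (sym_extend p)) \<otimes>\<^bsub>cross_product X s d I\<^esub>
      (sym_span I +>\<^bsub>free_cross_product X s d\<^esub> sym_extend q) =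
    sym_span I +>\<^bsub>free_cross_product X s d\<^esub> scale f (sym_extend (p * q))"
    (is "?A \<otimes>\<^bsub>_\<^esub> ?B = ?C")
proof -
  let ?p = "scale f (sym_extend p)"
  have "sym_span I +>\<^bsub>free_cross_product X s d\<^esub> cross_mult s d x y = ?C"
    if "x \<in> ?A" "y \<in> ?B" for x y
  proof -
    have x: "x - ?p \<in> sym_span I" and y: "y - sym_extend q \<in> sym_span I"
      using that by (simp_all add: sym_coset_iff)
    have "keys ?p \<subseteq> keys p" by (auto simp: in_keys_iff lookup_scale lookup_sym_extend)
    then have kx: "keys x \<subseteq> lists X"
      using assms(1) span_keys[OF x] keys_add[of "x - ?p" ?p] by auto
    have "cross_mult s d x y = cross_mult s d x (y - sym_extend q) + cross_mult s d x (sym_extend q)"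
      using cross_mult_add_right[OF kx, of "y - sym_extend q" "sym_extend q"] by simp
    also have "cross_mult s d x (sym_extend q) =
        cross_mult s d (x - ?p) (sym_extend q) + cross_mult s d ?p (sym_extend q)"
      using cross_mult_add_left[of "x - ?p" ?p "sym_extend q"] by simp
    also have "cross_mult s d ?p (sym_extend q) = scale f (sym_extend (p * q))"
      by (rule cross_mult_extend[OF assms(1)])
    finally have "cross_mult s d x y - scale f (sym_extend (p * q)) \<in> sym_span I"
      using cross_mult_span_right[OF kx y] cross_mult_span_left[OF assms(2) x]
      by (simp add: sym_span_add)
    then show ?thesis by (simp add: sym_coset_eq_iff)
  qed
  moreover have "?p \<in> ?A" "sym_extend q \<in> ?B" by (simp_all add: sym_coset_iff sym_span_0)
  ultimately show ?thesis unfolding cross_product_mult by blast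
qed

end

section \<open>Coefficients of symmetrized words\<close>

definition rat_linear :: "(('x list \<Rightarrow>\<^sub>0 rat) \<Rightarrow> ('x list \<Rightarrow>\<^sub>0 rat)) \<Rightarrow> bool"
  where "rat_linear F \<longleftrightarrow> (\<forall>p q. F (p + q) = F p + F q) \<and> (\<forall>c p. F (scale c p) = scale c (F p))"

lemma rat_linear_expand:
  assumes "rat_linear F"
  shows "lookup (F p) z = (\<Sum>u\<in>keys p. lookup p u * lookup (F (word u)) z)"
proof -
  have add: "F (p + q) = F p + F q" for p q using assms by (simp add: rat_linear_def)
  have "F p = F (\<Sum>u\<in>keys p. single u (lookup p u))" by (simp flip: poly_mapping_sum_single)
  also have "\<dots> = F (\<Sum>u\<in>keys p. scale (lookup p u) (word u))" by simp
  also have "\<dots> = (\<Sum>u\<in>keys p. F (scale (lookup p u) (word u)))" by (rule additive_sum[of F]) (rule add)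
  also have "\<dots> = (\<Sum>u\<in>keys p. scale (lookup p u) (F (word u)))"
    using assms by (simp only: rat_linear_def)
  finally show ?thesis by (simp add: lookup_sum lookup_scale)
qed

lemma braid_at_linear: "rat_linear (braid_at c i)"
proof -
  let ?W = "\<lambda>u. word (take i u) * c (u ! i) (u ! Suc i) * word (drop (Suc (Suc i)) u)"
  have "braid_at c i (p + q) = braid_at c i p + braid_at c i q" for p q
    unfolding braid_at_def by (rule setsum_keys_plus_distrib) simp_all
  moreover have "braid_at c i (scale b p) = scale b (braid_at c i p)" for b p
  proof -
    have "braid_at c i (scale b p) = (\<Sum>u\<in>keys p. scale (lookup (scale b p) u) (?W u))"
      unfolding braid_at_def by (intro sum_keys_superset) (simp_all add: scale_keys)
    also have "\<dots> = scale b (braid_at c i p)"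
      by (simp add: braid_at_def lookup_scale scale_sum)
    finally show ?thesis .
  qed
  ultimately show ?thesis by (simp add: rat_linear_def)
qed

lemma foldr_braid_at_rat_linear: "rat_linear (foldr (braid_at c) ks)"
proof (induction ks)
  case (Cons k ks)
  then show ?case using braid_at_linear[of c k] by (simp add: rat_linear_def)
qed (simp add: rat_linear_def)

lemma braided_symmetrizer_linear: "rat_linear (braided_symmetrizer c n)"
proof -
  have "rat_linear (braid_lift c n w)" for w
    unfolding braid_lift_def by (rule foldr_braid_at_rat_linear)
  then show ?thesis
    by (simp add: rat_linear_def braided_symmetrizer_def sum.distrib scale_sum)
qed

lemma reduced_expression_inside: "reduced_expression n w ks \<Longrightarrow> \<forall>k\<in>set ks. Suc k < n"
  by (simp add: reduced_expression_def expression_for_iff)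

text \<open>
  A braiding of a vector space with basis \<open>X\<close> that is, up to scalars, the braiding of a conjugation
  rack of involutions.
\<close>

locale involution_braiding =
  fixes X :: "'x set" and c :: "'x \<Rightarrow> 'x \<Rightarrow> ('x list \<Rightarrow>\<^sub>0 rat)" and deg :: "'x \<Rightarrow> 'p \<Rightarrow> 'p"
  assumes braiding: "x \<in> X \<Longrightarrow> y \<in> X \<Longrightarrow>
      \<exists>e z. z \<in> X \<and> c x y = single [z, x] e \<and> deg z = deg x \<circ> deg y \<circ> deg x"
    and deg_involution: "x \<in> X \<Longrightarrow> deg x \<circ> deg x = id"
begin

lemma braid_at_word:
  assumes "u \<in> lists X" "Suc k < length u"
  shows "\<exists>e v. v \<in> lists X \<and> length v = length u \<and> map deg v = hurwitz k (map deg u) \<and>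
    braid_at c k (single u b) = single v e"
proof -
  have x: "u ! k \<in> X" "u ! Suc k \<in> X" using assms by (auto simp: in_lists_conv_set)
  obtain e z where z: "z \<in> X" "c (u ! k) (u ! Suc k) = single [z, u ! k] e"
    "deg z = deg (u ! k) \<circ> deg (u ! Suc k) \<circ> deg (u ! k)"
    using braiding[OF x] by blast
  let ?v = "take k u @ [z, u ! k] @ drop (Suc (Suc k)) u"
  have "braid_at c k (single u b) = single ?v (b * e)"
    by (cases "b = 0") (simp_all add: braid_at_def z mult_single plus_list_def)
  moreover have "?v \<in> lists X"
    using assms(1) x z by (auto simp: in_lists_conv_set dest: in_set_takeD in_set_dropD)
  moreover have "map deg ?v = hurwitz k (map deg u)"
    using assms(2) z by (simp add: hurwitz_def take_map drop_map)
  moreover have "length ?v = length u" using assms(2) by simp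
  ultimately show ?thesis by blast
qed

text \<open>
  Each braiding replaces two neighbouring letters by two letters, up to a scalar, and acts on the
  degrees by a Hurwitz move.
\<close>

lemma foldr_braid_at_word:
  assumes "u \<in> lists X" "\<forall>k\<in>set ks. Suc k < length u"
  shows "\<exists>e v. v \<in> lists X \<and> length v = length u \<and> map deg v = foldr hurwitz ks (map deg u) \<and>
    foldr (braid_at c) ks (word u) = single v e"
  using assms(2)
proof (induction ks)
  case Nil
  then show ?case using assms(1) by auto
next
  case (Cons k ks)
  then obtain e v where v: "v \<in> lists X" "length v = length u" "map deg v = foldr hurwitz ks (map deg u)"
    "foldr (braid_at c) ks (word u) = single v e" by auto
  show ?case using braid_at_word[OF v(1), of k e] v Cons.prems by simp
qed

lemma product_hurwitz:
  assumes "u \<in> lists X" "\<forall>k\<in>set ks. Suc k < length u"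
  shows "product (foldr hurwitz ks (map deg u)) = product (map deg u)"
  using assms(2)
proof (induction ks)
  case (Cons k ks)
  then obtain v where v: "v \<in> lists X" "length v = length u" "map deg v = foldr hurwitz ks (map deg u)"
    using foldr_braid_at_word[OF assms(1), of ks] by auto
  have k: "Suc k < length (map deg v)" using v(2) Cons.prems by simp
  then have "v ! k \<in> X" using v(1) by (auto simp: in_lists_conv_set)
  then have "map deg v ! k \<circ> map deg v ! k = id" using k deg_involution by simp
  from hurwitz_suffix[OF k this, of 0] have "product (hurwitz k (map deg v)) = product (map deg v)" by simp
  then show ?case using Cons v(3) by simp
qed simp

lemma braid_lift_word:
  assumes "u \<in> lists X" "length u = n" "w permutes {..<n}"
  shows "\<exists>ks e v. reduced_expression n w ks \<and> v \<in> lists X \<and> length v = n \<and>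
    map deg v = foldr hurwitz ks (map deg u) \<and> product (map deg v) = product (map deg u) \<and>
    braid_lift c n w (word u) = single v e"
proof -
  let ?ks = "SOME ks. reduced_expression n w ks"
  have ks: "reduced_expression n w ?ks"
    by (rule someI_ex) (rule reduced_expression_exists[OF assms(3)])
  have inside: "\<forall>k\<in>set ?ks. Suc k < length u"
    unfolding assms(2) by (rule reduced_expression_inside[OF ks])
  obtain e v where v: "v \<in> lists X" "length v = length u" "map deg v = foldr hurwitz ?ks (map deg u)"
    "foldr (braid_at c) ?ks (word u) = single v e"
    using foldr_braid_at_word[OF assms(1) inside] by blast
  have "product (map deg v) = product (map deg u)"
    unfolding v(3) by (rule product_hurwitz[OF assms(1) inside])
  moreover have "braid_lift c n w (word u) = single v e"
    unfolding braid_lift_def by (rule v(4))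
  ultimately show ?thesis using ks v(1-3) assms(2) by blast
qed

lemma braid_lift_id: "braid_lift c n id p = p"
proof -
  have "ks = []" if "reduced_expression n id ks" for ks
  proof -
    have "expression_for n id []" by (simp add: expression_for_iff)
    then have "length ks \<le> length ([] :: nat list)" using that unfolding reduced_expression_def by blast
    then show ?thesis by simp
  qed
  then have "(SOME ks. reduced_expression n id ks) = []"
    using someI_ex[OF reduced_expression_exists[OF permutes_id, of n]] by blast
  then show ?thesis by (simp add: braid_lift_def)
qed

text \<open>
  Every permutation sends the word of \<open>v\<close> to a multiple of one word, whose degrees have the same
  product as those of \<open>v\<close>.  So the word of \<open>u\<close> occurs only if \<open>v = u\<close>, and then only for the identity,
  as Hurwitz moves along a nontrivial permutation never reproduce a reduced word.
\<close>

theorem symmetrizer_coefficient: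
  assumes letter: "\<And>i. letter i \<in> X" "\<And>i. deg (letter i) = s i"
    and u: "reduced_word s u" and v: "length v = length u"
    and neq: "v \<noteq> u \<Longrightarrow> composite s v \<noteq> composite s u"
  shows "lookup (braided_symmetrizer c (length u) (word (map letter v))) (map letter u) = (if v = u then 1 else 0)"
proof -
  let ?n = "length u"
  have s: "s i \<circ> s i = id" for i using deg_involution[OF letter(1), of i] letter(2) by simp
  have degs: "map deg (map letter x) = map s x" for x using letter(2) by simp
  have mem: "map letter x \<in> lists X" for x using letter(1) by (induction x) auto
  have "lookup (braid_lift c ?n w (word (map letter v))) (map letter u) = (if w = id \<and> v = u then 1 else 0)"
    if w: "w permutes {..<?n}" for w
  proof -
    obtain ks e z where z: "reduced_expression ?n w ks"
      "map deg z = foldr hurwitz ks (map deg (map letter v))"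
      "product (map deg z) = product (map deg (map letter v))"
      "braid_lift c ?n w (word (map letter v)) = single z e"
      using braid_lift_word[OF mem _ w, of v] v by auto
    show ?thesis
    proof (cases "v = u")
      case False
      have "z \<noteq> map letter u"
      proof
        assume "z = map letter u"
        then have "product (map s u) = product (map s v)" using z(3) by (simp only: degs)
        then show False using neq[OF False] by (simp add: product_map)
      qed
      then show ?thesis using False z(4) by (simp add: lookup_single)
    next
      case True
      show ?thesis
      proof (cases "w = id")
        case True
        then show ?thesis using \<open>v = u\<close> by (simp add: braid_lift_id)
      next
        case False
        have "z \<noteq> map letter u"
        proof
          assume "z = map letter u"
          then have "foldr hurwitz ks (map s u) = map s u" using z(2) \<open>v = u\<close> by (simp only: degs)
          then show False using hurwitz_fixes_no_reduced_word[OF u s z(1) False] by blast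
        qed
        then show ?thesis using False z(4) by (simp add: lookup_single)
      qed
    qed
  qed
  then have "lookup (braided_symmetrizer c ?n (word (map letter v))) (map letter u) =
      (\<Sum>w | w permutes {..<?n}. if w = id then (if v = u then 1 else 0) else 0)"
    unfolding braided_symmetrizer_def lookup_sum by (intro sum.cong) auto
  also have "\<dots> = (if v = u then 1 else 0)"
    by (simp add: finite_permutations permutes_id)
  finally show ?thesis .
qed

end

lemma lookup_degree_part: "lookup (degree_part n p) u = (if length u = n then lookup p u else 0)"
proof -
  have "lookup (degree_part n p) u = (\<Sum>v | v \<in> keys p \<and> length v = n. if v = u then lookup p u else 0)"
    unfolding degree_part_def lookup_sum by (rule sum.cong) (auto simp: lookup_single when_def)
  then show ?thesis by (auto simp: in_keys_iff)
qed

text \<open>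
  The coefficient of the monomial \<open>m\<close> of \<open>S\<close> and the word \<open>z\<close> in the degree \<open>n\<close> part of
  \<open>(id \<otimes> \<sigma>\<^sub>n) x\<close>, a linear form on \<open>S \<otimes> T\<close>.
\<close>

definition symmetrized_coeff ::
    "('x \<Rightarrow> 'x \<Rightarrow> ('x list \<Rightarrow>\<^sub>0 rat)) \<Rightarrow> nat \<Rightarrow> ('i \<Rightarrow>\<^sub>0 nat) \<Rightarrow> 'x list \<Rightarrow> ('x list \<Rightarrow>\<^sub>0 'i sym) \<Rightarrow> rat"
  where "symmetrized_coeff c n m z x = (\<Sum>u\<in>keys x.
    if length u = n then lookup (lookup x u) m * lookup (braided_symmetrizer c n (word u)) z else 0)"

lemma symmetrized_coeff_add:
  "symmetrized_coeff c n m z (x + y) = symmetrized_coeff c n m z x + symmetrized_coeff c n m z y"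
  unfolding symmetrized_coeff_def
  by (rule setsum_keys_plus_distrib) (simp_all add: lookup_add distrib_right)

lemma symmetrized_coeff_single:
  "symmetrized_coeff c n m z (single u f) =
    (if length u = n then lookup f m * lookup (braided_symmetrizer c n (word u)) z else 0)"
  by (cases "f = 0") (simp_all add: symmetrized_coeff_def)

lemma symmetrized_coeff_extend:
  "symmetrized_coeff c n m z (scale f (sym_extend p)) =
    lookup f m * lookup (braided_symmetrizer c n (degree_part n p)) z"
proof -
  let ?\<sigma> = "\<lambda>u. lookup (braided_symmetrizer c n (word u)) z"
  have keys: "keys (scale f (sym_extend p)) \<subseteq> keys p"
    by (auto simp: in_keys_iff lookup_scale lookup_sym_extend)
  have "symmetrized_coeff c n m z (scale f (sym_extend p)) =
      (\<Sum>u\<in>keys p. if length u = n then lookup (lookup (scale f (sym_extend p)) u) m * ?\<sigma> u else 0)"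
    unfolding symmetrized_coeff_def by (rule sum_keys_superset) (simp_all add: keys)
  also have "\<dots> = (\<Sum>u\<in>keys p. lookup f m * (lookup (degree_part n p) u * ?\<sigma> u))"
  proof (rule sum.cong)
    fix u
    have "lookup (f * const b) m = lookup f m * b" for b
      using lookup_const_mult[of b f m] by (simp add: mult.commute)
    then show "(if length u = n then lookup (lookup (scale f (sym_extend p)) u) m * ?\<sigma> u else 0) =
        lookup f m * (lookup (degree_part n p) u * ?\<sigma> u)"
      by (simp add: lookup_scale lookup_sym_extend lookup_degree_part)
  qed simp
  also have "\<dots> = lookup f m * (\<Sum>u\<in>keys p. lookup (degree_part n p) u * ?\<sigma> u)"
    by (simp only: sum_distrib_left)
  also have "(\<Sum>u\<in>keys p. lookup (degree_part n p) u * ?\<sigma> u) =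
      (\<Sum>u\<in>keys (degree_part n p). lookup (degree_part n p) u * ?\<sigma> u)"
    by (rule sum_keys_superset[symmetric, where F = "\<lambda>u b. b * ?\<sigma> u"])
       (auto simp: in_keys_iff lookup_degree_part split: if_splits)
  also have "\<dots> = lookup (braided_symmetrizer c n (degree_part n p)) z"
    by (rule rat_linear_expand[OF braided_symmetrizer_linear, symmetric])
  finally show ?thesis .
qed

lemma symmetrized_coeff_span:
  assumes "x \<in> sym_span (nichols_ideal X c)" shows "symmetrized_coeff c n m z x = 0"
  using assms
proof (induction rule: sym_span_induct)
  case zero
  then show ?case by (simp add: symmetrized_coeff_def)
next
  case (step f p y)
  then show ?case by (simp add: symmetrized_coeff_add symmetrized_coeff_extend nichols_ideal_def)
qed

section \<open>Normal words\<close>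

lemma single_eq_scale: "single w f = scale f (sym_extend (word w))"
  by simp

lemma free_ideal_closed:
  assumes "ideal I (free_algebra UNIV)"
  shows "p \<in> I \<Longrightarrow> q \<in> I \<Longrightarrow> p + q \<in> I" "0 \<in> I" "p \<in> I \<Longrightarrow> q * p \<in> I" "p \<in> I \<Longrightarrow> p * q \<in> I"
proof -
  have sub: "additive_subgroup I (free_algebra UNIV)" by (rule ideal.axioms(1)[OF assms])
  show "p \<in> I \<Longrightarrow> q \<in> I \<Longrightarrow> p + q \<in> I" "0 \<in> I"
    using additive_subgroup.a_closed[OF sub, of p q] additive_subgroup.zero_closed[OF sub]
    by (simp_all add: free_algebra_def)
  show "p \<in> I \<Longrightarrow> q * p \<in> I" "p \<in> I \<Longrightarrow> p * q \<in> I"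
    using ideal.I_l_closed[OF assms, of p q] ideal.I_r_closed[OF assms, of p q]
    by (simp_all add: free_algebra_def)
qed

lemma nil_coxeter_ideal_mult:
  assumes "p \<in> nil_coxeter_ideal a \<theta>"
  shows "q * p \<in> nil_coxeter_ideal a \<theta>" "p * q \<in> nil_coxeter_ideal a \<theta>"
  using assms unfolding nil_coxeter_ideal_def genideal_def by (blast intro: free_ideal_closed)+

lemma nil_coxeter_ideal_add:
  assumes "p \<in> nil_coxeter_ideal a \<theta>" "q \<in> nil_coxeter_ideal a \<theta>"
  shows "p + q \<in> nil_coxeter_ideal a \<theta>"
  using assms unfolding nil_coxeter_ideal_def genideal_def by (blast intro: free_ideal_closed)+

lemma nil_coxeter_ideal_0: "0 \<in> nil_coxeter_ideal a \<theta>"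
  unfolding nil_coxeter_ideal_def genideal_def by (blast intro: free_ideal_closed)+

lemma nil_coxeter_ideal_square: "word [i, i] \<in> nil_coxeter_ideal a \<theta>"
  unfolding nil_coxeter_ideal_def genideal_def by blast

lemma nil_coxeter_ideal_braid:
  "i \<noteq> j \<Longrightarrow> coxeter_order a \<theta> i j \<noteq> 0 \<Longrightarrow>
    word (alternating i j (coxeter_order a \<theta> i j)) - word (alternating j i (coxeter_order a \<theta> i j))
      \<in> nil_coxeter_ideal a \<theta>"
  unfolding nil_coxeter_ideal_def genideal_def by blast

lemma word_append: "word (u @ v) = word u * word v"
  by (simp add: mult_single plus_list_def)

lemma nil_coxeter_ideal_braid_equiv:
  "braid_equiv (coxeter_order a \<theta>) u v \<Longrightarrow> word u - word v \<in> nil_coxeter_ideal a \<theta>"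
proof (induction rule: braid_equiv.induct)
  case (refl u)
  then show ?case by (simp add: nil_coxeter_ideal_0)
next
  case (sym u v)
  then show ?case using nil_coxeter_ideal_mult(1)[of "word u - word v" a \<theta> "-1"] by simp
next
  case (trans u v w)
  then show ?case using nil_coxeter_ideal_add[of "word u - word v" a \<theta> "word v - word w"] by simp
next
  case (braid i j x y)
  from nil_coxeter_ideal_mult(2)[OF nil_coxeter_ideal_mult(1)[OF nil_coxeter_ideal_braid[OF braid]], of "word x" "word y"]
  show ?case by (simp only: word_append left_diff_distrib right_diff_distrib mult.assoc)
qed

context affine_root_datum_sym begin

lemma affine_basis_root: "(\<alpha>, k) \<in> affine_basis \<Delta> a \<Longrightarrow> \<alpha> \<in> \<Delta>"
  by (simp add: affine_basis_def positive_roots_def)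

sublocale nil: twisted_letters_ideal "UNIV :: 'i option set" "\<lambda>i. sym_reflection a (node_root a \<theta> i)"
    "\<lambda>i. divided_difference a (node_root a \<theta> i)" "nil_coxeter_ideal a \<theta>"
  by standard
     (simp_all add: sym_reflection_linear divided_difference_linear node_root_in nil_coxeter_ideal_mult)

sublocale nichols: twisted_letters "affine_basis \<Delta> a" "\<lambda>(\<alpha>, k). sym_reflection a \<alpha>"
    "\<lambda>(\<alpha>, k). divided_difference a \<alpha>"
  by standard
     (auto simp: sym_reflection_linear divided_difference_linear dest: affine_basis_root)

sublocale involution_braiding "affine_basis \<Delta> a" "affine_braiding \<Delta> a" affine_root_reflection
proof
  fix x assume "x \<in> affine_basis \<Delta> a"
  then show "affine_root_reflection x \<circ> affine_root_reflection x = id"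
    using affine_reflection_involution[OF root_nonzero[OF affine_basis_root]] by (cases x) auto
qed (rule affine_braiding_letters)

lemma nonreduced_word_in_ideal:
  assumes "\<not> is_reduced u" shows "word u \<in> nil_coxeter_ideal a \<theta>"
proof -
  obtain x i y where "braid_equiv (coxeter_order a \<theta>) u (x @ [i, i] @ y)"
    using nonreduced_braid_equiv_square[OF assms] by blast
  then have "word u - word (x @ [i, i] @ y) \<in> nil_coxeter_ideal a \<theta>"
    by (rule nil_coxeter_ideal_braid_equiv)
  moreover have "word (x @ [i, i] @ y) \<in> nil_coxeter_ideal a \<theta>"
    unfolding word_append[of x] word_append[of "[i, i]"]
    by (intro nil_coxeter_ideal_mult nil_coxeter_ideal_square)
  ultimately show ?thesis using nil_coxeter_ideal_add by fastforce
qed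

text \<open>
  The choice is made by the element of the affine Weyl group alone, so words of the same element get the
  same normal word.
\<close>

definition normal_word :: "'i option list \<Rightarrow> 'i option list"
  where "normal_word u = (SOME v. is_reduced v \<and> \<pi> v = \<pi> u)"

lemma normal_word: "is_reduced (normal_word u)" "\<pi> (normal_word u) = \<pi> u"
  using someI_ex[OF reduced_word_exists[of "simple_reflection a \<theta>" u]] unfolding normal_word_def by auto

lemma normal_word_cong: "\<pi> u = \<pi> v \<Longrightarrow> normal_word u = normal_word v"
  by (simp add: normal_word_def)

text \<open>
  The normal words span the nil-Hecke algebra over \<open>S\<close>: a word is zero if it is not reduced, and it
  equals the normal word of its element if it is.
\<close>

lemma reduce_mod_ideal:
  "\<exists>q. (\<forall>w\<in>keys q. is_reduced w \<and> normal_word w = w) \<and> p - q \<in> sym_span (nil_coxeter_ideal a \<theta>)"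
proof -
  let ?N = "\<lambda>w f. if is_reduced w then single (normal_word w) f else 0"
  define q where "q = (\<Sum>w\<in>keys p. ?N w (lookup p w))"
  have "single w f - ?N w f \<in> sym_span (nil_coxeter_ideal a \<theta>)" for w f
  proof (cases "is_reduced w")
    case True
    then have "word w - word (normal_word w) \<in> nil_coxeter_ideal a \<theta>"
      using Matsumoto[OF True normal_word(1)] normal_word(2) by (intro nil_coxeter_ideal_braid_equiv) simp
    from sym_span_base[OF this, of f] show ?thesis using True by (simp add: sym_extend_diff scale_diff)
  next
    case False
    from sym_span_base[OF nonreduced_word_in_ideal[OF this], of f] show ?thesis using False by simp
  qed
  then have "(\<Sum>w\<in>keys p. single w (lookup p w) - ?N w (lookup p w)) \<in> sym_span (nil_coxeter_ideal a \<theta>)"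
    by (intro sym_span_sum)
  then have "p - q \<in> sym_span (nil_coxeter_ideal a \<theta>)"
    by (simp add: sum_subtractf q_def flip: poly_mapping_sum_single)
  moreover have "is_reduced w \<and> normal_word w = w" if "w \<in> keys q" for w
  proof -
    have "w \<in> (\<Union>v\<in>keys p. keys (?N v (lookup p v)))"
      using that keys_sum[of "\<lambda>w. ?N w (lookup p w)" "keys p"] unfolding q_def by blast
    then obtain v where "w = normal_word v" by (auto split: if_splits)
    then show ?thesis using normal_word[of v] normal_word_cong by metis
  qed
  ultimately show ?thesis by blast
qed

section \<open>Linear independence of the images\<close>

text \<open>
  The basis letter that is the image of \<open>\<tau>\<^sub>i\<close> up to sign; for \<open>i = 0\<close> it is
  \<open>[\<theta>,1] = - [-\<theta>,-1]\<close>.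
\<close>

fun node_letter :: "'i option \<Rightarrow> 'v \<times> int" where
  "node_letter None = (\<theta>, 1)"
| "node_letter (Some i) = (a i, 0)"

definition word_sign :: "'i option list \<Rightarrow> rat"
  where "word_sign u = (\<Prod>i\<leftarrow>u. if i = None then -1 else 1)"

definition word_image :: "'i option list \<Rightarrow> (('v \<times> int) list \<Rightarrow>\<^sub>0 rat)"
  where "word_image u = single (map node_letter u) (word_sign u)"

lemma node_letter_in: "node_letter i \<in> affine_basis \<Delta> a"
  by (cases i) (simp_all add: affine_basis_def positive_roots_def theta_root theta_nonneg simple_root nonneg_combs_single)

lemma node_letter_reflection: "affine_root_reflection (node_letter i) = simple_reflection a \<theta> i"
  by (cases i) simp_all

lemma affine_symbol_node: "affine_symbol \<Delta> a (node_root a \<theta> i) (node_level i) = word_image [i]"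
proof (cases i)
  case None
  have "- \<theta> \<notin> nonneg_combs a"
    using nonneg_combs_both[OF simple theta_nonneg] root_nonzero[OF theta_root] by blast
  then show ?thesis
    using None by (simp add: affine_symbol_def positive_roots_def word_image_def word_sign_def single_uminus)
next
  case (Some k)
  then show ?thesis
    by (simp add: affine_symbol_def positive_roots_def simple_root nonneg_combs_single word_image_def word_sign_def)
qed

lemma word_image_Cons: "word_image (i # w) = word_image [i] * word_image w"
  by (simp add: word_image_def word_sign_def mult_single plus_list_def)

lemma word_image_keys: "keys (word_image w) \<subseteq> lists (affine_basis \<Delta> a)"
  using node_letter_in by (auto simp: word_image_def in_lists_conv_set)

abbreviation "nil_coset \<equiv> a_r_coset
  (free_cross_product UNIV (\<lambda>i. sym_reflection a (node_root a \<theta> i)) (\<lambda>i. divided_difference a (node_root a \<theta> i)))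
  (sym_span (nil_coxeter_ideal a \<theta>))"

abbreviation "nichols_coset \<equiv> a_r_coset
  (free_cross_product (affine_basis \<Delta> a) (\<lambda>(\<alpha>, k). sym_reflection a \<alpha>) (\<lambda>(\<alpha>, k). divided_difference a \<alpha>))
  (sym_span (affine_nichols_ideal \<Delta> a))"

text \<open>
  The \<open>S\<close>-linear map of free cross products that lifts the homomorphism.
\<close>

definition free_map :: "('i option list \<Rightarrow>\<^sub>0 'i sym) \<Rightarrow> (('v \<times> int) list \<Rightarrow>\<^sub>0 'i sym)"
  where "free_map p = (\<Sum>w\<in>keys p. scale (lookup p w) (sym_extend (word_image w)))"

lemma free_map_add: "free_map (p + q) = free_map p + free_map q"
  unfolding free_map_def by (rule setsum_keys_plus_distrib) simp_all

lemma free_map_diff: "free_map (p - q) = free_map p - free_map q"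
  using free_map_add[of "p - q" q] by simp

text \<open>
  Take a normal word \<open>u\<close> and a monomial \<open>m\<close> occurring in its coefficient.  The symmetrized image has
  at \<open>m\<close> and the word of \<open>u\<close> a contribution of \<open>u\<close> alone, up to sign the coefficient of \<open>m\<close>, because
  other normal words represent other elements.
\<close>

theorem free_map_injective_on_normal_words:
  assumes "\<And>w. w \<in> keys p \<Longrightarrow> is_reduced w \<and> normal_word w = w"
    and "free_map p \<in> sym_span (affine_nichols_ideal \<Delta> a)"
  shows "p = 0"
proof (rule ccontr)
  assume "p \<noteq> 0"
  then obtain u where u: "u \<in> keys p" by (metis all_not_in_conv keys_eq_empty)
  then have "lookup p u \<noteq> 0" by (simp add: in_keys_iff)
  then obtain m where m: "lookup (lookup p u) m \<noteq> 0" by (metis lookup_zero poly_mapping_eqI)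
  let ?T = "symmetrized_coeff (affine_braiding \<Delta> a) (length u) m (map node_letter u)"
  have T: "?T (scale f (sym_extend (word_image w))) = (if w = u then lookup f m * word_sign u else 0)"
    if w: "w \<in> keys p" for w f
  proof -
    have c: "lookup (f * const b) m = lookup f m * b" for b
      using lookup_const_mult[of b f m] by (simp add: mult.commute)
    have neq: "\<pi> w \<noteq> \<pi> u" if "w \<noteq> u"
      using assms(1)[OF w] assms(1)[OF u] normal_word_cong that by metis
    show ?thesis
    proof (cases "length w = length u")
      case True
      then show ?thesis
        using symmetrizer_coefficient[of node_letter "simple_reflection a \<theta>" u w] neq
          assms(1)[OF u] node_letter_in node_letter_reflection
        by (simp add: word_image_def symmetrized_coeff_single c)
    next
      case False
      then show ?thesis by (auto simp: word_image_def symmetrized_coeff_single)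
    qed
  qed
  have "?T (free_map p) = (\<Sum>w\<in>keys p. ?T (scale (lookup p w) (sym_extend (word_image w))))"
    unfolding free_map_def by (rule additive_sum) (rule symmetrized_coeff_add)
  also have "\<dots> = (\<Sum>w\<in>keys p. if w = u then lookup (lookup p w) m * word_sign u else 0)"
    by (rule sum.cong) (simp_all add: T)
  also have "\<dots> = lookup (lookup p u) m * word_sign u" using u by simp
  finally have "lookup (lookup p u) m * word_sign u = 0"
    using symmetrized_coeff_span[OF assms(2)[unfolded affine_nichols_ideal_def]] by simp
  moreover have "word_sign u \<noteq> 0" by (auto simp: word_sign_def prod_list_zero_iff)
  ultimately show False using m by simp
qed

end

section \<open>Injectivity\<close>

locale nil_hecke_hom = affine_root_datum_sym \<Delta> a \<theta>
  for \<Delta> :: "'v::euclidean_space set" and a :: "'i::{finite,linorder} \<Rightarrow> 'v" and \<theta> :: 'v +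
  fixes \<phi> :: "('i option list \<Rightarrow>\<^sub>0 'i sym) set \<Rightarrow> (('v \<times> int) list \<Rightarrow>\<^sub>0 'i sym) set"
  assumes hom: "\<phi> \<in> ring_hom (nil_hecke a \<theta>) (nichols_cross \<Delta> a)"
    and hom_tau: "\<phi> (nil_hecke_tau a \<theta> i) = nichols_cross_symbol \<Delta> a (node_root a \<theta> i) (node_level i)"
    and hom_sym: "\<phi> (nil_hecke_of_sym a \<theta> f) = nichols_cross_of_sym \<Delta> a f"
begin

lemma nil_coset_in: "nil_coset p \<in> carrier (nil_hecke a \<theta>)"
  by (auto simp: nil_hecke_def cross_product_carrier)

text \<open>
  The source product is a coset by \<open>nil.cross_product_mult_extend\<close>, so it has an image in the carrier.
  Hence the target product is a single coset, and is known from one pair of representatives.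
\<close>

lemma hom_mult:
  assumes "\<phi> (nil_coset (scale f (sym_extend p))) = nichols_coset (scale g (sym_extend p'))"
    and "\<phi> (nil_coset (sym_extend q)) = nichols_coset (sym_extend q')"
    and "keys p' \<subseteq> lists (affine_basis \<Delta> a)"
  shows "\<phi> (nil_coset (scale f (sym_extend (p * q)))) = nichols_coset (scale g (sym_extend (p' * q')))"
proof -
  let ?A = "nil_coset (scale f (sym_extend p))" and ?B = "nil_coset (sym_extend q)"
  have AB: "?A \<otimes>\<^bsub>nil_hecke a \<theta>\<^esub> ?B = nil_coset (scale f (sym_extend (p * q)))"
    unfolding nil_hecke_def by (rule nil.cross_product_mult_extend) simp_all
  have eq: "\<phi> (?A \<otimes>\<^bsub>nil_hecke a \<theta>\<^esub> ?B) =
      nichols_coset (scale g (sym_extend p')) \<otimes>\<^bsub>nichols_cross \<Delta> a\<^esub> nichols_coset (sym_extend q')"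
    using ring_hom_mult[OF hom nil_coset_in nil_coset_in] assms(1,2) by simp
  have "\<phi> (?A \<otimes>\<^bsub>nil_hecke a \<theta>\<^esub> ?B) \<in> carrier (nichols_cross \<Delta> a)"
    unfolding AB by (rule ring_hom_closed[OF hom nil_coset_in])
  then have "\<phi> (?A \<otimes>\<^bsub>nil_hecke a \<theta>\<^esub> ?B) = nichols_coset
      (cross_mult (\<lambda>(\<alpha>, k). sym_reflection a \<alpha>) (\<lambda>(\<alpha>, k). divided_difference a \<alpha>)
        (scale g (sym_extend p')) (sym_extend q'))"
    unfolding eq nichols_cross_def by (rule cross_product_mult_in_carrier)
  then show ?thesis unfolding AB nichols.cross_mult_extend[OF assms(3)] .
qed

lemma hom_word: "\<phi> (nil_coset (sym_extend (word w))) = nichols_coset (sym_extend (word_image w))"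
proof (induction w)
  case Nil
  have "\<phi> \<one>\<^bsub>nil_hecke a \<theta>\<^esub> = \<one>\<^bsub>nichols_cross \<Delta> a\<^esub>" by (rule ring_hom_one[OF hom])
  then show ?case
    by (simp add: nil_hecke_def nichols_cross_def cross_product_one word_image_def word_sign_def)
next
  case (Cons i w)
  have "\<phi> (nil_coset (sym_extend (word [i]))) = nichols_coset (sym_extend (word_image [i]))"
    using hom_tau[of i]
    unfolding affine_symbol_node nil_hecke_tau_def nichols_cross_symbol_def cross_of_alg_def .
  then have "\<phi> (nil_coset (scale 1 (sym_extend (word [i] * word w)))) =
      nichols_coset (scale 1 (sym_extend (word_image [i] * word_image w)))"
    using Cons word_image_keys by (intro hom_mult) (simp_all del: sym_extend_simps)
  then show ?case
    by (simp only: scale_simps word_image_Cons[of i w] word_append[of "[i]" w, simplified append.simps])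
qed

lemma hom_single: "\<phi> (nil_coset (single w f)) = nichols_coset (scale f (sym_extend (word_image w)))"
proof -
  have one: "word [] = 1" by (simp flip: zero_list_def)
  have "\<phi> (nil_coset (scale f (sym_extend (word [])))) = nichols_coset (scale f (sym_extend (word [])))"
    using hom_sym[of f] by (simp add: nil_hecke_of_sym_def nichols_cross_of_sym_def cross_of_sym_def)
  then have "\<phi> (nil_coset (scale f (sym_extend (word [] * word w)))) =
      nichols_coset (scale f (sym_extend (word [] * word_image w)))"
    using hom_word by (intro hom_mult) simp_all
  then show ?thesis unfolding single_eq_scale[of w f] by (simp only: one mult_1_left)
qed

text \<open>
  The product \<open>f \<tau>\<^sub>i \<tau>\<^sub>j \<cdots>\<close> is computed by multiplying from the left, so that every right factor
  is a word with constant coefficient.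
\<close>

lemma hom_free_map: "\<phi> (nil_coset p) = nichols_coset (free_map p)"
proof -
  have "\<phi> (nil_coset (\<Sum>w\<in>A. single w (g w))) =
      nichols_coset (\<Sum>w\<in>A. scale (g w) (sym_extend (word_image w)))" if "finite A" for A g
    using that
  proof (induction A rule: finite_induct)
    case empty
    show ?case using hom_single[of "[]" 0] by simp
  next
    case (insert w A)
    have "nil_coset (single w (g w) + (\<Sum>w\<in>A. single w (g w))) =
        nil_coset (single w (g w)) \<oplus>\<^bsub>nil_hecke a \<theta>\<^esub> nil_coset (\<Sum>w\<in>A. single w (g w))"
      unfolding nil_hecke_def cross_product_add ..
    then have "\<phi> (nil_coset (single w (g w) + (\<Sum>w\<in>A. single w (g w)))) =
        nichols_coset (scale (g w) (sym_extend (word_image w))) \<oplus>\<^bsub>nichols_cross \<Delta> a\<^esub>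
        nichols_coset (\<Sum>w\<in>A. scale (g w) (sym_extend (word_image w)))"
      using ring_hom_add[OF hom nil_coset_in nil_coset_in] hom_single insert.IH by simp
    then show ?case
      using insert.hyps by (simp add: nichols_cross_def cross_product_add)
  qed
  from this[where A = "keys p" and g = "lookup p", OF finite_keys] show ?thesis
    unfolding free_map_def by (simp flip: poly_mapping_sum_single)
qed

theorem inj_hom: "inj_on \<phi> (carrier (nil_hecke a \<theta>))"
proof (rule inj_onI)
  fix x y assume "x \<in> carrier (nil_hecke a \<theta>)" "y \<in> carrier (nil_hecke a \<theta>)" and eq: "\<phi> x = \<phi> y"
  then obtain p q where xy: "x = nil_coset p" "y = nil_coset q"
    by (auto simp: nil_hecke_def cross_product_carrier)
  obtain r where r: "\<And>w. w \<in> keys r \<Longrightarrow> is_reduced w \<and> normal_word w = w"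
    "(p - q) - r \<in> sym_span (nil_coxeter_ideal a \<theta>)"
    using reduce_mod_ideal by blast
  have "free_map (p - q) \<in> sym_span (affine_nichols_ideal \<Delta> a)"
    using eq unfolding xy hom_free_map by (simp add: sym_coset_eq_iff free_map_diff)
  moreover have "nil_coset (p - q) = nil_coset r" using r(2) by (simp add: sym_coset_eq_iff)
  then have "\<phi> (nil_coset (p - q)) = \<phi> (nil_coset r)" by simp
  then have "free_map (p - q) - free_map r \<in> sym_span (affine_nichols_ideal \<Delta> a)"
    unfolding hom_free_map by (simp add: sym_coset_eq_iff)
  ultimately have "free_map (p - q) - (free_map (p - q) - free_map r) \<in> sym_span (affine_nichols_ideal \<Delta> a)"
    by (rule sym_span_diff)
  then have "r = 0" using free_map_injective_on_normal_words[OF r(1)] by simp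
  then show "x = y" using r(2) xy by (simp add: sym_coset_eq_iff)
qed

end

theorem theorem3p1:
  fixes \<Delta> :: "'v::euclidean_space set"
    and a :: "'i::{finite,linorder} \<Rightarrow> 'v"
    and \<theta> :: 'v
    and \<phi> :: "('i option list \<Rightarrow>\<^sub>0 'i sym) set \<Rightarrow> (('v \<times> int) list \<Rightarrow>\<^sub>0 'i sym) set"
  assumes "irreducible_root_system \<Delta>"
    and "simple_roots \<Delta> a"
    and "highest_root \<Delta> a \<theta>"
    and "\<phi> \<in> ring_hom (nil_hecke a \<theta>) (nichols_cross \<Delta> a)"
    and "\<phi> (nil_hecke_tau a \<theta> None) = nichols_cross_symbol \<Delta> a (- \<theta>) (-1)"
    and "\<And>i. \<phi> (nil_hecke_tau a \<theta> (Some i)) = nichols_cross_symbol \<Delta> a (a i) 0"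
    and "\<And>f. \<phi> (nil_hecke_of_sym a \<theta> f) = nichols_cross_of_sym \<Delta> a f"
  shows "inj_on \<phi> (carrier (nil_hecke a \<theta>))"
proof -
  interpret affine_root_datum_sym \<Delta> a \<theta>
    using assms(1-3) by unfold_locales (simp_all add: irreducible_root_system_def)
  have "\<phi> (nil_hecke_tau a \<theta> i) = nichols_cross_symbol \<Delta> a (node_root a \<theta> i) (node_level i)" for i
    using assms(5,6) by (cases i) simp_all
  then interpret nil_hecke_hom \<Delta> a \<theta> \<phi>
    using assms(4,7) by unfold_locales
  show ?thesis by (rule inj_hom)
qed

end
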